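(* Let $A=\mathbb F_q[t]$, $C=\mathbb P^1_{\mathbb F_q}$, $K=\mathbb F_q(\theta)$ with $\gamma:A\to K$, $\gamma(t)=\theta$, and let $\underline{\mathcal C}=(K[t],\tau_{\mathcal C}=t-\theta)$ be the Carlitz motive. Let $\omega=1$ be the generator of $\mathrm H^1_{\rm dR}(\underline{\mathcal C},K[[z-\zeta]])=K[[z-\zeta]]$ and let $u\in \mathrm H_{1,\rm Betti}(\underline{\mathcal C},\mathbb F_q[t])$ be the generator dual to the generator $\beta\ell^-_\zeta$ of $\mathrm H^1_{\rm Betti}(\underline{\mathcal C},\mathbb F_q[t])$. Then, when the divergent sum over the finite places is interpreted by the regularization convention stated in the context, applied with the trivial character $a=\mathbf 1$, one has $$\log\prod_{\text{all }v}\Bigl|\int_u\omega\Bigr|_v=\log\Bigl|\int_u\omega\Bigr|_\infty+\sum_{v\neq\infty}\log\Bigl|\int_u\omega\Bigr|_v=0,$$ i.e. the value of the product $\prod_v|\int_u\omega|_v$ is $1$.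
   Context: **Notation.** $Q=\mathbb F_q(t)$, identified with $K$ via $t\mapsto\theta$ when regarded as coefficients; $\infty$ is the pole of $t$. $\zeta=1/\theta$, $z=1/t$. $\mathbb C_\infty$ is the completion of an algebraic closure of $\mathbb F_q((\zeta))$ with $|\zeta|_\infty=q^{-1}$. For a finite place $v$ of $Q$, i.e. a maximal ideal $v=(z_v)\subset\mathbb F_q[t]$, put $\zeta_v=\gamma(z_v)$, $\mathbb F_v=A/v$, $q_v=\#\mathbb F_v$; $A_v=\mathbb F_v[[z_v]]$; $\mathbb C_v$ is the completion of an algebraic closure of $K_v=\mathbb F_v((\zeta_v))$ with $|\zeta_v|_v=q_v^{-1}$. Fix embeddings of an algebraic closure of $K$ into $\mathbb C_\infty$ and into each $\mathbb C_v$. $\sigma$ denotes the map raising coefficients in $K$, $\mathbb C_\infty$, etc. to the $q$-th power and fixing $t$. **Betti realization.** $\mathrm H^1_{\rm Betti}(\underline{\mathcal C},A)=\{f\in\mathbb C_\infty\langle t\rangle: f=(t-\theta)\sigma(f)\}$ ($\mathbb C_\infty\langle t\rangle$ the Tate algebra). It equals $A\cdot\beta\ell^-_\zeta$, where $\beta\in\mathbb C_\infty$ satisfies $\beta^{q-1}=-\zeta$ and $\ell^-_\zeta=\prod_{i\ge0}(1-\zeta^{q^i}t)$. $\mathrm H_{1,\rm Betti}$ is its $A$-dual. **Periods.** The de Rham realization is $\mathrm H^1_{\rm dR}(\underline{\mathcal C},K[[z-\zeta]])=K[[z-\zeta]]\cdot\omega$ (completion of $K[t]$ at $t=\theta$).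 The isomorphism $h_{\rm Betti,dR}$ sends $f\in \mathrm H^1_{\rm Betti}$ to $\sigma(f)|_{t=\theta}\cdot\omega$. Thus $|\int_u\omega|_\infty=|\langle\omega,u\rangle_\infty|_\infty$ with $\langle\omega,u\rangle_\infty=\bigl(\sigma(\beta\ell^-_\zeta)|_{t=\theta}\bigr)^{-1}$. For $v\ne\infty$, the $v$-adic completion of $\beta\ell^-_\zeta$ (its system of reductions mod $v^n$) lies in $\varprojlim_nA/v^n\otimes_{\mathbb F_q}K^{\rm sep}$; let $f_{v,0}\in K_v^{\rm sep}[[z_v]]$ be its image under the quotient map by $(a\otimes1-1\otimes\gamma(a):a\in\mathbb F_v)$, expanded as a power series in $z_v-\zeta_v$. The comparison isomorphism sends $\beta\ell^-_\zeta$ to $(t-\theta)^{-1}f_{v,0}\cdot\omega$, so $\langle\omega,u\rangle_v=(t-\theta)f_{v,0}^{-1}\in\mathbb C_v((z_v-\zeta_v))$. For $0\ne x\in\mathbb C_v((z_v-\zeta_v))$ with $\hat v(x)=\mathrm{ord}_{z_v-\zeta_v}(x)$ put $|x|_v=|(z_v-\zeta_v)^{-\hat v(x)}x\bmod(z_v-\zeta_v)|_v$, and $|\int_u\omega|_v:=|\langle\omega,u\rangle_v|_v$. **Regularization convention.** For a complex character $\chi$ of $\mathcal G_Q=\mathrm{Gal}(Q^{\rm sep}/Q)$ with open kernel representation, let $L_v(\chi,s)$ be the Euler factor at $v$ of its Artin $L$-function, $L^\infty(\chi,s)=\prod_{v\ne\infty}L_v(\chi,s)$ (meromorphically continued), $Z^\infty(\chi,s)=\frac{\frac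 d{ds}L^\infty(\chi,s)}{L^\infty(\chi,s)}$, $Z_v(\chi,s)=\frac{\frac d{ds}L_v(\chi,s)}{-L_v(\chi,s)\log q_v}$ (so $Z^\infty=-\sum_{v\ne\infty}Z_v\log q_v$), and $\mu^\infty_{\rm Art}(\chi)=\sum_{v\ne\infty}\mu_{{\rm Art},v}(\chi)\log q_v$ with $\mu_{{\rm Art},v}(\chi)$ the exponent at $v$ of the Artin conductor; extend linearly to locally constant $\mathbb Q$-valued class functions $a$. Put $a^*(g)=a(g^{-1})$. If $(x_v)_{v\ne\infty}$ are complex numbers with $x_v=-Z_v(a,1)\log q_v$ for all but finitely many $v$, and $Z^\infty(a^*,s)$ has no pole at $s=0$, then the (divergent) series $\sum_{v\ne\infty}x_v$ is given the value $-Z^\infty(a^*,0)-\mu^\infty_{\rm Art}(a)+\sum_{v\ne\infty}(x_v+Z_v(a,1)\log q_v)$. Here $x_v=\log|\int_u\omega|_v$ and $a=\mathbf 1$ (so that $L^\infty(\mathbf 1,s)=\prod_{v\ne\infty}(1-q_v^{-s})^{-1}$). *)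

theory Defs
  imports
    "HOL-Complex_Analysis.Complex_Analysis"
    "HOL-Algebra.Algebraic_Closure_Type"
begin


section \<open>The fields\<close>

text \<open>
  The finite field with \<open>q\<close> elements is a type \<open>'q :: {finite, field}\<close>; \<open>A\<close> is \<open>'q poly\<close> (variable
  \<open>t\<close>), \<open>K\<close> is \<open>'q poly fract\<close> (variable \<open>\<theta>\<close>), and \<open>\<gamma> : A \<rightarrow> K\<close> is \<open>to_fract\<close>.  The algebraic closure
  of \<open>K\<close> is the library's \<open>'q poly fract alg_closure\<close>, with \<open>to_ac\<close> the inclusion of \<open>K\<close>.
\<close>

type_synonym 'q ratbar = "'q poly fract alg_closure"

definition ring_embedding :: "('a::field \<Rightarrow> 'b::field) \<Rightarrow> bool" where
  "ring_embedding f \<longleftrightarrow> f 1 = 1 \<and> (\<forall>x y. f (x + y) = f x + f y) \<and> (\<forall>x y. f (x * y) = f x * f y)"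

definition nonarchimedean_abs :: "('c::field \<Rightarrow> real) \<Rightarrow> bool" where
  "nonarchimedean_abs a \<longleftrightarrow>
     (\<forall>x. 0 \<le> a x) \<and> (\<forall>x. a x = 0 \<longleftrightarrow> x = 0) \<and>
     (\<forall>x y. a (x * y) = a x * a y) \<and> (\<forall>x y. a (x + y) \<le> max (a x) (a y))"

text \<open>
  The fields \<open>\<complex>\<^sub>v\<close> carry their absolute value as an explicit function, since several absolute values
  live on one type below.
\<close>

definition abs_topology :: "('c::field \<Rightarrow> real) \<Rightarrow> 'c topology" where
  "abs_topology a = Metric_space.mtopology UNIV (\<lambda>x y. a (x - y))"

definition abs_complete :: "('c::field \<Rightarrow> real) \<Rightarrow> bool" where
  "abs_complete a \<longleftrightarrow> Metric_space.mcomplete UNIV (\<lambda>x y. a (x - y))"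

definition abs_sums :: "('c::field \<Rightarrow> real) \<Rightarrow> (nat \<Rightarrow> 'c) \<Rightarrow> 'c \<Rightarrow> bool" where
  "abs_sums a f l \<longleftrightarrow> limitin (abs_topology a) (\<lambda>n. \<Sum>i<n. f i) l sequentially"

definition abs_lim :: "('c::field \<Rightarrow> real) \<Rightarrow> (nat \<Rightarrow> 'c) \<Rightarrow> 'c" where
  "abs_lim a f = (THE l. limitin (abs_topology a) f l sequentially)"

definition abs_suminf :: "('c::field \<Rightarrow> real) \<Rightarrow> (nat \<Rightarrow> 'c) \<Rightarrow> 'c" where
  "abs_suminf a f = (THE l. abs_sums a f l)"

definition algebraic_elements :: "'c::field set \<Rightarrow> 'c set" where
  "algebraic_elements k = {x. \<exists>p. p \<noteq> 0 \<and> (\<forall>i. poly.coeff p i \<in> k) \<and> poly p x = 0}"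

text \<open>
  \<open>completed_closure \<iota> a\<close>: the field \<open>'c\<close> with absolute value \<open>a\<close> is the completion of an algebraic
  closure of the completion of \<open>K\<close> at the place that \<open>a\<close> induces on \<open>K\<close>, and \<open>\<iota>\<close> is an embedding of
  the algebraic closure of \<open>K\<close> into it.  The completion of \<open>K\<close> is the closure of \<open>\<iota> K\<close> in \<open>'c\<close>; its
  algebraic closure is the set of elements of \<open>'c\<close> that are algebraic over it.
\<close>

definition local_field ::
    "('q::{finite,field} ratbar \<Rightarrow> 'c::field) \<Rightarrow> ('c \<Rightarrow> real) \<Rightarrow> 'c set" where
  "local_field \<iota> a = abs_topology a closure_of range (\<lambda>x. \<iota> (to_ac x))"

definition completed_closure ::
    "('q::{finite,field} ratbar \<Rightarrow> 'c::field) \<Rightarrow> ('c \<Rightarrow> real) \<Rightarrow> bool" where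
  "completed_closure \<iota> a \<longleftrightarrow>
     ring_embedding \<iota> \<and> nonarchimedean_abs a \<and> abs_complete a \<and>
     (let E = algebraic_elements (local_field \<iota> a) in
        (\<forall>p. (\<forall>i. poly.coeff p i \<in> E) \<and> Polynomial.degree p > 0 \<longrightarrow> (\<exists>x\<in>E. poly p x = 0)) \<and>
        abs_topology a closure_of E = UNIV)"

definition gam :: "('q::{finite,field} ratbar \<Rightarrow> 'c::field) \<Rightarrow> 'q poly \<Rightarrow> 'c" where
  "gam \<iota> b = \<iota> (to_ac (to_fract b))"

definition theta :: "('q::{finite,field} ratbar \<Rightarrow> 'c::field) \<Rightarrow> 'c" where
  "theta \<iota> = gam \<iota> [:0, 1:]"

definition scal :: "('q::{finite,field} ratbar \<Rightarrow> 'c::field) \<Rightarrow> 'q \<Rightarrow> 'c" where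
  "scal \<iota> c = gam \<iota> [:c:]"

text \<open>
  A set of finite places is a set \<open>V\<close> containing exactly one generator of every maximal ideal of \<open>A\<close>:
  \<open>v \<in> V\<close> is at the same time the place and its chosen generator \<open>z\<^sub>v\<close>, so \<open>\<zeta>\<^sub>v = gam \<iota> v\<close>.
\<close>

definition finite_places :: "'q::{finite,field} poly set \<Rightarrow> bool" where
  "finite_places V \<longleftrightarrow>
     (\<forall>v\<in>V. Factorial_Ring.irreducible v) \<and>
     (\<forall>p. Factorial_Ring.irreducible p \<longrightarrow> (\<exists>!v. v \<in> V \<and> v dvd p))"

definition qv :: "'q::{finite,field} poly \<Rightarrow> nat" where
  "qv v = CARD('q) ^ Polynomial.degree v"

text \<open>
  \<open>\<complex>\<^sub>\<infinity>\<close> (where \<open>|\<zeta>| = 1/q\<close>) and \<open>\<complex>\<^sub>v\<close> (where \<open>|\<zeta>\<^sub>v| = 1/q\<^sub>v\<close>).  The absolute values on \<open>K\<close> are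
  prescribed on \<open>A\<close>, which determines them.  For varying \<open>v\<close> the fields \<open>\<complex>\<^sub>v\<close> may share one type
  with different absolute values and embeddings: as a topological field each of them is the
  completion of an algebraic closure of \<open>k((X))\<close> with \<open>k\<close> an algebraic closure of the finite field.
\<close>

definition is_C_infinity ::
    "('q::{finite,field} ratbar \<Rightarrow> 'c::field) \<Rightarrow> ('c \<Rightarrow> real) \<Rightarrow> bool" where
  "is_C_infinity \<iota> a \<longleftrightarrow> completed_closure \<iota> a \<and>
     (\<forall>b. b \<noteq> 0 \<longrightarrow> a (gam \<iota> b) = real CARD('q) ^ Polynomial.degree b)"

definition is_C_v ::
    "'q::{finite,field} poly \<Rightarrow> ('q ratbar \<Rightarrow> 'c::field) \<Rightarrow> ('c \<Rightarrow> real) \<Rightarrow> bool" where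
  "is_C_v v \<iota> a \<longleftrightarrow> completed_closure \<iota> a \<and>
     (\<forall>n b. \<not> v dvd b \<longrightarrow> a (gam \<iota> (v ^ n * b)) = (1 / real (qv v)) ^ n)"


section \<open>Betti cohomology of the Carlitz motive\<close>

text \<open>\<open>H1_Betti\<close> belongs to the Carlitz motive \<open>(K[t], \<tau> = t - \<theta>)\<close>; \<open>t\<close> is \<open>fps_X\<close>.\<close>

definition tate_algebra :: "('c::field \<Rightarrow> real) \<Rightarrow> 'c fps set" where
  "tate_algebra a = {f. (\<lambda>n. a (fps_nth f n)) \<longlonglongrightarrow> 0}"

definition sigma :: "nat \<Rightarrow> 'c::field fps \<Rightarrow> 'c fps" where
  "sigma q f = Abs_fps (\<lambda>n. fps_nth f n ^ q)"

definition H1_Betti ::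
    "('q::{finite,field} ratbar \<Rightarrow> 'c::field) \<Rightarrow> ('c \<Rightarrow> real) \<Rightarrow> 'c fps set" where
  "H1_Betti \<iota> a =
     {f \<in> tate_algebra a. f = (fps_X - fps_const (theta \<iota>)) * sigma CARD('q) f}"

definition A_to_fps :: "('q::{finite,field} ratbar \<Rightarrow> 'c::field) \<Rightarrow> 'q poly \<Rightarrow> 'c fps" where
  "A_to_fps \<iota> b = fps_of_poly (map_poly (scal \<iota>) b)"

text \<open>\<open>\<ell>\<^sub>\<zeta>\<^sup>-\<close>, the infinite product of the \<open>1 - \<zeta>^(q^i) t\<close>, as the coefficientwise limit.\<close>

definition ell_minus ::
    "('q::{finite,field} ratbar \<Rightarrow> 'c::field) \<Rightarrow> ('c \<Rightarrow> real) \<Rightarrow> 'c fps" where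
  "ell_minus \<iota> a = Abs_fps (\<lambda>n. abs_lim a (\<lambda>N.
     fps_nth (\<Prod>i<N. 1 - fps_const (inverse (theta \<iota>) ^ (CARD('q) ^ i)) * fps_X) n))"

text \<open>
  The \<open>A\<close>-dual of \<open>H1_Betti\<close>; only the values of \<open>u\<close> on \<open>H1_Betti\<close> are meaningful.
\<close>

definition H_1_Betti ::
    "('q::{finite,field} ratbar \<Rightarrow> 'c::field) \<Rightarrow> ('c \<Rightarrow> real) \<Rightarrow> ('c fps \<Rightarrow> 'q poly) set" where
  "H_1_Betti \<iota> a =
     {u. (\<forall>f\<in>H1_Betti \<iota> a. \<forall>g\<in>H1_Betti \<iota> a. u (f + g) = u f + u g) \<and>
         (\<forall>b. \<forall>f\<in>H1_Betti \<iota> a. u (A_to_fps \<iota> b * f) = b * u f)}"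


section \<open>The period at infinity\<close>

text \<open>
  De Rham classes are given by their coordinate with respect to \<open>\<omega> = 1\<close>.  If \<open>h\<close> is the comparison
  isomorphism of a place, then \<open>\<langle>h f, u\<rangle> = u f\<close> for \<open>f \<in> H1_Betti\<close>, so \<open>\<langle>\<omega>, u\<rangle>\<close> is the element
  \<open>c\<close> with \<open>u f = h f * c\<close> for all \<open>f\<close>.
\<close>

definition h_infinity ::
    "('q::{finite,field} ratbar \<Rightarrow> 'c::field) \<Rightarrow> ('c \<Rightarrow> real) \<Rightarrow> 'c fps \<Rightarrow> 'c" where
  "h_infinity \<iota> a f = abs_suminf a (\<lambda>n. fps_nth (sigma CARD('q) f) n * theta \<iota> ^ n)"

definition pairing_infinity ::
    "('q::{finite,field} ratbar \<Rightarrow> 'c::field) \<Rightarrow> ('c \<Rightarrow> real) \<Rightarrow> ('c fps \<Rightarrow> 'q poly) \<Rightarrow> 'c" where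
  "pairing_infinity \<iota> a u =
     (THE c. \<forall>f\<in>H1_Betti \<iota> a. gam \<iota> (u f) = h_infinity \<iota> a f * c)"

definition abs_period_infinity ::
    "('q::{finite,field} ratbar \<Rightarrow> 'c::field) \<Rightarrow> ('c \<Rightarrow> real) \<Rightarrow> ('c fps \<Rightarrow> 'q poly) \<Rightarrow> real" where
  "abs_period_infinity \<iota> a u = a (pairing_infinity \<iota> a u)"


section \<open>The periods at the finite places\<close>

text \<open>
  In \<open>A\<^sub>v = \<F>\<^sub>v[[z\<^sub>v]]\<close> write \<open>t = \<Sum>i. a\<^sub>i z\<^sub>v\<^sup>i\<close> with \<open>a\<^sub>i \<in> \<F>\<^sub>v\<close>.  \<open>t_expansion\<close> is the power series
  \<open>\<Sum>i. \<gamma>(a\<^sub>i) z\<^sub>v\<^sup>i\<close> over \<open>\<complex>\<^sub>v\<close>, i.e. the image of \<open>t\<close> under the quotient by the \<open>a \<otimes> 1 - 1 \<otimes> \<gamma>(a)\<close>,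
  \<open>a \<in> \<F>\<^sub>v\<close>.  It is determined by the expansion \<open>\<theta> = \<Sum>i. \<gamma>(a\<^sub>i) \<zeta>\<^sub>v\<^sup>i\<close> in \<open>K\<^sub>v = \<F>\<^sub>v((\<zeta>\<^sub>v))\<close>, where
  \<open>\<F>\<^sub>v\<close> is the set of solutions of \<open>x^(q\<^sub>v) = x\<close>.
\<close>

definition t_expansion ::
    "'q::{finite,field} poly \<Rightarrow> ('q ratbar \<Rightarrow> 'c::field) \<Rightarrow> ('c \<Rightarrow> real) \<Rightarrow> 'c fps" where
  "t_expansion v \<iota> a =
     (THE T. (\<forall>i. fps_nth T i ^ qv v = fps_nth T i) \<and>
             abs_sums a (\<lambda>i. fps_nth T i * gam \<iota> v ^ i) (theta \<iota>))"

definition subst_t ::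
    "'q::{finite,field} poly \<Rightarrow> ('q ratbar \<Rightarrow> 'c::field) \<Rightarrow> ('c \<Rightarrow> real) \<Rightarrow> 'q ratbar poly \<Rightarrow> 'c fps" where
  "subst_t v \<iota> a g = poly (map_poly (\<lambda>x. fps_const (\<iota> x)) g) (t_expansion v \<iota> a)"

text \<open>
  \<open>reduction \<iota> a v n f g\<close>: the class of \<open>f\<close> in \<open>\<complex>\<^sub>\<infinity>\<langle>t\<rangle> / v\<^sup>n\<close> is that of a polynomial \<open>g\<close> over the
  algebraic closure of \<open>K\<close>; for \<open>f \<in> H1_Betti\<close> such a \<open>g\<close> exists, its class modulo \<open>v\<^sup>n\<close> is unique and
  is defined over the separable closure.  \<open>f_v0\<close> is the power series in \<open>z\<^sub>v\<close> over \<open>\<complex>\<^sub>v\<close> whose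
  reductions modulo \<open>z\<^sub>v\<^sup>n\<close> are the images of these classes; \<open>\<iota>i, ai\<close> refer to \<open>\<complex>\<^sub>\<infinity>\<close> and
  \<open>\<iota>, a\<close> to \<open>\<complex>\<^sub>v\<close>.
\<close>

definition reduction ::
    "('q::{finite,field} ratbar \<Rightarrow> 'c::field) \<Rightarrow> ('c \<Rightarrow> real) \<Rightarrow> 'q poly \<Rightarrow> nat \<Rightarrow>
      'c fps \<Rightarrow> 'q ratbar poly \<Rightarrow> bool" where
  "reduction \<iota> a v n f g \<longleftrightarrow>
     (\<exists>h\<in>tate_algebra a. f - fps_of_poly (map_poly \<iota> g) = A_to_fps \<iota> (v ^ n) * h)"

definition f_v0 ::
    "('q::{finite,field} ratbar \<Rightarrow> 'c::field) \<Rightarrow> ('c \<Rightarrow> real) \<Rightarrow>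
     'q poly \<Rightarrow> ('q ratbar \<Rightarrow> 'd::field) \<Rightarrow> ('d \<Rightarrow> real) \<Rightarrow> 'c fps \<Rightarrow> 'd fps" where
  "f_v0 \<iota>i ai v \<iota> a f =
     (THE F. \<forall>n. \<exists>g. reduction \<iota>i ai v n f g \<and> fps_X ^ n dvd (F - subst_t v \<iota> a g))"

text \<open>A power series in \<open>z\<close> rewritten as a power series in \<open>z - w\<close>.\<close>

definition recenter :: "('c::field \<Rightarrow> real) \<Rightarrow> 'c \<Rightarrow> 'c fps \<Rightarrow> 'c fps" where
  "recenter a w F =
     Abs_fps (\<lambda>j. abs_suminf a (\<lambda>i. of_nat (i choose j) * fps_nth F i * w ^ (i - j)))"

text \<open>
  The type \<open>'d fls\<close> is \<open>\<complex>\<^sub>v((z\<^sub>v - \<zeta>\<^sub>v))\<close>; \<open>h_v\<close> is \<open>f \<mapsto> (t - \<theta>)\<^sup>-\<^sup>1 f\<^bsub>v,0\<^esub>\<close> and \<open>A_to_fls\<close> the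
  structure map from \<open>A\<close>.
\<close>

definition A_to_fls ::
    "'q::{finite,field} poly \<Rightarrow> ('q ratbar \<Rightarrow> 'd::field) \<Rightarrow> ('d \<Rightarrow> real) \<Rightarrow> 'q poly \<Rightarrow> 'd fls" where
  "A_to_fls v \<iota> a b = fps_to_fls (recenter a (gam \<iota> v)
     (poly (map_poly (\<lambda>c. fps_const (scal \<iota> c)) b) (t_expansion v \<iota> a)))"

definition h_v ::
    "('q::{finite,field} ratbar \<Rightarrow> 'c::field) \<Rightarrow> ('c \<Rightarrow> real) \<Rightarrow>
     'q poly \<Rightarrow> ('q ratbar \<Rightarrow> 'd::field) \<Rightarrow> ('d \<Rightarrow> real) \<Rightarrow> 'c fps \<Rightarrow> 'd fls" where
  "h_v \<iota>i ai v \<iota> a f =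
     inverse (A_to_fls v \<iota> a [:0, 1:] - fls_const (theta \<iota>)) *
     fps_to_fls (recenter a (gam \<iota> v) (f_v0 \<iota>i ai v \<iota> a f))"

definition pairing_v ::
    "('q::{finite,field} ratbar \<Rightarrow> 'c::field) \<Rightarrow> ('c \<Rightarrow> real) \<Rightarrow>
     'q poly \<Rightarrow> ('q ratbar \<Rightarrow> 'd::field) \<Rightarrow> ('d \<Rightarrow> real) \<Rightarrow> ('c fps \<Rightarrow> 'q poly) \<Rightarrow> 'd fls" where
  "pairing_v \<iota>i ai v \<iota> a u =
     (THE c. \<forall>f\<in>H1_Betti \<iota>i ai. A_to_fls v \<iota> a (u f) = h_v \<iota>i ai v \<iota> a f * c)"

definition abs_period_v ::
    "('q::{finite,field} ratbar \<Rightarrow> 'c::field) \<Rightarrow> ('c \<Rightarrow> real) \<Rightarrow>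
     'q poly \<Rightarrow> ('q ratbar \<Rightarrow> 'd::field) \<Rightarrow> ('d \<Rightarrow> real) \<Rightarrow> ('c fps \<Rightarrow> 'q poly) \<Rightarrow> real" where
  "abs_period_v \<iota>i ai v \<iota> a u =
     (let x = pairing_v \<iota>i ai v \<iota> a u in a (fls_nth x (fls_subdegree x)))"


section \<open>Artin \<open>L\<close>-functions and conductors\<close>

text \<open>
  The Galois group of \<open>K\<close> (that is, of \<open>Q\<close>) is the group of \<open>K\<close>-automorphisms of the algebraic
  closure; restriction identifies it with the automorphism group of the separable closure.  A
  character with open kernel is given by a representation \<open>\<rho>\<close> on \<open>complex ^ 'n\<close>, trivial on an open
  subgroup.  \<open>w\<close> is an absolute value on the algebraic closure of \<open>K\<close>, extending that of \<open>v\<close>.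
\<close>

definition galois_group :: "('q::{finite,field} ratbar \<Rightarrow> 'q ratbar) set" where
  "galois_group = {g. ring_embedding g \<and> bij g \<and> (\<forall>x. g (to_ac x) = to_ac x)}"

type_synonym ('q, 'n) galois_rep = "('q ratbar \<Rightarrow> 'q ratbar) \<Rightarrow> complex ^ 'n ^ 'n"

definition decomposition_group ::
    "('q::{finite,field} ratbar \<Rightarrow> real) \<Rightarrow> ('q ratbar \<Rightarrow> 'q ratbar) set" where
  "decomposition_group w = {g \<in> galois_group. \<forall>x. w (g x) = w x}"

definition inertia_group ::
    "('q::{finite,field} ratbar \<Rightarrow> real) \<Rightarrow> ('q ratbar \<Rightarrow> 'q ratbar) set" where
  "inertia_group w = {g \<in> decomposition_group w. \<forall>x. w x \<le> 1 \<longrightarrow> w (g x - x) < 1}"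

definition frobenius ::
    "nat \<Rightarrow> ('q::{finite,field} ratbar \<Rightarrow> real) \<Rightarrow> 'q ratbar \<Rightarrow> 'q ratbar" where
  "frobenius N w = (SOME g. g \<in> decomposition_group w \<and> (\<forall>x. w x \<le> 1 \<longrightarrow> w (g x - x ^ N) < 1))"

text \<open>For a finite group \<open>M\<close> of matrices the average is the projection onto the \<open>M\<close>-invariants.\<close>

definition invariants_projection :: "(complex ^ 'n::finite ^ 'n) set \<Rightarrow> complex ^ 'n ^ 'n" where
  "invariants_projection M = (\<chi> i j. (\<Sum>m\<in>M. m $ i $ j) / of_nat (card M))"

text \<open>
  \<open>det (1 - q\<^sub>v\<^sup>-\<^sup>s Frob | invariants of inertia)\<^sup>-\<^sup>1\<close>: composing with the projection adds only factors
  \<open>1\<close> to the determinant.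
\<close>

definition euler_factor ::
    "'q::{finite,field} poly \<Rightarrow> ('q ratbar \<Rightarrow> real) \<Rightarrow> ('q, 'n::finite) galois_rep \<Rightarrow>
     complex \<Rightarrow> complex" where
  "euler_factor v w \<rho> s = inverse (det (mat 1 -
     (\<chi> i j. of_nat (qv v) powr (- s) *
        (\<rho> (frobenius (qv v) w) ** invariants_projection (\<rho> ` inertia_group w)) $ i $ j)))"

text \<open>
  The finite Galois extension \<open>L\<close> of \<open>K\<close> cut out by \<open>\<rho>\<close>: elements fixed by the kernel and separable
  over \<open>K\<close>, i.e. a simple root of some polynomial over \<open>K\<close>.
\<close>

definition cut_out_field :: "('q::{finite,field}, 'n::finite) galois_rep \<Rightarrow> 'q ratbar set" where
  "cut_out_field \<rho> =
     {x. (\<exists>p. poly (map_poly to_ac p) x = 0 \<and> poly (map_poly to_ac (pderiv p)) x \<noteq> 0) \<and>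
         (\<forall>g\<in>galois_group. \<rho> g = mat 1 \<longrightarrow> g x = x)}"

text \<open>
  The preimage in the decomposition group of the \<open>i\<close>-th ramification group (lower numbering) of
  \<open>L/K\<close>; the supremum is the absolute value of a uniformizer of \<open>L\<close>.
\<close>

definition ramification_group ::
    "('q::{finite,field} ratbar \<Rightarrow> real) \<Rightarrow> ('q, 'n::finite) galois_rep \<Rightarrow> nat \<Rightarrow>
     ('q ratbar \<Rightarrow> 'q ratbar) set" where
  "ramification_group w \<rho> i =
     {g \<in> decomposition_group w. \<forall>x\<in>cut_out_field \<rho>. w x \<le> 1 \<longrightarrow>
        w (g x - x) \<le> (Sup {w y | y. y \<in> cut_out_field \<rho> \<and> w y < 1}) ^ (i + 1)}"

definition conductor_exponent ::
    "('q::{finite,field} ratbar \<Rightarrow> real) \<Rightarrow> ('q, 'n::finite) galois_rep \<Rightarrow> complex" where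
  "conductor_exponent w \<rho> =
     (\<Sum>i. of_nat (card (\<rho> ` ramification_group w \<rho> i)) / of_nat (card (\<rho> ` ramification_group w \<rho> 0)) *
        (of_nat CARD('n) - trace (invariants_projection (\<rho> ` ramification_group w \<rho> i))))"

definition contragredient ::
    "('q::{finite,field}, 'n::finite) galois_rep \<Rightarrow> ('q, 'n) galois_rep" where
  "contragredient \<rho> g = transpose (\<rho> (inv_into UNIV g))"

definition trivial_rep :: "('q::{finite,field}, 1) galois_rep" where
  "trivial_rep g = mat 1"


section \<open>Regularization\<close>

text \<open>
  Below \<open>w v\<close> is the absolute value at \<open>v \<in> V\<close>.  \<open>L_infinity\<close> is the meromorphic continuation of the
  Euler product, which converges for \<open>Re s > 1\<close>.
\<close>

definition L_infinity ::
    "'q::{finite,field} poly set \<Rightarrow> ('q poly \<Rightarrow> 'q ratbar \<Rightarrow> real) \<Rightarrow> ('q, 'n::finite) galois_rep \<Rightarrow>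
     complex \<Rightarrow> complex" where
  "L_infinity V w \<rho> =
     (THE L. L nicely_meromorphic_on UNIV \<and>
        (\<forall>s. Re s > 1 \<longrightarrow>
           ((\<lambda>S. \<Prod>v\<in>S. euler_factor v (w v) \<rho> s) \<longlongrightarrow> L s) (finite_subsets_at_top V)))"

definition Z_infinity ::
    "'q::{finite,field} poly set \<Rightarrow> ('q poly \<Rightarrow> 'q ratbar \<Rightarrow> real) \<Rightarrow> ('q, 'n::finite) galois_rep \<Rightarrow>
     complex \<Rightarrow> complex" where
  "Z_infinity V w \<rho> s = deriv (L_infinity V w \<rho>) s / L_infinity V w \<rho> s"

definition Z_v ::
    "'q::{finite,field} poly \<Rightarrow> ('q ratbar \<Rightarrow> real) \<Rightarrow> ('q, 'n::finite) galois_rep \<Rightarrow>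
     complex \<Rightarrow> complex" where
  "Z_v v w \<rho> s =
     deriv (euler_factor v w \<rho>) s / (- euler_factor v w \<rho> s * of_real (ln (real (qv v))))"

definition mu_Art ::
    "'q::{finite,field} poly set \<Rightarrow> ('q poly \<Rightarrow> 'q ratbar \<Rightarrow> real) \<Rightarrow> ('q, 'n::finite) galois_rep \<Rightarrow>
     complex" where
  "mu_Art V w \<rho> =
     (\<Sum>v\<in>{v\<in>V. conductor_exponent (w v) \<rho> \<noteq> 0}. conductor_exponent (w v) \<rho> * of_real (ln (real (qv v))))"

text \<open>
  \<open>has_regularized_sum V w \<rho> x S\<close>: the convention for the character of \<open>\<rho>\<close> applies to the series of
  the \<open>x v\<close> and gives it the value \<open>S\<close>.
\<close>

definition has_regularized_sum ::
    "'q::{finite,field} poly set \<Rightarrow> ('q poly \<Rightarrow> 'q ratbar \<Rightarrow> real) \<Rightarrow> ('q, 'n::finite) galois_rep \<Rightarrow>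
     ('q poly \<Rightarrow> complex) \<Rightarrow> complex \<Rightarrow> bool" where
  "has_regularized_sum V w \<rho> x S \<longleftrightarrow>
     (let y = (\<lambda>v. x v + Z_v v (w v) \<rho> 1 * of_real (ln (real (qv v))));
          Z = Z_infinity V w (contragredient \<rho>) in
      finite {v\<in>V. y v \<noteq> 0} \<and> \<not> is_pole Z 0 \<and>
      S = - Z 0 - mu_Art V w \<rho> + (\<Sum>v\<in>{v\<in>V. y v \<noteq> 0}. y v))"

end

theory Submission
  imports Defs
begin

text \<open>
  Write \<open>q\<close> for the number of elements of the finite field and, for a finite place \<open>v\<close> of degree \<open>d\<close>,
  \<open>Q = q^d\<close>.  The theorem holds because each finite place contributes exactly the local term of the
  regularization: \<open>log |\<integral>\<omega>|\<^sub>v = - log Q / (Q - 1) = - Z\<^sub>v(1,1) log Q\<close>.  All correction terms vanish, so the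
  regularized sum is \<open>- Z\<^sup>\<infinity>(1,0) = - (q/(q-1)) log q\<close>, the negative of the contribution of the
  infinite place.

  \<^bold>\<open>The infinite place.\<close>  The series \<open>\<ell>\<close> is a unit of the Tate algebra.  If \<open>f\<close> lies in \<open>H1_Betti\<close>,
  then \<open>f / (\<beta>\<ell>)\<close> is fixed by \<open>\<sigma>\<close> and has coefficients tending to 0, hence is a polynomial over the
  finite field (\<open>H1_generated\<close>).  So the period is the inverse of \<open>\<sigma>(\<beta>\<ell>)\<close> at \<open>t = \<theta>\<close>.  There the
  constant term \<open>\<beta>^q\<close> dominates (\<open>abs_h_generator\<close>), and \<open>|\<beta>|^(q-1) = 1/q\<close>.

  \<^bold>\<open>A finite place.\<close>  The expansion \<open>T\<close> of \<open>t\<close> has its coefficients in the residue field, so it is fixed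
  by \<open>\<sigma>^d\<close>.  Iterating \<open>f = (t - \<theta>)\<sigma>(f)\<close> therefore gives the equation
  \<open>F = (\<Prod>i<d. T - \<theta>^(q^i)) \<sigma>^d(F)\<close> for the completion \<open>F\<close> of \<open>\<beta>\<ell>\<close> (\<open>solution_equation\<close>).  The constant
  term of the product has absolute value \<open>1/Q\<close>, because only the factor \<open>i = 0\<close> is not a unit.
  Comparing constant terms yields \<open>|F\<^sub>0|^(Q-1) = Q\<close>, and comparing the other coefficients bounds them
  (\<open>solution_nth_bound\<close>) so well that \<open>F\<close> converges at \<open>\<zeta>\<^sub>v\<close> with \<open>|F(\<zeta>\<^sub>v)| = |F\<^sub>0|\<close>.  Since \<open>t - \<theta>\<close> has a
  simple zero at \<open>\<zeta>\<^sub>v\<close> whose leading coefficient is a unit, \<open>(t - \<theta>) / F\<close> has absolute value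
  \<open>Q^(-1/(Q-1))\<close>.

  The completion has to be constructed first.  Weierstrass division produces the class of \<open>\<beta>\<ell>\<close> modulo
  \<open>v^n\<close> as a polynomial, whose coefficients are algebraic over \<open>K\<close> by a linear dependence among the
  iterates of the Frobenius equation (\<open>generator_reduction\<close>); uniqueness of the division makes these
  classes compatible (\<open>reduction_unique\<close>).  Finally \<open>F\<^sub>0 \<noteq> 0\<close>, because a unit of the Tate algebra has no
  zero on the closed unit disc (\<open>solution_nth_0_nonzero\<close>).

  \<^bold>\<open>The L-function.\<close>  The sum of \<open>|f|^(-s)\<close> is taken over all nonzero polynomials, not just over
  representatives up to units.  This multiplies everything by \<open>q - 1\<close> and makes the Euler product
  independent of the generators chosen for the places (\<open>euler_product\<close>).
\<close>

hide_const (open) Polynomials.degree up_ring.monom module.smult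

section \<open>Ring maps and polynomials\<close>

locale ring_map =
  fixes f :: "'a::comm_ring_1 \<Rightarrow> 'b::comm_ring_1"
  assumes map_one: "f 1 = 1"
    and map_add: "f (x + y) = f x + f y"
    and map_mult: "f (x * y) = f x * f y"
begin

lemma map_zero: "f 0 = 0"
  using map_add[of 0 0] by simp

lemma map_uminus: "f (- x) = - f x"
  using map_add[of x "- x"] by (simp add: map_zero eq_neg_iff_add_eq_0 add.commute)

lemma map_diff: "f (x - y) = f x - f y"
  using map_add[of x "- y"] by (simp add: map_uminus)

lemma map_sum: "f (sum g A) = (\<Sum>x\<in>A. f (g x))"
  by (induction A rule: infinite_finite_induct) (auto simp: map_zero map_add)

lemma map_prod: "f (prod g A) = (\<Prod>x\<in>A. f (g x))"
  by (induction A rule: infinite_finite_induct) (auto simp: map_one map_mult)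

lemma map_power: "f (x ^ n) = f x ^ n"
  by (induction n) (auto simp: map_one map_mult)

lemma map_of_nat: "f (of_nat n) = of_nat n"
  by (induction n) (auto simp: map_zero map_one map_add)

lemma map_dvd: "x dvd y \<Longrightarrow> f x dvd f y"
  by (auto simp: dvd_def map_mult)

lemma coeff_map: "poly.coeff (map_poly f p) i = f (poly.coeff p i)"
  by (simp add: coeff_map_poly map_zero)

lemma ring_map_map_poly: "ring_map (map_poly f)"
proof
  show "map_poly f 1 = 1"
    by (rule poly_eqI) (auto simp: coeff_map one_pCons map_zero map_one coeff_pCons split: nat.splits)
  show "map_poly f (p + q) = map_poly f p + map_poly f q" for p q
    by (rule poly_eqI) (auto simp: coeff_map map_add)
  show "map_poly f (p * q) = map_poly f p * map_poly f q" for p q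
    by (rule poly_eqI) (auto simp: coeff_map coeff_mult map_sum map_mult)
qed

end

lemma ring_map_comp:
  assumes "ring_map f" "ring_map g"
  shows "ring_map (\<lambda>x. g (f x))"
proof -
  interpret f: ring_map f by fact
  interpret g: ring_map g by fact
  show ?thesis by standard (auto simp: f.map_one f.map_add f.map_mult g.map_one g.map_add g.map_mult)
qed

lemma ring_map_poly: "ring_map (\<lambda>p. poly p x)"
  by standard auto

lemma ring_map_fps_const: "ring_map (fps_const :: 'a::comm_ring_1 \<Rightarrow> 'a fps)"
  by standard auto

lemma ring_map_fps_of_poly: "ring_map (fps_of_poly :: 'a::comm_ring_1 poly \<Rightarrow> 'a fps)"
  by standard (auto simp: fps_of_poly_add fps_of_poly_mult)

lemma ring_map_inj:
  fixes f :: "'a::field \<Rightarrow> 'b::comm_ring_1"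
  assumes "ring_map f"
  shows "f x = 0 \<longleftrightarrow> x = 0"
proof -
  interpret ring_map f by fact
  have False if "x \<noteq> 0" "f x = 0"
    using map_mult[of x "inverse x"] that by (simp add: map_one)
  then show ?thesis using map_zero by auto
qed

lemma ring_map_eq_iff:
  fixes f :: "'a::field \<Rightarrow> 'b::comm_ring_1"
  assumes "ring_map f"
  shows "f x = f y \<longleftrightarrow> x = y"
  using ring_map_inj[OF assms, of "x - y"] ring_map.map_diff[OF assms, of x y] by auto

lemma degree_ring_map:
  fixes f :: "'a::field \<Rightarrow> 'b::comm_ring_1"
  assumes "ring_map f"
  shows "degree (map_poly f p) = degree p"
  by (rule degree_map_poly) (auto simp: ring_map_inj[OF assms])

lemma poly_map_eval:
  assumes "ring_map f"
  shows "poly (map_poly f p) (f x) = f (poly p x)"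
  by (induction p) (auto simp: map_poly_pCons ring_map.map_zero[OF assms] ring_map.map_add[OF assms]
      ring_map.map_mult[OF assms])

text \<open>
  The polynomial splits already before it is mapped to the larger field, so no new roots can appear.
\<close>

lemma roots_in_alg_closed_field:
  fixes \<iota> :: "'a::alg_closed_field \<Rightarrow> 'b::field"
  assumes "ring_map \<iota>" "p \<noteq> 0" "poly (map_poly \<iota> p) x = 0"
  shows "\<exists>y. x = \<iota> y \<and> poly p y = 0"
  using assms(2,3)
proof (induction "degree p" arbitrary: p rule: less_induct)
  case less
  interpret ring_map \<iota> by fact
  interpret mp: ring_map "map_poly \<iota>" by (rule ring_map_map_poly)
  show ?case
  proof (cases "degree p = 0")
    case True
    then obtain c where "p = [:c:]" by (elim degree_eq_zeroE)
    with less show ?thesis by (auto simp: map_poly_pCons map_zero ring_map_inj[OF assms(1)])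
  next
    case False
    then obtain y where y: "poly p y = 0" using alg_closed_imp_poly_has_root by blast
    then obtain r where r: "p = [:- y, 1:] * r" unfolding poly_eq_0_iff_dvd dvd_def by blast
    have "map_poly \<iota> p = [:- \<iota> y, 1:] * map_poly \<iota> r"
      unfolding r mp.map_mult by (simp add: map_poly_pCons map_zero map_one map_uminus)
    with less.prems have "x = \<iota> y \<or> poly (map_poly \<iota> r) x = 0" by auto
    then show ?thesis
    proof
      assume "poly (map_poly \<iota> r) x = 0"
      moreover have "r \<noteq> 0" using less.prems r by auto
      moreover from this have "degree r < degree p" unfolding r by (subst degree_mult_eq) auto
      ultimately show ?thesis using less.hyps[of r] r by auto
    qed (use y in auto)
  qed
qed

text \<open>
  Gaussian elimination on the top coefficient.
\<close>

lemma linear_dependence_degree_less: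
  fixes p :: "'i \<Rightarrow> 'a::field poly"
  assumes "finite I" "D < card I" "\<And>k i. k \<in> I \<Longrightarrow> D \<le> i \<Longrightarrow> poly.coeff (p k) i = 0"
  shows "\<exists>c. (\<exists>k\<in>I. c k \<noteq> 0) \<and> (\<Sum>k\<in>I. smult (c k) (p k)) = 0"
  using assms
proof (induction D arbitrary: I p)
  case 0
  then have "p k = 0" if "k \<in> I" for k using that by (intro poly_eqI) auto
  moreover have "\<exists>k. k \<in> I" using 0 by (metis card.empty equals0I less_irrefl)
  ultimately show ?case by (intro exI[of _ "\<lambda>_. 1"]) auto
next
  case (Suc D)
  show ?case
  proof (cases "\<forall>k\<in>I. poly.coeff (p k) D = 0")
    case True
    have "poly.coeff (p k) i = 0" if "k \<in> I" "D \<le> i" for k i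
      using that True Suc.prems(3)[of k i] by (cases "i = D") auto
    then show ?thesis using Suc.IH[of I p] Suc.prems by auto
  next
    case False
    then obtain m where m: "m \<in> I" "poly.coeff (p m) D \<noteq> 0" by auto
    define e where "e k = poly.coeff (p k) D / poly.coeff (p m) D" for k
    define p' where "p' k = p k - smult (e k) (p m)" for k
    have "poly.coeff (p' k) i = 0" if "k \<in> I - {m}" "D \<le> i" for k i
      using that Suc.prems(3)[of k i] Suc.prems(3)[of m i] m by (cases "i = D") (auto simp: p'_def e_def)
    moreover have "D < card (I - {m})" using Suc.prems m by auto
    ultimately obtain c where c: "\<exists>k\<in>I - {m}. c k \<noteq> 0" "(\<Sum>k\<in>I - {m}. smult (c k) (p' k)) = 0"
      using Suc.IH[of "I - {m}" p'] Suc.prems(1) by auto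
    define c' where "c' k = (if k = m then - (\<Sum>k\<in>I - {m}. c k * e k) else c k)" for k
    have "(\<Sum>k\<in>I. smult (c' k) (p k)) = smult (c' m) (p m) + (\<Sum>k\<in>I - {m}. smult (c' k) (p k))"
      using m Suc.prems(1) by (simp add: sum.remove)
    also have "(\<Sum>k\<in>I - {m}. smult (c' k) (p k)) = (\<Sum>k\<in>I - {m}. smult (c k) (p k))"
      by (intro sum.cong) (auto simp: c'_def)
    also have "smult (c' m) (p m) = - (\<Sum>k\<in>I - {m}. smult (c k * e k) (p m))"
      by (simp add: c'_def smult_sum)
    finally have "(\<Sum>k\<in>I. smult (c' k) (p k)) = (\<Sum>k\<in>I - {m}. smult (c k) (p' k))"
      by (simp add: p'_def smult_diff_right sum_subtractf)
    moreover have "\<exists>k\<in>I. c' k \<noteq> 0" using c(1) by (auto simp: c'_def)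
    ultimately show ?thesis using c(2) by auto
  qed
qed

section \<open>Finite fields\<close>

lemma finite_polys_below: "finite {b :: 'q::{finite,field} poly. \<forall>i\<ge>n. poly.coeff b i = 0}" (is "finite (?P n)")
  and card_polys_below: "card {b :: 'q::{finite,field} poly. \<forall>i\<ge>n. poly.coeff b i = 0} = CARD('q) ^ n"
proof -
  have "finite (?P n) \<and> card (?P n) = CARD('q) ^ n"
  proof (induction n)
    case 0
    have "?P 0 = {0}" by (auto intro!: poly_eqI)
    then show ?case by simp
  next
    case (Suc n)
    have eq: "?P (Suc n) = (\<lambda>(c, p). pCons c p) ` (UNIV \<times> ?P n)"
    proof safe
      fix b :: "'q poly" assume b: "\<forall>i\<ge>Suc n. poly.coeff b i = 0"
      obtain c p where cp: "b = pCons c p" by (cases b)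
      have "poly.coeff p i = 0" if "n \<le> i" for i
        using b that cp by (auto dest!: spec[of _ "Suc i"])
      then show "b \<in> (\<lambda>(c, p). pCons c p) ` (UNIV \<times> ?P n)" using cp by force
    next
      fix c :: 'q and p :: "'q poly" and i
      assume "\<forall>i\<ge>n. poly.coeff p i = 0" "Suc n \<le> i"
      then show "poly.coeff (pCons c p) i = 0" by (cases i) auto
    qed
    have "inj_on (\<lambda>(c, p :: 'q poly). pCons c p) (UNIV \<times> ?P n)" by (auto simp: inj_on_def)
    then show ?case using Suc unfolding eq by (simp add: card_image card_cartesian_product)
  qed
  then show "finite (?P n)" "card (?P n) = CARD('q) ^ n" by auto
qed

lemma polys_below_eq: "{b :: 'a::zero poly. \<forall>i\<ge>n. poly.coeff b i = 0} = insert 0 {b. b \<noteq> 0 \<and> degree b < n}"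
proof (rule Set.set_eqI)
  fix b :: "'a poly"
  have "(\<forall>i\<ge>n. poly.coeff b i = 0) \<longleftrightarrow> b = 0 \<or> degree b < n"
    using coeff_eq_0[of b] by (metis coeff_0 leading_coeff_0_iff not_less order_less_le_trans)
  then show "b \<in> {b. \<forall>i\<ge>n. poly.coeff b i = 0} \<longleftrightarrow> b \<in> insert 0 {b. b \<noteq> 0 \<and> degree b < n}"
    by auto
qed

lemma card_nonzero_polys_below:
  "finite {b :: 'q::{finite,field} poly. b \<noteq> 0 \<and> degree b < n}"
  "card {b :: 'q::{finite,field} poly. b \<noteq> 0 \<and> degree b < n} = CARD('q) ^ n - 1"
proof -
  let ?R = "{b :: 'q poly. b \<noteq> 0 \<and> degree b < n}"
  show fin: "finite ?R"
    by (rule finite_subset[OF _ finite_polys_below[of n]]) (subst polys_below_eq, auto)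
  have "card (insert 0 ?R) = CARD('q) ^ n"
    unfolding polys_below_eq[symmetric] by (rule card_polys_below)
  then show "card ?R = CARD('q) ^ n - 1" using fin by simp
qed

text \<open>
  Multiplication by \<open>b\<close> permutes the nonzero residues modulo \<open>v\<close>, and \<open>v\<close> does not divide their product.
\<close>

lemma fermat_poly:
  fixes v b :: "'q::{finite,field} poly"
  assumes "Factorial_Ring.irreducible v"
  shows "v dvd b ^ (CARD('q) ^ degree v) - b"
proof (cases "v dvd b")
  case True
  then have "v dvd b ^ (CARD('q) ^ degree v)"
    by (meson dvd_power dvd_trans zero_less_card_finite zero_less_power)
  with True show ?thesis by simp
next
  case False
  have pr: "prime_elem v" using assms by (rule field_poly_irreducible_imp_prime)
  have v0: "v \<noteq> 0" using assms by auto
  define R where "R = {b :: 'q poly. b \<noteq> 0 \<and> degree b < degree v}"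
  have fin: "finite R" and card: "card R = CARD('q) ^ degree v - 1"
    unfolding R_def by (rule card_nonzero_polys_below)+
  have notdvd: "\<not> v dvd r" if "r \<in> R" for r
    using that dvd_imp_degree_le[of v r] by (auto simp: R_def)
  define \<phi> where "\<phi> r = (b * r) mod v" for r
  have "\<phi> ` R \<subseteq> R"
  proof safe
    fix r assume r: "r \<in> R"
    have "\<not> v dvd b * r" using pr False notdvd[OF r] by (simp add: prime_elem_dvd_mult_iff)
    then have "\<phi> r \<noteq> 0" by (simp add: \<phi>_def mod_eq_0_iff_dvd)
    moreover from this have "degree (\<phi> r) < degree v"
      unfolding \<phi>_def using degree_mod_less[OF v0, of "b * r"] by auto
    ultimately show "\<phi> r \<in> R" by (simp add: R_def)
  qed
  moreover have "inj_on \<phi> R"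
  proof (rule inj_onI)
    fix r s assume rs: "r \<in> R" "s \<in> R" "\<phi> r = \<phi> s"
    then have "v dvd b * r - b * s" by (simp add: \<phi>_def mod_eq_dvd_iff)
    then have "v dvd b * (r - s)" by (simp add: algebra_simps)
    then have "v dvd r - s" using pr False by (simp add: prime_elem_dvd_mult_iff)
    moreover have "degree (r - s) < degree v"
      using rs degree_diff_less[of r "degree v" s] by (auto simp: R_def)
    ultimately show "r = s" using dvd_imp_degree_le[of v "r - s"] by auto
  qed
  ultimately have "\<phi> ` R = R" using fin by (simp add: endo_inj_surj)
  then have "(\<Prod>r\<in>R. \<phi> r) = (\<Prod>r\<in>R. r)"
    using prod.reindex[OF \<open>inj_on \<phi> R\<close>, of "\<lambda>x. x"] by simp
  moreover have "(\<Prod>r\<in>R. \<phi> r) mod v = (\<Prod>r\<in>R. b * r) mod v"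
    unfolding \<phi>_def by (rule mod_prod_eq)
  ultimately have "v dvd (\<Prod>r\<in>R. b * r) - (\<Prod>r\<in>R. r)"
    by (metis mod_eq_dvd_iff)
  then have "v dvd (b ^ card R - 1) * (\<Prod>r\<in>R. r)"
    by (simp add: prod.distrib algebra_simps)
  moreover have "\<not> v dvd (\<Prod>r\<in>S. r)" if "S \<subseteq> R" "finite S" for S
    using that(2,1)
  proof (induction S rule: finite_induct)
    case empty
    show ?case using pr by (simp add: prime_elem_def)
  next
    case (insert r S)
    then show ?case using pr notdvd[of r] by (simp add: prime_elem_dvd_mult_iff)
  qed
  from this[of R] have "\<not> v dvd (\<Prod>r\<in>R. r)" using fin by simp
  with \<open>v dvd (b ^ card R - 1) * _\<close> have "v dvd b ^ card R - 1"
    using pr by (auto simp: prime_elem_dvd_mult_iff)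
  then have "v dvd b * (b ^ card R - 1)" by (rule dvd_mult)
  moreover have "b * (b ^ card R - 1) = b ^ Suc (card R) - b" by (simp add: algebra_simps)
  moreover have "Suc (card R) = CARD('q) ^ degree v" using card by simp
  ultimately show ?thesis by simp
qed

lemma finite_field_power_card: "(x :: 'q::{finite,field}) ^ CARD('q) = x"
proof -
  have "Factorial_Ring.irreducible ([:0, 1:] :: 'q poly)"
    by (rule irreducible_linear_field_poly) auto
  from fermat_poly[OF this, of "[:x:]"]
  have "[:0, 1:] dvd [:x ^ CARD('q) - x:]" by (simp add: poly_const_pow)
  then have "poly [:x ^ CARD('q) - x:] 0 = 0" using poly_eq_0_iff_dvd[of _ 0] by force
  then show ?thesis by simp
qed

lemma card_field_ge_2: "CARD('q::{finite,field}) \<ge> 2"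
proof -
  have "card {0, 1 :: 'q} \<le> CARD('q)" by (rule card_mono) auto
  then show ?thesis by simp
qed

text \<open>
  The polynomial \<open>(X + 1)^q - X^q - 1\<close> vanishes at all \<open>q\<close> elements of the field, but its degree is less
  than \<open>q\<close>.  This makes \<open>x \<mapsto> x^q\<close> additive in every algebra over the field.
\<close>

lemma card_choose_eq_0:
  assumes "0 < k" "k < CARD('q::{finite,field})"
  shows "of_nat (CARD('q) choose k) = (0 :: 'q)"
proof -
  define G :: "'q poly" where "G = (\<Sum>j\<in>{0<..<CARD('q)}. monom (of_nat (CARD('q) choose j)) j)"
  have coeff: "poly.coeff G j = (if 0 < j \<and> j < CARD('q) then of_nat (CARD('q) choose j) else 0)" for j
    by (auto simp: G_def coeff_sum)
  have root: "poly G x = 0" for x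
  proof -
    have "(x + 1) ^ CARD('q) = (\<Sum>j\<le>CARD('q). of_nat (CARD('q) choose j) * x ^ j)"
      by (subst binomial_ring) simp
    also have "{..CARD('q)} = insert 0 (insert CARD('q) {0<..<CARD('q)})" by auto
    also have "(\<Sum>j\<in>\<dots>. of_nat (CARD('q) choose j) * x ^ j) = 1 + x ^ CARD('q) + poly G x"
      by (simp add: G_def poly_sum poly_monom add.assoc)
    finally show ?thesis by (simp add: finite_field_power_card)
  qed
  have "G = 0"
  proof (rule ccontr)
    assume "G \<noteq> 0"
    then have "card {x. poly G x = 0} \<le> degree G" by (rule card_poly_roots_bound)
    moreover have "degree G \<le> CARD('q) - 1" by (rule degree_le) (auto simp: coeff)
    moreover have "{x. poly G x = 0} = UNIV" using root by auto
    ultimately show False using card_field_ge_2[where 'q = 'q] by simp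
  qed
  then show ?thesis using coeff[of k] assms by simp
qed

lemma ring_map_power_card:
  assumes "ring_map (f :: 'q::{finite,field} \<Rightarrow> 'b::comm_ring_1)"
  shows "ring_map (\<lambda>x :: 'b. x ^ (CARD('q) ^ k))"
proof (induction k)
  case 0
  show ?case by standard auto
next
  case (Suc k)
  interpret ring_map f by fact
  have "ring_map (\<lambda>x :: 'b. x ^ CARD('q))"
  proof
    show "(x * y) ^ CARD('q) = x ^ CARD('q) * y ^ CARD('q)" for x y :: 'b
      by (simp add: power_mult_distrib)
    show "(x + y) ^ CARD('q) = x ^ CARD('q) + y ^ CARD('q)" for x y :: 'b
    proof -
      have zero: "of_nat (CARD('q) choose j) = (0 :: 'b)" if "j \<in> {0<..<CARD('q)}" for j
        using card_choose_eq_0[where 'q = 'q, of j] that map_of_nat[of "CARD('q) choose j"]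
        by (simp add: map_zero)
      have "(x + y) ^ CARD('q) = (\<Sum>j\<le>CARD('q). of_nat (CARD('q) choose j) * x ^ j * y ^ (CARD('q) - j))"
        by (rule binomial_ring)
      also have "{..CARD('q)} = insert 0 (insert CARD('q) {0<..<CARD('q)})" by auto
      also have "(\<Sum>j\<in>\<dots>. of_nat (CARD('q) choose j) * x ^ j * y ^ (CARD('q) - j)) =
          x ^ CARD('q) + y ^ CARD('q)"
        using zero by (simp add: algebra_simps)
      finally show ?thesis .
    qed
  qed auto
  from ring_map_comp[OF Suc this] show ?case by (simp add: power_mult[symmetric] mult.commute)
qed

text \<open>
  The polynomial \<open>X^q - X\<close> has no room for roots besides the \<open>q\<close> elements of the finite field.
\<close>

lemma power_card_fixed:
  assumes "ring_map (f :: 'q::{finite,field} \<Rightarrow> 'b::field)" "y ^ CARD('q) = y"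
  shows "\<exists>c. y = f c"
proof (rule ccontr)
  assume no: "\<not> (\<exists>c. y = f c)"
  interpret ring_map f by fact
  define G :: "'b poly" where "G = monom 1 CARD('q) - monom 1 1"
  have q: "CARD('q) \<ge> 2" by (rule card_field_ge_2)
  have coeff: "poly.coeff G CARD('q) = 1" using q by (simp add: G_def)
  then have G0: "G \<noteq> 0" by auto
  have "degree G \<le> CARD('q)" using q by (intro degree_le) (auto simp: G_def)
  have "inj f" using ring_map_eq_iff[OF assms(1)] by (auto intro: injI)
  have "insert y (range f) \<subseteq> {x. poly G x = 0}"
    using assms(2) by (auto simp: G_def poly_monom map_power[symmetric] finite_field_power_card)
  then have "card (insert y (range f)) \<le> card {x. poly G x = 0}"
    using poly_roots_finite[OF G0] by (intro card_mono) auto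
  also have "\<dots> \<le> CARD('q)" using card_poly_roots_bound[OF G0] \<open>degree G \<le> _\<close> by linarith
  finally show False using no \<open>inj f\<close> by (auto simp: card_image image_iff card_insert_if)
qed

section \<open>Frobenius twists of power series\<close>

lemma sigma_nth [simp]: "fps_nth (sigma n F) i = fps_nth F i ^ n"
  by (simp add: sigma_def)

lemma ring_map_sigma:
  assumes "ring_map (\<lambda>x :: 'a::field. x ^ n)"
  shows "ring_map (sigma n :: 'a fps \<Rightarrow> 'a fps)"
proof -
  interpret ring_map "\<lambda>x :: 'a. x ^ n" by fact
  show ?thesis
    by standard (auto simp: fps_eq_iff fps_mult_nth map_add map_mult map_sum map_zero)
qed

lemma sigma_const [simp]: "ring_map (\<lambda>x :: 'a::field. x ^ n) \<Longrightarrow> sigma n (fps_const (c :: 'a)) = fps_const (c ^ n)"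
  using ring_map.map_zero[of "\<lambda>x :: 'a. x ^ n"] by (auto simp: fps_eq_iff)

lemma sigma_X [simp]: "ring_map (\<lambda>x :: 'a::field. x ^ n) \<Longrightarrow> sigma n (fps_X :: 'a fps) = fps_X"
  using ring_map.map_zero[of "\<lambda>x :: 'a. x ^ n"] by (auto simp: fps_eq_iff)

lemma sigma_sigma: "sigma m (sigma n F) = sigma (n * m) F"
  by (simp add: fps_eq_iff power_mult)

section \<open>Convergence for nonarchimedean absolute values\<close>

locale nonarch =
  fixes a :: "'c::field \<Rightarrow> real"
  assumes nonarch: "nonarchimedean_abs a"
begin

lemma abs_nonneg [simp]: "0 \<le> a x"
  and abs_eq_0 [simp]: "a x = 0 \<longleftrightarrow> x = 0"
  and abs_mult: "a (x * y) = a x * a y"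
  and abs_add_le: "a (x + y) \<le> max (a x) (a y)"
  using nonarch by (auto simp: nonarchimedean_abs_def)

lemma abs_0 [simp]: "a 0 = 0" by simp

lemma abs_pos: "x \<noteq> 0 \<Longrightarrow> 0 < a x"
  by (metis abs_eq_0 abs_nonneg less_eq_real_def)

lemma abs_1 [simp]: "a 1 = 1"
  using abs_mult[of 1 1] abs_eq_0[of 1] by auto

lemma abs_power: "a (x ^ n) = a x ^ n"
  by (induction n) (auto simp: abs_mult)

lemma abs_minus_1: "a (- 1) = 1"
proof -
  have "a (- 1) ^ 2 = 1" using abs_power[of "- 1" 2] by simp
  then show ?thesis by (metis abs_nonneg power2_eq_1_iff not_one_le_zero neg_0_le_iff_le)
qed

lemma abs_minus [simp]: "a (- x) = a x"
  using abs_mult[of "- 1" x] by (simp add: abs_minus_1)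

lemma abs_diff_le: "a (x - y) \<le> max (a x) (a y)"
  using abs_add_le[of x "- y"] by simp

lemma abs_diff_commute: "a (x - y) = a (y - x)"
  using abs_minus[of "x - y"] by simp

lemma abs_inverse: "a (inverse x) = inverse (a x)"
proof (cases "x = 0")
  case False
  then have "a x * a (inverse x) = 1" using abs_mult[of x "inverse x"] by simp
  then show ?thesis by (metis inverse_unique)
qed simp

lemma abs_divide: "a (x / y) = a x / a y"
  by (simp add: divide_inverse abs_mult abs_inverse)

lemma abs_prod: "a (prod f A) = (\<Prod>x\<in>A. a (f x))"
  by (induction A rule: infinite_finite_induct) (auto simp: abs_mult)

lemma abs_sum_le:
  assumes "\<And>x. x \<in> A \<Longrightarrow> a (f x) \<le> B" "0 \<le> B"
  shows "a (sum f A) \<le> B"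
  using assms(1)
proof (induction A rule: infinite_finite_induct)
  case (insert x A)
  then show ?case using abs_add_le[of "f x" "sum f A"] by (smt (verit) insertCI sum.insert)
qed (use assms(2) in auto)

lemma abs_sum_less:
  assumes "\<And>x. x \<in> A \<Longrightarrow> a (f x) < B" "0 < B"
  shows "a (sum f A) < B"
  using assms(1)
proof (induction A rule: infinite_finite_induct)
  case (insert x A)
  then show ?case using abs_add_le[of "f x" "sum f A"] by (smt (verit) insertCI sum.insert)
qed (use assms(2) in auto)

lemma abs_add_le': "a x \<le> B \<Longrightarrow> a y \<le> B \<Longrightarrow> a (x + y) \<le> B"
  using abs_add_le[of x y] by linarith

lemma abs_diff_le': "a x \<le> B \<Longrightarrow> a y \<le> B \<Longrightarrow> a (x - y) \<le> B"
  using abs_diff_le[of x y] by linarith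

lemma abs_add_eq:
  assumes "a y < a x"
  shows "a (x + y) = a x"
  using abs_add_le[of x y] abs_diff_le[of "x + y" y] assms by auto

lemma abs_of_nat_le_1: "a (of_nat n) \<le> 1"
  by (induction n) (auto intro: abs_add_le')

lemma abs_triangle: "a (x + y) \<le> a x + a y"
proof -
  have "max (a x) (a y) \<le> a x + a y" using abs_nonneg[of x] abs_nonneg[of y] by linarith
  then show ?thesis using abs_add_le[of x y] by linarith
qed

lemma metric: "Metric_space UNIV (\<lambda>x y. a (x - y))"
proof
  show "a (x - z) \<le> a (x - y) + a (y - z)" for x y z
    using abs_triangle[of "x - y" "y - z"] by simp
qed (auto simp: abs_diff_commute)

text \<open>
  Several absolute values can live on one type, so convergence is reduced to real null sequences.
\<close>

definition converges :: "(nat \<Rightarrow> 'c) \<Rightarrow> 'c \<Rightarrow> bool" where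
  "converges f l \<longleftrightarrow> (\<lambda>n. a (f n - l)) \<longlonglongrightarrow> 0"

lemma limitin_iff: "limitin (abs_topology a) f l sequentially \<longleftrightarrow> converges f l"
proof -
  interpret Metric_space UNIV "\<lambda>x y. a (x - y)" by (rule metric)
  show ?thesis unfolding abs_topology_def converges_def limitin_metric_dist_null by simp
qed

lemma converges_unique: "converges f l \<Longrightarrow> converges f l' \<Longrightarrow> l = l'"
proof -
  interpret Metric_space UNIV "\<lambda>x y. a (x - y)" by (rule metric)
  show "converges f l \<Longrightarrow> converges f l' \<Longrightarrow> l = l'"
    unfolding limitin_iff[symmetric] abs_topology_def
    using limitin_metric_unique trivial_limit_sequentially by blast
qed

lemma abs_lim_eq: "converges f l \<Longrightarrow> abs_lim a f = l"
  unfolding abs_lim_def limitin_iff by (rule the_equality) (auto intro: converges_unique)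

lemma converges_const: "converges (\<lambda>n. c) c"
  by (simp add: converges_def)

lemma tendsto_0_le:
  fixes f g :: "nat \<Rightarrow> real"
  assumes "g \<longlonglongrightarrow> 0" "\<And>n. 0 \<le> f n" "\<And>n. f n \<le> g n"
  shows "f \<longlonglongrightarrow> 0"
  by (rule tendsto_sandwich[OF _ _ tendsto_const assms(1)]) (auto simp: assms)

lemma converges_add:
  assumes "converges f l" "converges g m"
  shows "converges (\<lambda>n. f n + g n) (l + m)"
  unfolding converges_def
proof (rule tendsto_0_le)
  show "(\<lambda>n. a (f n - l) + a (g n - m)) \<longlonglongrightarrow> 0"
    using tendsto_add[of "\<lambda>n. a (f n - l)" 0 sequentially "\<lambda>n. a (g n - m)" 0] assms
    by (simp add: converges_def)
  show "a (f n + g n - (l + m)) \<le> a (f n - l) + a (g n - m)" for n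
    using abs_triangle[of "f n - l" "g n - m"] by (simp add: add_diff_add)
qed simp

lemma converges_cmult:
  assumes "converges f l"
  shows "converges (\<lambda>n. c * f n) (c * l)"
  using tendsto_mult_right_zero[of "\<lambda>n. a (f n - l)" sequentially "a c"] assms
  by (simp add: converges_def right_diff_distrib[symmetric] abs_mult)

lemma converges_uminus: "converges f l \<Longrightarrow> converges (\<lambda>n. - f n) (- l)"
  using converges_cmult[of f l "- 1"] by simp

lemma converges_diff: "converges f l \<Longrightarrow> converges g m \<Longrightarrow> converges (\<lambda>n. f n - g n) (l - m)"
  using converges_add[of f l "\<lambda>n. - g n" "- m"] converges_uminus[of g m] by simp

lemma converges_power:
  assumes "converges f l" "ring_map (\<lambda>x :: 'c. x ^ n)"
  shows "converges (\<lambda>k. f k ^ n) (l ^ n)"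
proof -
  interpret ring_map "\<lambda>x :: 'c. x ^ n" by fact
  have n: "n \<noteq> 0" using map_zero by (cases n) auto
  have "(\<lambda>k. a (f k - l) ^ n) \<longlonglongrightarrow> 0 ^ n"
    using assms(1) by (intro tendsto_power) (simp add: converges_def)
  then show ?thesis using n by (simp add: converges_def map_diff[symmetric] abs_power zero_power)
qed

lemma converges_Suc: "converges (\<lambda>n. f (Suc n)) l \<longleftrightarrow> converges f l"
  unfolding converges_def by (rule filterlim_sequentially_Suc)

lemma converges_le:
  assumes "converges f l" "\<And>n. N \<le> n \<Longrightarrow> a (f n) \<le> B"
  shows "a l \<le> B"
proof (rule ccontr)
  assume "\<not> a l \<le> B"
  moreover have "0 \<le> B" using assms(2)[of N] abs_nonneg[of "f N"] by (meson order_refl order_trans)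
  ultimately have "0 < a l" "B < a l" by auto
  have "eventually (\<lambda>n. a (f n - l) < a l) sequentially"
    using assms(1) \<open>0 < a l\<close> unfolding converges_def by (auto dest: order_tendstoD)
  moreover have "eventually (\<lambda>n. N \<le> n) sequentially" by (rule eventually_ge_at_top)
  ultimately have "eventually (\<lambda>n. False) sequentially"
  proof eventually_elim
    case (elim n)
    then have "a (l + (f n - l)) = a l" by (intro abs_add_eq) auto
    then show ?case using assms(2)[of n] elim \<open>B < a l\<close> by simp
  qed
  then show False by simp
qed

lemma converges_0_iff: "converges f 0 \<longleftrightarrow> (\<lambda>n. a (f n)) \<longlonglongrightarrow> 0"
  by (simp add: converges_def)

lemma abs_sums_iff: "abs_sums a f l \<longleftrightarrow> converges (\<lambda>n. \<Sum>i<n. f i) l"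
  by (simp add: abs_sums_def limitin_iff)

lemma abs_sums_unique: "abs_sums a f l \<Longrightarrow> abs_sums a f l' \<Longrightarrow> l = l'"
  unfolding abs_sums_iff by (rule converges_unique)

lemma abs_suminf_eq: "abs_sums a f l \<Longrightarrow> abs_suminf a f = l"
  unfolding abs_suminf_def by (rule the_equality) (auto intro: abs_sums_unique)

lemma abs_sums_add: "abs_sums a f l \<Longrightarrow> abs_sums a g m \<Longrightarrow> abs_sums a (\<lambda>n. f n + g n) (l + m)"
  unfolding abs_sums_iff sum.distrib by (rule converges_add)

lemma abs_sums_cmult: "abs_sums a f l \<Longrightarrow> abs_sums a (\<lambda>n. c * f n) (c * l)"
  unfolding abs_sums_iff sum_distrib_left[symmetric] by (rule converges_cmult)

lemma abs_sums_zero: "abs_sums a (\<lambda>n. 0) 0"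
  unfolding abs_sums_iff by (simp add: converges_const)

lemma abs_sums_diff: "abs_sums a f l \<Longrightarrow> abs_sums a g m \<Longrightarrow> abs_sums a (\<lambda>n. f n - g n) (l - m)"
  using abs_sums_add[of f l "\<lambda>n. - 1 * g n" "- 1 * m"] abs_sums_cmult[of g m "- 1"] by simp

lemma abs_sums_sum:
  assumes "\<And>i. i \<in> A \<Longrightarrow> abs_sums a (f i) (l i)"
  shows "abs_sums a (\<lambda>n. \<Sum>i\<in>A. f i n) (\<Sum>i\<in>A. l i)"
  using assms by (induction A rule: infinite_finite_induct) (auto intro: abs_sums_zero abs_sums_add)

lemma abs_sums_Suc: "abs_sums a (\<lambda>n. f (Suc n)) l \<longleftrightarrow> abs_sums a f (f 0 + l)"
proof -
  have "abs_sums a f (f 0 + l) \<longleftrightarrow> converges (\<lambda>n. \<Sum>i<Suc n. f i) (f 0 + l)"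
    unfolding abs_sums_iff by (subst converges_Suc) simp
  also have "\<dots> \<longleftrightarrow> abs_sums a (\<lambda>n. f (Suc n)) l"
    unfolding abs_sums_iff converges_def by (subst sum.lessThan_Suc_shift) (simp add: algebra_simps)
  finally show ?thesis by simp
qed

lemma abs_sums_finite:
  assumes "\<And>i. N \<le> i \<Longrightarrow> f i = 0"
  shows "abs_sums a f (\<Sum>i<N. f i)"
proof -
  have "eventually (\<lambda>n. a ((\<Sum>i<n. f i) - (\<Sum>i<N. f i)) = 0) sequentially"
    using eventually_ge_at_top[of N]
  proof eventually_elim
    case (elim n)
    have "(\<Sum>i<n. f i) = (\<Sum>i<N. f i)"
      using elim assms by (intro sum.mono_neutral_right) auto
    then show ?case by simp
  qed
  then show ?thesis unfolding abs_sums_iff converges_def by (rule tendsto_eventually)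
qed

lemma abs_sums_le:
  assumes "abs_sums a f l" "\<And>n. a (f n) \<le> B"
  shows "a l \<le> B"
proof -
  have "0 \<le> B" using assms(2)[of 0] abs_nonneg[of "f 0"] by linarith
  then have "a (\<Sum>i<n. f i) \<le> B" for n by (intro abs_sum_le) (auto simp: assms)
  with assms(1) show ?thesis unfolding abs_sums_iff by (rule converges_le)
qed

text \<open>
  A term that is strictly larger than all others determines the absolute value of the sum; all the
  absolute values of periods below are computed in this way.
\<close>

lemma abs_sums_dominated:
  assumes "abs_sums a f l" "\<And>n. a (f (Suc n)) \<le> B" "B < a (f 0)"
  shows "a l = a (f 0)"
proof -
  have "abs_sums a (\<lambda>n. f (Suc n)) (l - f 0)" using assms(1) by (subst abs_sums_Suc) simp
  then have "a (l - f 0) \<le> B" by (rule abs_sums_le) (rule assms)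
  then have "a (f 0 + (l - f 0)) = a (f 0)" using assms by (intro abs_add_eq) auto
  then show ?thesis by simp
qed

end

locale complete_nonarch = nonarch +
  assumes complete: "abs_complete a"
begin

lemma abs_sums_exists:
  assumes "(\<lambda>n. a (f n)) \<longlonglongrightarrow> 0"
  shows "\<exists>l. abs_sums a f l"
proof -
  interpret Metric_space UNIV "\<lambda>x y. a (x - y)" by (rule metric)
  have "MCauchy (\<lambda>n. \<Sum>i<n. f i)"
    unfolding MCauchy_def
  proof (intro conjI allI impI)
    fix \<epsilon> :: real assume e: "\<epsilon> > 0"
    obtain N where N: "\<And>n. n \<ge> N \<Longrightarrow> a (f n) < \<epsilon>"
      using order_tendstoD(2)[OF assms e] by (auto simp: eventually_sequentially)
    have *: "a ((\<Sum>i<n. f i) - (\<Sum>i<n'. f i)) < \<epsilon>" if "N \<le> n'" "n' \<le> n" for n n'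
    proof -
      have "{..<n} = {..<n'} \<union> {n'..<n}" using that by auto
      then have "(\<Sum>i<n. f i) = (\<Sum>i<n'. f i) + (\<Sum>i\<in>{n'..<n}. f i)"
        by (simp add: sum.union_disjoint ivl_disj_int)
      then show ?thesis using abs_sum_less[of "{n'..<n}" f \<epsilon>] N that e by simp
    qed
    show "\<exists>N. \<forall>n n'. N \<le> n \<longrightarrow> N \<le> n' \<longrightarrow> a ((\<Sum>i<n. f i) - (\<Sum>i<n'. f i)) < \<epsilon>"
    proof (intro exI allI impI)
      fix n n' assume "N \<le> n" "N \<le> n'"
      then show "a ((\<Sum>i<n. f i) - (\<Sum>i<n'. f i)) < \<epsilon>"
        using *[of n n'] *[of n' n] by (cases "n' \<le> n") (auto simp: abs_diff_commute)
    qed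
  qed simp
  then show ?thesis
    using complete unfolding abs_complete_def mcomplete_def abs_sums_def abs_topology_def by blast
qed

lemma abs_sums_suminf: "(\<lambda>n. a (f n)) \<longlonglongrightarrow> 0 \<Longrightarrow> abs_sums a f (abs_suminf a f)"
  using abs_sums_exists abs_suminf_eq by metis

lemma converges_exists:
  assumes "(\<lambda>n. a (f (Suc n) - f n)) \<longlonglongrightarrow> 0"
  shows "\<exists>l. converges f l"
proof -
  obtain l where l: "abs_sums a (\<lambda>n. f (Suc n) - f n) l" using abs_sums_exists[OF assms] by auto
  have "converges f (l + f 0)"
    using l unfolding abs_sums_iff sum_lessThan_telescope converges_def by (simp add: algebra_simps)
  then show ?thesis by blast
qed

end

section \<open>Values and recentering of power series\<close>

context nonarch
begin

lemma abs_sums_terms: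
  assumes "abs_sums a f l"
  shows "(\<lambda>n. a (f n)) \<longlonglongrightarrow> 0"
proof -
  have "converges (\<lambda>n. \<Sum>i<Suc n. f i) l"
    using assms unfolding abs_sums_iff by (subst converges_Suc)
  from converges_diff[OF this] assms show ?thesis
    unfolding abs_sums_iff by (fastforce simp: converges_def)
qed

text \<open>
  The product of the \<open>n\<close>-th partial sums differs from the \<open>n\<close>-th partial sum of the product by terms
  \<open>f i * g j\<close> with \<open>i + j \<ge> n\<close>.  One factor of each of them is small, and by the ultrametric inequality so
  is their sum.
\<close>

lemma abs_sums_Cauchy_product:
  assumes f: "abs_sums a f l" and g: "abs_sums a g m"
  shows "abs_sums a (\<lambda>k. \<Sum>i\<le>k. f i * g (k - i)) (l * m)"
proof -
  define I where "I n = {(i, j). i < n \<and> j < n \<and> n \<le> i + j}" for n :: nat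
  have fin: "finite (I n)" for n by (rule finite_subset[of _ "{..<n} \<times> {..<n}"]) (auto simp: I_def)
  have split: "(\<Sum>i<n. f i) * (\<Sum>j<n. g j) - (\<Sum>k<n. \<Sum>i\<le>k. f i * g (k - i)) =
      (\<Sum>(i, j)\<in>I n. f i * g j)" for n
  proof -
    have fin': "finite {(i, j). i + j < n}"
      by (rule finite_subset[of _ "{..<n} \<times> {..<n}"]) auto
    have "(\<Sum>i<n. f i) * (\<Sum>j<n. g j) = (\<Sum>(i, j)\<in>{..<n} \<times> {..<n}. f i * g j)"
      by (simp add: sum_product sum.cartesian_product)
    also have "{..<n} \<times> {..<n} = {(i, j). i + j < n} \<union> I n" by (auto simp: I_def)
    also have "(\<Sum>(i, j)\<in>\<dots>. f i * g j) = (\<Sum>(i, j)\<in>{(i, j). i + j < n}. f i * g j) + (\<Sum>(i, j)\<in>I n. f i * g j)"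
      using fin fin' by (intro sum.union_disjoint) (auto simp: I_def)
    also have "(\<Sum>(i, j)\<in>{(i, j). i + j < n}. f i * g j) = (\<Sum>k<n. \<Sum>i\<le>k. f i * g (k - i))"
      by (rule sum.triangle_reindex)
    finally show ?thesis by simp
  qed
  have f0: "(\<lambda>n. a (f n)) \<longlonglongrightarrow> 0" and g0: "(\<lambda>n. a (g n)) \<longlonglongrightarrow> 0"
    using f g by (auto dest: abs_sums_terms)
  obtain B where B: "B > 0" "\<And>n. a (f n) \<le> B" "\<And>n. a (g n) \<le> B"
  proof -
    obtain B1 B2 where "\<And>n. a (f n) \<le> B1" "\<And>n. a (g n) \<le> B2" "B1 > 0" "B2 > 0"
      using convergent_imp_Bseq[OF convergentI[OF f0]] convergent_imp_Bseq[OF convergentI[OF g0]]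
      by (auto simp: Bseq_def)
    then show ?thesis by (intro that[of "max B1 B2"]) (auto intro: order_trans simp: le_max_iff_disj)
  qed
  have c1: "converges (\<lambda>n. (\<Sum>i<n. f i) * (\<Sum>j<n. g j) - (\<Sum>k<n. \<Sum>i\<le>k. f i * g (k - i))) 0"
    unfolding converges_0_iff split
  proof (rule LIMSEQ_I)
    fix r :: real assume r: "r > 0"
    then have "r / B > 0" using B by simp
    have "eventually (\<lambda>n. a (f n) < r / B \<and> a (g n) < r / B) sequentially"
      by (intro eventually_conj order_tendstoD[OF f0] order_tendstoD[OF g0] \<open>r / B > 0\<close>)
    then obtain N where N: "\<And>n. N \<le> n \<Longrightarrow> a (f n) < r / B" "\<And>n. N \<le> n \<Longrightarrow> a (g n) < r / B"
      by (auto simp: eventually_sequentially)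
    show "\<exists>no. \<forall>n\<ge>no. norm (a (\<Sum>(i, j)\<in>I n. f i * g j) - 0) < r"
    proof (intro exI[of _ "2 * N"] allI impI)
      fix n assume n: "2 * N \<le> n"
      have "a (\<Sum>(i, j)\<in>I n. f i * g j) < r"
      proof (rule abs_sum_less)
        fix x assume "x \<in> I n"
        then obtain i j where x: "x = (i, j)" "n \<le> i + j" by (auto simp: I_def)
        then consider "N \<le> i" | "N \<le> j" using n by linarith
        then have "a (f i) * a (g j) < r"
        proof cases
          case 1
          have "a (f i) * a (g j) \<le> a (f i) * B" by (intro mult_left_mono B) simp
          also have "\<dots> < r" using N(1)[OF 1] B(1) by (simp add: field_simps)
          finally show ?thesis .
        next
          case 2
          have "a (f i) * a (g j) \<le> B * a (g j)" by (intro mult_right_mono B) simp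
          also have "\<dots> < r" using N(2)[OF 2] B(1) by (simp add: field_simps)
          finally show ?thesis .
        qed
        then show "a (case x of (i, j) \<Rightarrow> f i * g j) < r" using x by (simp add: abs_mult)
      qed (rule r)
      then show "norm (a (\<Sum>(i, j)\<in>I n. f i * g j) - 0) < r" by simp
    qed
  qed
  have c2: "converges (\<lambda>n. (\<Sum>i<n. f i) * (\<Sum>j<n. g j)) (l * m)"
  proof -
    have "converges (\<lambda>n. ((\<Sum>i<n. f i) - l) * (\<Sum>j<n. g j)) 0"
      unfolding converges_0_iff
    proof (rule tendsto_0_le)
      show "(\<lambda>n. a ((\<Sum>i<n. f i) - l) * B) \<longlonglongrightarrow> 0"
        using f tendsto_mult_left_zero[of "\<lambda>n. a ((\<Sum>i<n. f i) - l)"] unfolding abs_sums_iff converges_def by simp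
      show "a (((\<Sum>i<n. f i) - l) * (\<Sum>j<n. g j)) \<le> a ((\<Sum>i<n. f i) - l) * B" for n
        unfolding abs_mult using B by (intro mult_left_mono abs_sum_le) auto
    qed simp
    from converges_add[OF this converges_cmult[of "\<lambda>n. \<Sum>j<n. g j" m l]] g show ?thesis
      unfolding abs_sums_iff by (simp add: algebra_simps)
  qed
  show ?thesis using converges_diff[OF c2 c1] unfolding abs_sums_iff by simp
qed

definition conv_at :: "'c fps \<Rightarrow> 'c \<Rightarrow> bool" where
  "conv_at F x \<longleftrightarrow> (\<lambda>n. a (fps_nth F n * x ^ n)) \<longlonglongrightarrow> 0"

definition fps_value :: "'c fps \<Rightarrow> 'c \<Rightarrow> 'c" where
  "fps_value F x = abs_suminf a (\<lambda>n. fps_nth F n * x ^ n)"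

lemma tate_iff: "F \<in> tate_algebra a \<longleftrightarrow> conv_at F 1"
  by (simp add: tate_algebra_def conv_at_def)

lemma conv_at_mono:
  assumes "conv_at F y" "a x \<le> a y"
  shows "conv_at F x"
  unfolding conv_at_def
proof (rule tendsto_0_le[OF assms(1)[unfolded conv_at_def]])
  show "a (fps_nth F n * x ^ n) \<le> a (fps_nth F n * y ^ n)" for n
    unfolding abs_mult abs_power using assms(2) by (intro mult_left_mono power_mono) auto
qed simp

lemma conv_at_add: "conv_at F x \<Longrightarrow> conv_at G x \<Longrightarrow> conv_at (F + G) x"
  using converges_add[of "\<lambda>n. fps_nth F n * x ^ n" 0 "\<lambda>n. fps_nth G n * x ^ n" 0]
  unfolding conv_at_def converges_0_iff[symmetric] by (simp add: algebra_simps)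

lemma conv_at_uminus: "conv_at F x \<Longrightarrow> conv_at (- F) x"
  unfolding conv_at_def by simp

lemma conv_at_diff: "conv_at F x \<Longrightarrow> conv_at G x \<Longrightarrow> conv_at (F - G) x"
  using conv_at_add[of F x "- G"] conv_at_uminus[of G x] by simp

lemma conv_at_poly: "conv_at (fps_of_poly p) x"
  unfolding conv_at_def
proof (rule tendsto_eventually)
  show "eventually (\<lambda>n. a (fps_nth (fps_of_poly p) n * x ^ n) = 0) sequentially"
    using eventually_gt_at_top[of "degree p"]
    by eventually_elim (simp add: coeff_eq_0)
qed

lemma conv_at_const: "conv_at (fps_const c) x"
  using conv_at_poly[of "[:c:]" x] by (simp add: fps_of_poly_const)

lemma conv_at_bounded:
  assumes "\<And>n. a (fps_nth F n) \<le> 1" "a x < 1"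
  shows "conv_at F x"
  unfolding conv_at_def
proof (rule tendsto_0_le)
  show "(\<lambda>n. a x ^ n) \<longlonglongrightarrow> 0" using assms(2) by (intro LIMSEQ_power_zero) simp
  show "a (fps_nth F n * x ^ n) \<le> a x ^ n" for n
    unfolding abs_mult abs_power using assms(1)[of n] by (intro mult_left_le_one_le) auto
qed simp

end

context complete_nonarch
begin

lemma conv_at_sums: "conv_at F x \<Longrightarrow> abs_sums a (\<lambda>n. fps_nth F n * x ^ n) (fps_value F x)"
  unfolding conv_at_def fps_value_def by (rule abs_sums_suminf)

lemma
  assumes "conv_at F x" "conv_at G x"
  shows conv_at_mult: "conv_at (F * G) x"
    and fps_value_mult: "fps_value (F * G) x = fps_value F x * fps_value G x"
proof -
  have eq: "(\<lambda>k. \<Sum>i\<le>k. fps_nth F i * x ^ i * (fps_nth G (k - i) * x ^ (k - i))) =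
      (\<lambda>k. fps_nth (F * G) k * x ^ k)"
  proof
    fix k
    have "fps_nth F i * x ^ i * (fps_nth G (k - i) * x ^ (k - i)) = fps_nth F i * fps_nth G (k - i) * x ^ k"
      if "i \<le> k" for i
    proof -
      have "x ^ k = x ^ i * x ^ (k - i)" using that by (simp add: power_add[symmetric])
      then show ?thesis by (simp add: mult_ac)
    qed
    then show "(\<Sum>i\<le>k. fps_nth F i * x ^ i * (fps_nth G (k - i) * x ^ (k - i))) = fps_nth (F * G) k * x ^ k"
      unfolding fps_mult_nth sum_distrib_right atLeast0AtMost by (intro sum.cong) auto
  qed
  have s: "abs_sums a (\<lambda>k. fps_nth (F * G) k * x ^ k) (fps_value F x * fps_value G x)"
    using abs_sums_Cauchy_product[OF conv_at_sums[OF assms(1)] conv_at_sums[OF assms(2)]] unfolding eq .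
  show "conv_at (F * G) x" unfolding conv_at_def by (rule abs_sums_terms[OF s])
  show "fps_value (F * G) x = fps_value F x * fps_value G x"
    unfolding fps_value_def[of "F * G"] by (rule abs_suminf_eq[OF s])
qed

lemma fps_value_add:
  assumes "conv_at F x" "conv_at G x"
  shows "fps_value (F + G) x = fps_value F x + fps_value G x"
  using abs_sums_add[OF conv_at_sums[OF assms(1)] conv_at_sums[OF assms(2)]]
  unfolding fps_value_def[of "F + G"] by (intro abs_suminf_eq) (simp add: algebra_simps)

lemma fps_value_poly: "fps_value (fps_of_poly p) x = poly p x"
proof -
  have "abs_sums a (\<lambda>n. fps_nth (fps_of_poly p) n * x ^ n) (\<Sum>n<Suc (degree p). fps_nth (fps_of_poly p) n * x ^ n)"
    by (rule abs_sums_finite) (simp add: coeff_eq_0)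
  then show ?thesis unfolding fps_value_def by (subst abs_suminf_eq) (auto simp: poly_altdef lessThan_Suc_atMost)
qed

lemma fps_value_const: "fps_value (fps_const c) x = c"
  using fps_value_poly[of "[:c:]" x] by (simp add: fps_of_poly_const)

lemma fps_value_diff:
  assumes "conv_at F x" "conv_at G x"
  shows "fps_value (F - G) x = fps_value F x - fps_value G x"
  using abs_sums_diff[OF conv_at_sums[OF assms(1)] conv_at_sums[OF assms(2)]]
  unfolding fps_value_def[of "F - G"] by (intro abs_suminf_eq) (simp add: algebra_simps)

lemma
  assumes "conv_at T x"
  shows conv_at_poly_comp: "conv_at (poly (map_poly fps_const p) T) x"
    and fps_value_poly_comp: "fps_value (poly (map_poly fps_const p) T) x = poly p (fps_value T x)"
proof -
  have "conv_at (poly (map_poly fps_const p) T) x \<and>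
      fps_value (poly (map_poly fps_const p) T) x = poly p (fps_value T x)"
  proof (induction p)
    case 0
    show ?case using conv_at_const[of 0] fps_value_const[of 0] by simp
  next
    case (pCons c p)
    then show ?case using assms
      by (simp add: map_poly_pCons conv_at_add conv_at_mult conv_at_const fps_value_add fps_value_mult fps_value_const)
  qed
  then show "conv_at (poly (map_poly fps_const p) T) x"
    "fps_value (poly (map_poly fps_const p) T) x = poly p (fps_value T x)" by auto
qed

end

text \<open>
  The Hasse derivatives are the coefficients of \<open>Y^j\<close> in \<open>F(X + Y)\<close>.  Recentering evaluates them at the
  new centre, so their Leibniz rule makes recentering multiplicative.
\<close>

definition hasse :: "nat \<Rightarrow> 'a::comm_ring_1 fps \<Rightarrow> 'a fps" where
  "hasse j F = Abs_fps (\<lambda>i. of_nat ((i + j) choose j) * fps_nth F (i + j))"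

text \<open>
  Coefficientwise this is Vandermonde's identity.
\<close>

lemma hasse_mult: "hasse j (F * G) = (\<Sum>i\<le>j. hasse i F * hasse (j - i) G)"
proof (rule fps_ext)
  fix n
  define u where "u i k = of_nat (i choose k) * of_nat ((n + j - i) choose (j - k)) * (fps_nth F i * fps_nth G (n + j - i))"
    for i k
  have "fps_nth (hasse j (F * G)) n =
      (\<Sum>i\<le>n + j. of_nat ((n + j) choose j) * (fps_nth F i * fps_nth G (n + j - i)))"
    by (simp add: hasse_def fps_mult_nth atLeast0AtMost sum_distrib_left)
  also have "\<dots> = (\<Sum>i\<le>n + j. \<Sum>k\<le>j. u i k)"
  proof (intro sum.cong refl)
    fix i assume "i \<in> {..n + j}"
    then have "(n + j) choose j = (\<Sum>k\<le>j. (i choose k) * ((n + j - i) choose (j - k)))"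
      using vandermonde[of i "n + j - i" j] by simp
    then show "of_nat ((n + j) choose j) * (fps_nth F i * fps_nth G (n + j - i)) = (\<Sum>k\<le>j. u i k)"
      by (simp add: u_def sum_distrib_right)
  qed
  also have "\<dots> = (\<Sum>k\<le>j. \<Sum>i\<le>n + j. u i k)" by (rule sum.swap)
  also have "\<dots> = (\<Sum>k\<le>j. fps_nth (hasse k F * hasse (j - k) G) n)"
  proof (intro sum.cong refl)
    fix k assume k: "k \<in> {..j}"
    have "(\<Sum>i\<le>n + j. u i k) = (\<Sum>i\<in>{k..n + k}. u i k)"
      using k by (intro sum.mono_neutral_right) (auto simp: u_def binomial_eq_0)
    also have "\<dots> = (\<Sum>i\<in>{0..n}. u (i + k) k)"
      using sum.shift_bounds_cl_nat_ivl[of "\<lambda>i. u i k" 0 k n] by simp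
    also have "\<dots> = fps_nth (hasse k F * hasse (j - k) G) n"
      using k by (auto simp: fps_mult_nth hasse_def u_def algebra_simps intro!: sum.cong)
    finally show "(\<Sum>i\<le>n + j. u i k) = fps_nth (hasse k F * hasse (j - k) G) n" .
  qed
  finally show "fps_nth (hasse j (F * G)) n = fps_nth (\<Sum>i\<le>j. hasse i F * hasse (j - i) G) n"
    by (simp add: fps_sum_nth)
qed

context complete_nonarch
begin

lemma conv_at_hasse:
  assumes "conv_at F w" "w \<noteq> 0"
  shows "conv_at (hasse j F) w"
  unfolding conv_at_def
proof (rule tendsto_0_le)
  have "(\<lambda>n. a (fps_nth F (n + j) * w ^ (n + j)) / a w ^ j) \<longlonglongrightarrow> 0 / a w ^ j"
    using assms unfolding conv_at_def
    by (intro tendsto_divide tendsto_const LIMSEQ_ignore_initial_segment) auto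
  then show "(\<lambda>n. a (fps_nth F (n + j) * w ^ (n + j)) / a w ^ j) \<longlonglongrightarrow> 0" by simp
  show "a (fps_nth (hasse j F) n * w ^ n) \<le> a (fps_nth F (n + j) * w ^ (n + j)) / a w ^ j" for n
  proof -
    have "a (fps_nth F (n + j) * w ^ (n + j)) / a w ^ j = a (fps_nth F (n + j) * w ^ n)"
      using assms(2) by (simp add: abs_mult abs_power power_add)
    moreover have "a (of_nat ((n + j) choose j)) * a (fps_nth F (n + j) * w ^ n) \<le> a (fps_nth F (n + j) * w ^ n)"
      by (intro mult_left_le_one_le abs_of_nat_le_1) auto
    ultimately show ?thesis by (simp add: hasse_def abs_mult mult.assoc)
  qed
qed simp

lemma recenter_nth:
  assumes "conv_at F w" "w \<noteq> 0"
  shows "fps_nth (recenter a w F) j = fps_value (hasse j F) w"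
proof -
  let ?f = "\<lambda>i. of_nat (i choose j) * fps_nth F i * w ^ (i - j)"
  have "abs_sums a (\<lambda>n. ?f (n + k)) l \<Longrightarrow> k \<le> j \<Longrightarrow> abs_sums a ?f l" for k l
  proof (induction k)
    case (Suc k)
    have "abs_sums a (\<lambda>n. ?f (n + k)) (?f (0 + k) + l)"
      using Suc.prems abs_sums_Suc[of "\<lambda>n. ?f (n + k)" l] by simp
    moreover have "k choose j = 0" using Suc.prems by simp
    ultimately show ?case using Suc by simp
  qed simp
  from this[of j "fps_value (hasse j F) w"] have "abs_sums a ?f (fps_value (hasse j F) w)"
    using conv_at_sums[OF conv_at_hasse[OF assms, of j]] by (simp add: hasse_def)
  then show ?thesis unfolding recenter_def by (simp add: abs_suminf_eq)
qed

lemma fps_value_sum: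
  assumes "\<And>i. i \<in> I \<Longrightarrow> conv_at (F i) x"
  shows "conv_at (\<Sum>i\<in>I. F i) x \<and> fps_value (\<Sum>i\<in>I. F i) x = (\<Sum>i\<in>I. fps_value (F i) x)"
  using assms
proof (induction I rule: infinite_finite_induct)
  case (insert i I)
  then show ?case by (simp add: conv_at_add fps_value_add)
qed (use conv_at_const[of 0 x] fps_value_const[of 0 x] in auto)

lemma recenter_mult:
  assumes "conv_at F w" "conv_at G w" "w \<noteq> 0"
  shows "recenter a w (F * G) = recenter a w F * recenter a w G"
proof (rule fps_ext)
  fix j
  have "fps_nth (recenter a w (F * G)) j = fps_value (\<Sum>i\<le>j. hasse i F * hasse (j - i) G) w"
    using assms by (simp add: recenter_nth conv_at_mult hasse_mult)
  also have "\<dots> = (\<Sum>i\<le>j. fps_value (hasse i F * hasse (j - i) G) w)"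
    using fps_value_sum[of "{..j}" "\<lambda>i. hasse i F * hasse (j - i) G" w] assms
    by (simp add: conv_at_mult conv_at_hasse)
  also have "\<dots> = fps_nth (recenter a w F * recenter a w G) j"
    using assms by (simp add: fps_value_mult conv_at_hasse recenter_nth fps_mult_nth atLeast0AtMost)
  finally show "fps_nth (recenter a w (F * G)) j = fps_nth (recenter a w F * recenter a w G) j" .
qed

end

section \<open>Weierstrass division over the finite field\<close>

definition ac_scal :: "'q::{finite,field} \<Rightarrow> 'q ratbar" where
  "ac_scal c = to_ac (to_fract [:c:])"

lemma ring_map_to_K: "ring_map (\<lambda>b :: 'q::{finite,field} poly. to_ac (to_fract b))"
  by standard auto

lemma ring_map_const_poly: "ring_map (\<lambda>c :: 'a::comm_ring_1. [:c:])"
  by standard auto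

lemma ring_map_ac_scal: "ring_map (ac_scal :: 'q::{finite,field} \<Rightarrow> _)"
  unfolding ac_scal_def using ring_map_comp[OF ring_map_const_poly ring_map_to_K] .

locale place = 
  fixes \<iota> :: "'q::{finite,field} ratbar \<Rightarrow> 'c::field" and a :: "'c \<Rightarrow> real"
  assumes completed: "completed_closure \<iota> a"
begin

sublocale complete_nonarch a
  using completed by unfold_locales (auto simp: completed_closure_def)

sublocale \<iota>: ring_map \<iota>
  using completed by unfold_locales (auto simp: completed_closure_def ring_embedding_def)

lemma ring_map_\<iota>: "ring_map \<iota>" ..

sublocale gam: ring_map "gam \<iota>"
  unfolding gam_def using ring_map_comp[OF ring_map_to_K ring_map_\<iota>] .

lemma scal_eq: "scal \<iota> c = \<iota> (ac_scal c)"
  by (simp add: scal_def gam_def ac_scal_def)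

lemma theta_eq: "theta \<iota> = \<iota> (to_ac (to_fract [:0, 1:]))"
  by (simp add: theta_def gam_def)

sublocale scal: ring_map "scal \<iota>"
  unfolding scal_eq using ring_map_comp[OF ring_map_ac_scal ring_map_\<iota>] .

lemma ring_map_scal: "ring_map (scal \<iota>)" ..

lemma frob: "ring_map (\<lambda>x :: 'c. x ^ (CARD('q) ^ k))"
  by (rule ring_map_power_card[OF ring_map_scal])

lemma frob1: "ring_map (\<lambda>x :: 'c. x ^ CARD('q))"
  using frob[of 1] by simp

lemma scal_power: "scal \<iota> c ^ (CARD('q) ^ k) = scal \<iota> c"
proof (induction k)
  case (Suc k)
  then show ?case by (simp add: power_mult mult.commute scal.map_power[symmetric] finite_field_power_card)
qed simp

lemma abs_power_fixed:
  assumes "x ^ n = x" "n \<ge> 2" "x \<noteq> 0"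
  shows "a x = 1"
proof -
  have "a x ^ n = a x" using assms(1) abs_power[of x n] by simp
  moreover have "a x ^ n = a x * a x ^ (n - 1)" using assms(2) by (cases n) auto
  ultimately have "a x ^ (n - 1) = 1" using assms(3) by auto
  then show ?thesis using assms(2) using power_eq_iff_eq_base[of "n - 1" "a x" 1] by simp
qed

lemma abs_scal: "c \<noteq> 0 \<Longrightarrow> a (scal \<iota> c) = 1"
  using abs_power_fixed[of "scal \<iota> c" "CARD('q)"] scal_power[of c 1] card_field_ge_2[where 'q = 'q]
  by (auto simp: ring_map_inj[OF ring_map_scal])

lemma abs_scal_le: "a (scal \<iota> c) \<le> 1"
  using abs_scal[of c] by (cases "c = 0") (auto simp: scal.map_zero)

lemma scal_poly_gam: "poly (map_poly (scal \<iota>) b) (theta \<iota>) = gam \<iota> b"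
proof (induction b)
  case (pCons c b)
  have "gam \<iota> (pCons c b) = gam \<iota> ([:c:] + [:0, 1:] * b)" by simp
  also have "\<dots> = scal \<iota> c + theta \<iota> * gam \<iota> b"
    unfolding gam.map_add gam.map_mult by (simp add: scal_def theta_def)
  finally show ?case using pCons by (simp add: map_poly_pCons scal.map_zero)
qed (simp add: gam.map_zero)

lemma ring_map_A_to_fps: "ring_map (A_to_fps \<iota>)"
  unfolding A_to_fps_def using ring_map_comp[OF scal.ring_map_map_poly ring_map_fps_of_poly] .

sublocale A: ring_map "A_to_fps \<iota>" by (rule ring_map_A_to_fps)

lemma A_to_fps_nth: "fps_nth (A_to_fps \<iota> b) n = scal \<iota> (poly.coeff b n)"
  by (simp add: A_to_fps_def scal.coeff_map)

lemma sigma_A_to_fps: "sigma (CARD('q) ^ k) (A_to_fps \<iota> b) = A_to_fps \<iota> b"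
  by (simp add: fps_eq_iff A_to_fps_nth scal_power)

lemma A_to_fps_eq_map: "A_to_fps \<iota> b = fps_of_poly (map_poly \<iota> (map_poly ac_scal b))"
  by (simp add: fps_eq_iff A_to_fps_nth \<iota>.coeff_map ring_map.coeff_map[OF ring_map_ac_scal] scal_eq)

lemma tate_mult: "F \<in> tate_algebra a \<Longrightarrow> G \<in> tate_algebra a \<Longrightarrow> F * G \<in> tate_algebra a"
  unfolding tate_iff by (rule conv_at_mult)

lemma tate_add: "F \<in> tate_algebra a \<Longrightarrow> G \<in> tate_algebra a \<Longrightarrow> F + G \<in> tate_algebra a"
  unfolding tate_iff by (rule conv_at_add)

lemma tate_diff: "F \<in> tate_algebra a \<Longrightarrow> G \<in> tate_algebra a \<Longrightarrow> F - G \<in> tate_algebra a"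
  unfolding tate_iff by (rule conv_at_diff)

lemma tate_poly: "fps_of_poly p \<in> tate_algebra a"
  unfolding tate_iff by (rule conv_at_poly)

lemma tate_A: "A_to_fps \<iota> b \<in> tate_algebra a"
  unfolding A_to_fps_def by (rule tate_poly)

lemma tate_sigma:
  assumes "F \<in> tate_algebra a"
  shows "sigma (CARD('q) ^ k) F \<in> tate_algebra a"
proof -
  have "(\<lambda>n. a (fps_nth F n) ^ (CARD('q) ^ k)) \<longlonglongrightarrow> 0 ^ (CARD('q) ^ k)"
    using assms unfolding tate_algebra_def by (intro tendsto_power) auto
  then show ?thesis by (simp add: tate_algebra_def abs_power zero_power)
qed

text \<open>
  The Gauss norm is multiplicative: let \<open>l\<close> be the last index at which the coefficients of \<open>h\<close> reach their
  largest absolute value \<open>M\<close>.  The coefficients of \<open>m\<close> have absolute value 0 or 1, hence the coefficient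
  of the product at \<open>l + degree m\<close> has absolute value \<open>M\<close> as well.
\<close>

lemma weierstrass_unique:
  assumes "m \<noteq> 0" "h \<in> tate_algebra a"
    and "\<And>n. degree m \<le> n \<Longrightarrow> fps_nth (A_to_fps \<iota> m * h) n = 0"
  shows "h = 0"
proof (rule ccontr)
  assume "h \<noteq> 0"
  then obtain k where k: "fps_nth h k \<noteq> 0" by (auto simp: fps_eq_iff)
  have fin: "finite {n. c \<le> a (fps_nth h n)}" if "c > 0" for c
  proof -
    have "eventually (\<lambda>n. a (fps_nth h n) < c) sequentially"
      using assms(2) that unfolding tate_algebra_def by (auto dest: order_tendstoD)
    then obtain N where "\<And>n. N \<le> n \<Longrightarrow> a (fps_nth h n) < c" by (auto simp: eventually_sequentially)
    then have "{n. c \<le> a (fps_nth h n)} \<subseteq> {..<N}" by (force simp: not_le[symmetric])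
    then show ?thesis by (rule finite_subset) simp
  qed
  define S where "S = {n. a (fps_nth h k) \<le> a (fps_nth h n)}"
  have S: "finite S" "k \<in> S" unfolding S_def using fin[of "a (fps_nth h k)"] k by (auto intro: abs_pos)
  define M where "M = Max ((\<lambda>n. a (fps_nth h n)) ` S)"
  have M: "M \<in> (\<lambda>n. a (fps_nth h n)) ` S" unfolding M_def using S by (intro Max_in) auto
  have leM: "a (fps_nth h n) \<le> M" for n
  proof (cases "n \<in> S")
    case True
    then show ?thesis unfolding M_def using S by (intro Max_ge) auto
  next
    case False
    then have "a (fps_nth h n) \<le> a (fps_nth h k)" by (simp add: S_def)
    also have "\<dots> \<le> M" unfolding M_def using S by (intro Max_ge) auto
    finally show ?thesis .
  qed
  have M0: "M > 0" using leM[of k] abs_pos[OF k] by linarith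
  define R where "R = {n. M \<le> a (fps_nth h n)}"
  have R: "finite R" "R \<noteq> {}" using fin[OF M0] M by (auto simp: R_def)
  define l where "l = Max R"
  have "l \<in> R" unfolding l_def using R by (intro Max_in)
  then have l: "a (fps_nth h l) = M" using leM[of l] by (simp add: R_def)
  have less: "a (fps_nth h n) < M" if "l < n" for n
    using that Max_ge[OF R(1), of n] by (force simp: l_def R_def not_le[symmetric])
  define D where "D = degree m"
  have "fps_nth (A_to_fps \<iota> m * h) (l + D) =
      (\<Sum>i\<le>l + D. scal \<iota> (poly.coeff m i) * fps_nth h (l + D - i))"
    by (simp add: fps_mult_nth A_to_fps_nth atLeast0AtMost)
  also have "\<dots> = scal \<iota> (poly.coeff m D) * fps_nth h l +
      (\<Sum>i\<in>{..l + D} - {D}. scal \<iota> (poly.coeff m i) * fps_nth h (l + D - i))"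
    by (subst sum.remove[of _ D]) auto
  also have "a \<dots> = a (scal \<iota> (poly.coeff m D) * fps_nth h l)"
  proof (rule abs_add_eq)
    have "a (\<Sum>i\<in>{..l + D} - {D}. scal \<iota> (poly.coeff m i) * fps_nth h (l + D - i)) < M"
    proof (rule abs_sum_less)
      fix i assume i: "i \<in> {..l + D} - {D}"
      show "a (scal \<iota> (poly.coeff m i) * fps_nth h (l + D - i)) < M"
      proof (cases "D < i")
        case True
        then show ?thesis using M0 by (simp add: D_def coeff_eq_0 scal.map_zero)
      next
        case False
        then have "a (fps_nth h (l + D - i)) < M" using i by (intro less) auto
        moreover have "a (scal \<iota> (poly.coeff m i)) * a (fps_nth h (l + D - i)) \<le> a (fps_nth h (l + D - i))"
          by (intro mult_left_le_one_le abs_scal_le) auto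
        ultimately show ?thesis by (simp add: abs_mult)
      qed
    qed (rule M0)
    then show "a (\<Sum>i\<in>{..l + D} - {D}. scal \<iota> (poly.coeff m i) * fps_nth h (l + D - i))
        < a (scal \<iota> (poly.coeff m D) * fps_nth h l)"
      using assms(1) l by (simp add: abs_mult D_def abs_scal)
  qed
  also have "\<dots> = M" using assms(1) l by (simp add: abs_mult D_def abs_scal)
  finally show False using assms(3)[of "l + D"] M0 by (simp add: D_def)
qed

text \<open>
  Each monomial \<open>t^j\<close> is divided by \<open>m\<close> over the finite field.  Quotients and remainders then have
  coefficients of absolute value at most 1 and can be summed against the null sequence of coefficients
  of \<open>F\<close>.
\<close>

lemma weierstrass_division:
  assumes "m \<noteq> 0" "F \<in> tate_algebra a"
  shows "\<exists>h\<in>tate_algebra a. \<exists>r. (\<forall>i\<ge>degree m. poly.coeff r i = 0) \<and>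
    F = A_to_fps \<iota> m * h + fps_of_poly r"
proof -
  define D where "D = degree m"
  define \<kappa> where "\<kappa> j = monom 1 j div m" for j
  define \<rho> where "\<rho> j = monom 1 j mod m" for j
  have div: "m * \<kappa> j + \<rho> j = monom 1 j" for j unfolding \<kappa>_def \<rho>_def by simp
  have \<rho>: "poly.coeff (\<rho> j) i = 0" if "D \<le> i" for i j
    using degree_mod_less[OF assms(1), of "monom 1 j"] that
    by (auto simp: \<rho>_def D_def coeff_eq_0)
  have \<kappa>: "poly.coeff (\<kappa> j) i = 0" if "j < i" for i j
  proof (cases "\<kappa> j = 0")
    case False
    have j: "degree m \<le> j"
    proof (rule ccontr)
      assume "\<not> degree m \<le> j"
      then have "\<kappa> j = 0" unfolding \<kappa>_def by (intro div_poly_less) (simp add: degree_monom_eq)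
      with False show False by simp
    qed
    have "degree (\<rho> j) \<le> j"
      using degree_mod_less[OF assms(1), of "monom 1 j"] j by (auto simp: \<rho>_def)
    then have "degree (monom 1 j - \<rho> j) \<le> j"
      by (intro degree_diff_le) (auto simp: degree_monom_eq)
    moreover have "monom 1 j - \<rho> j = m * \<kappa> j" using div[of j] by (simp add: algebra_simps)
    ultimately have "degree (\<kappa> j) \<le> j"
      using degree_mult_eq[OF assms(1) False] by simp
    then show ?thesis using that by (intro coeff_eq_0) auto
  qed simp
  have lim: "(\<lambda>j. a (fps_nth F j * scal \<iota> (c j))) \<longlonglongrightarrow> 0" for c
  proof (rule tendsto_0_le)
    show "(\<lambda>j. a (fps_nth F j)) \<longlonglongrightarrow> 0" using assms(2) by (simp add: tate_algebra_def)
    show "a (fps_nth F j * scal \<iota> (c j)) \<le> a (fps_nth F j)" for j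
      unfolding abs_mult by (intro mult_right_le_one_le abs_scal_le) auto
  qed simp
  define h where "h = Abs_fps (\<lambda>i. abs_suminf a (\<lambda>j. fps_nth F j * scal \<iota> (poly.coeff (\<kappa> j) i)))"
  define r' where "r' i = abs_suminf a (\<lambda>j. fps_nth F j * scal \<iota> (poly.coeff (\<rho> j) i))" for i
  have h: "abs_sums a (\<lambda>j. fps_nth F j * scal \<iota> (poly.coeff (\<kappa> j) i)) (fps_nth h i)" for i
    unfolding h_def fps_nth_Abs_fps by (rule abs_sums_suminf[OF lim])
  have r': "abs_sums a (\<lambda>j. fps_nth F j * scal \<iota> (poly.coeff (\<rho> j) i)) (r' i)" for i
    unfolding r'_def by (rule abs_sums_suminf[OF lim])
  have r'0: "r' i = 0" if "D \<le> i" for i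
    using r'[of i] abs_sums_unique[OF _ abs_sums_zero] \<rho>[OF that] by (simp add: scal.map_zero)
  define r where "r = (\<Sum>i<D. monom (r' i) i)"
  have coeff_r: "poly.coeff r i = r' i" for i
    using r'0[of i] by (auto simp: r_def coeff_sum)
  have "h \<in> tate_algebra a"
    unfolding tate_algebra_def mem_Collect_eq
  proof (rule LIMSEQ_I)
    fix e :: real assume e: "e > 0"
    have "eventually (\<lambda>n. a (fps_nth F n) < e / 2) sequentially"
      using assms(2) e unfolding tate_algebra_def by (auto dest: order_tendstoD[of _ _ _ "e / 2"])
    then obtain N where N: "\<And>n. N \<le> n \<Longrightarrow> a (fps_nth F n) < e / 2" by (auto simp: eventually_sequentially)
    have "a (fps_nth h i) \<le> e / 2" if "N \<le> i" for i
    proof (rule abs_sums_le[OF h])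
      fix j
      show "a (fps_nth F j * scal \<iota> (poly.coeff (\<kappa> j) i)) \<le> e / 2"
      proof (cases "j < i")
        case False
        then have "a (fps_nth F j) < e / 2" using that by (intro N) auto
        moreover have "a (fps_nth F j) * a (scal \<iota> (poly.coeff (\<kappa> j) i)) \<le> a (fps_nth F j)"
          by (intro mult_right_le_one_le abs_scal_le) auto
        ultimately show ?thesis by (simp add: abs_mult)
      qed (use e in \<open>simp add: \<kappa> scal.map_zero\<close>)
    qed
    then show "\<exists>no. \<forall>n\<ge>no. norm (a (fps_nth h n) - 0) < e" using e by (intro exI[of _ N]) force
  qed
  moreover have "F = A_to_fps \<iota> m * h + fps_of_poly r"
  proof (rule fps_ext)
    fix n
    let ?g = "\<lambda>j. (\<Sum>i\<le>n. scal \<iota> (poly.coeff m i) * (fps_nth F j * scal \<iota> (poly.coeff (\<kappa> j) (n - i))))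
        + fps_nth F j * scal \<iota> (poly.coeff (\<rho> j) n)"
    have "abs_sums a ?g ((\<Sum>i\<le>n. scal \<iota> (poly.coeff m i) * fps_nth h (n - i)) + r' n)"
      by (intro abs_sums_add abs_sums_sum abs_sums_cmult h r')
    moreover have "?g j = fps_nth F j * scal \<iota> (if j = n then 1 else 0)" for j
    proof -
      have "?g j = fps_nth F j * scal \<iota> (poly.coeff (m * \<kappa> j + \<rho> j) n)"
        by (simp add: coeff_mult scal.map_add scal.map_sum scal.map_mult distrib_left sum_distrib_left mult_ac)
      then show ?thesis by (simp only: div coeff_monom)
    qed
    moreover have "abs_sums a (\<lambda>j. fps_nth F j * scal \<iota> (if j = n then 1 else 0))
       (\<Sum>j<Suc n. fps_nth F j * scal \<iota> (if j = n then 1 else 0))"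
      by (rule abs_sums_finite) (auto simp: scal.map_zero)
    ultimately have "(\<Sum>i\<le>n. scal \<iota> (poly.coeff m i) * fps_nth h (n - i)) + r' n =
      (\<Sum>j<Suc n. fps_nth F j * scal \<iota> (if j = n then 1 else 0))"
      using abs_sums_unique by presburger
    also have "\<dots> = (\<Sum>j<Suc n. if j = n then fps_nth F j else 0)"
      by (intro sum.cong) (auto simp: scal.map_one scal.map_zero)
    also have "\<dots> = fps_nth F n" by simp
    finally show "fps_nth F n = fps_nth (A_to_fps \<iota> m * h + fps_of_poly r) n"
      by (simp add: fps_mult_nth A_to_fps_nth atLeast0AtMost coeff_r)
  qed
  moreover have "\<forall>i\<ge>degree m. poly.coeff r i = 0" using coeff_r r'0 by (simp add: D_def)
  ultimately show ?thesis by blast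
qed

end

section \<open>The Betti lattice and the period at infinity\<close>

locale infinite_place = place \<iota> a for \<iota> :: "'q::{finite,field} ratbar \<Rightarrow> 'c::field" and a :: "'c \<Rightarrow> real" +
  assumes abs_gam: "b \<noteq> 0 \<Longrightarrow> a (gam \<iota> b) = real CARD('q) ^ degree b"
begin

abbreviation "\<theta> \<equiv> theta \<iota>"
abbreviation "\<zeta> \<equiv> inverse (theta \<iota>)"
abbreviation "ell \<equiv> ell_minus \<iota> a"

lemma q_ge_2: "CARD('q) \<ge> 2" by (rule card_field_ge_2)

lemma abs_theta: "a \<theta> = real CARD('q)"
  using abs_gam[of "[:0, 1:]"] by (simp add: theta_def)

lemma theta_nonzero: "\<theta> \<noteq> 0"
  using abs_theta q_ge_2 by auto

lemma abs_zeta: "a \<zeta> = 1 / real CARD('q)" "a \<zeta> < 1" "0 < a \<zeta>" "a \<zeta> \<le> 1"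
  unfolding abs_inverse abs_theta using q_ge_2 by (auto simp: inverse_eq_divide)

sublocale sigma: ring_map "sigma CARD('q) :: 'c fps \<Rightarrow> 'c fps"
  by (rule ring_map_sigma[OF frob1])

definition partial_product :: "nat \<Rightarrow> 'c fps" where
  "partial_product N = (\<Prod>i<N. 1 - fps_const (\<zeta> ^ (CARD('q) ^ i)) * fps_X)"

lemma one_minus_const_X_mult_nth:
  fixes c :: 'c
  shows
  "fps_nth ((1 - fps_const c * fps_X) * F) n = fps_nth F n - (if n = 0 then 0 else c * fps_nth F (n - 1))"
proof -
  have "(1 - fps_const c * fps_X) * F = 1 * F - fps_const c * fps_X * F" by (rule left_diff_distrib)
  also have "fps_const c * fps_X * F = fps_const c * (fps_X * F)" by (rule mult.assoc)
  finally show ?thesis by simp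
qed

lemma partial_product_Suc:
  "partial_product (Suc N) = (1 - fps_const (\<zeta> ^ (CARD('q) ^ N)) * fps_X) * partial_product N"
  by (simp add: partial_product_def)

text \<open>
  Applying \<open>\<sigma>\<close> shifts the factors by one, which becomes the functional equation of \<open>\<ell>\<close> in the limit.
\<close>

lemma partial_product_sigma:
  "partial_product (Suc N) = (1 - fps_const \<zeta> * fps_X) * sigma CARD('q) (partial_product N)"
  unfolding partial_product_def prod.lessThan_Suc_shift sigma.map_prod
  by (simp add: sigma.map_diff sigma.map_one sigma.map_mult sigma_const[OF frob1] sigma_X[OF frob1]
      power_mult[symmetric] mult.commute[of "_ ^ _" "CARD('q)"])

lemma abs_zeta_power_le: "a (\<zeta> ^ (CARD('q) ^ N)) \<le> a \<zeta> ^ N" "a (\<zeta> ^ (CARD('q) ^ N)) \<le> a \<zeta>"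
proof -
  have "N < CARD('q) ^ N" using q_ge_2 by (intro less_exp[THEN order.strict_trans2] power_mono) auto
  moreover have "1 \<le> CARD('q) ^ N" using q_ge_2 by simp
  ultimately show "a (\<zeta> ^ (CARD('q) ^ N)) \<le> a \<zeta> ^ N" "a (\<zeta> ^ (CARD('q) ^ N)) \<le> a \<zeta>"
    unfolding abs_power using abs_zeta power_decreasing[of N "CARD('q) ^ N" "a \<zeta>"] power_decreasing[of 1 "CARD('q) ^ N" "a \<zeta>"]
    by auto
qed

text \<open>
  The factors \<open>1 - c t\<close> with \<open>|c| \<le> |\<zeta>|\<close> are bounded by 1 on the disc of radius \<open>q\<close>.  This decay makes the
  infinite product a unit of the Tate algebra and lets its constant term dominate at \<open>t = \<theta>\<close>.
\<close>

lemma partial_product_bound: "a (fps_nth (partial_product N) n) \<le> a \<zeta> ^ n"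
proof (induction N arbitrary: n)
  case 0
  show ?case using abs_zeta by (cases n) (auto simp: partial_product_def)
next
  case (Suc N)
  show ?case
  proof (cases n)
    case 0
    then show ?thesis using Suc[of 0] unfolding partial_product_Suc one_minus_const_X_mult_nth by simp
  next
    case (Suc k)
    have "a (\<zeta> ^ (CARD('q) ^ N) * fps_nth (partial_product N) k) \<le> a \<zeta> * a \<zeta> ^ k"
      unfolding abs_mult using Suc.IH[of k] abs_zeta abs_zeta_power_le by (intro mult_mono) auto
    then show ?thesis unfolding partial_product_Suc one_minus_const_X_mult_nth
      using Suc Suc.IH[of n] by (auto intro!: abs_diff_le')
  qed
qed

lemma partial_product_converges:
  "converges (\<lambda>N. fps_nth (partial_product N) n) (fps_nth ell n)"
proof -
  have "(\<lambda>N. a (fps_nth (partial_product (Suc N)) n - fps_nth (partial_product N) n)) \<longlonglongrightarrow> 0"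
  proof (rule tendsto_0_le)
    show "(\<lambda>N. a \<zeta> ^ N) \<longlonglongrightarrow> 0" using abs_zeta by (intro LIMSEQ_power_zero) auto
    fix N
    have "a (fps_nth (partial_product N) (n - 1)) \<le> 1"
      using partial_product_bound[of N "n - 1"] abs_zeta by (meson order_trans power_le_one less_imp_le)
    then have "a (\<zeta> ^ (CARD('q) ^ N)) * a (fps_nth (partial_product N) (n - 1)) \<le> a \<zeta> ^ N * 1"
      using abs_zeta abs_zeta_power_le by (intro mult_mono) auto
    then show "a (fps_nth (partial_product (Suc N)) n - fps_nth (partial_product N) n) \<le> a \<zeta> ^ N"
      unfolding partial_product_Suc one_minus_const_X_mult_nth using abs_zeta by (simp add: abs_mult)
  qed simp
  then obtain l where "converges (\<lambda>N. fps_nth (partial_product N) n) l"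
    using converges_exists[of "\<lambda>N. fps_nth (partial_product N) n"] by blast
  then show ?thesis unfolding ell_minus_def fps_nth_Abs_fps partial_product_def[symmetric]
    by (subst abs_lim_eq) auto
qed

lemma ell_bound: "a (fps_nth ell n) \<le> a \<zeta> ^ n"
  using partial_product_converges partial_product_bound by (rule converges_le)

lemma ell_0: "fps_nth ell 0 = 1"
proof -
  have "fps_nth (partial_product N) 0 = 1" for N
  proof (induction N)
    case (Suc N)
    then show ?case unfolding partial_product_Suc one_minus_const_X_mult_nth by simp
  qed (simp add: partial_product_def)
  then have "converges (\<lambda>N. 1) (fps_nth ell 0)" using partial_product_converges[of 0] by simp
  then show ?thesis by (rule converges_unique) (rule converges_const)
qed

lemma ell_sigma: "ell = (1 - fps_const \<zeta> * fps_X) * sigma CARD('q) ell"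
proof (rule fps_ext)
  fix n
  have "converges (\<lambda>N. fps_nth (partial_product (Suc N)) n)
      (fps_nth ell n ^ CARD('q) - (if n = 0 then 0 else \<zeta> * fps_nth ell (n - 1) ^ CARD('q)))"
    unfolding partial_product_sigma one_minus_const_X_mult_nth sigma_nth
    using converges_const[of 0] converges_cmult[OF converges_power[OF partial_product_converges frob1]]
    by (intro converges_diff converges_power frob1 partial_product_converges) simp
  moreover have "converges (\<lambda>N. fps_nth (partial_product (Suc N)) n) (fps_nth ell n)"
    unfolding converges_Suc[of "\<lambda>N. fps_nth (partial_product N) n"] by (rule partial_product_converges)
  ultimately show "fps_nth ell n = fps_nth ((1 - fps_const \<zeta> * fps_X) * sigma CARD('q) ell) n"
    unfolding one_minus_const_X_mult_nth sigma_nth by (rule converges_unique[rotated])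
qed

lemma inverse_ell_bound: "a (fps_nth (inverse ell) n) \<le> a \<zeta> ^ n"
proof (induction n rule: less_induct)
  case (less n)
  show ?case
  proof (cases "n = 0")
    case True
    then show ?thesis using ell_0 by simp
  next
    case False
    have "inverse ell * ell = 1" using ell_0 by (intro inverse_mult_eq_1) simp
    then have "0 = fps_nth (ell * inverse ell) n" using False by (simp add: mult.commute)
    also have "\<dots> = (\<Sum>i\<in>{0..n}. fps_nth ell i * fps_nth (inverse ell) (n - i))" by (simp add: fps_mult_nth)
    also have "\<dots> = fps_nth (inverse ell) n + (\<Sum>i\<in>{0..n} - {0}. fps_nth ell i * fps_nth (inverse ell) (n - i))"
      by (subst sum.remove[of _ 0]) (auto simp: ell_0)
    finally have eq: "fps_nth (inverse ell) n = - (\<Sum>i\<in>{0..n} - {0}. fps_nth ell i * fps_nth (inverse ell) (n - i))"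
      by (simp add: eq_neg_iff_add_eq_0)
    have "a (\<Sum>i\<in>{0..n} - {0}. fps_nth ell i * fps_nth (inverse ell) (n - i)) \<le> a \<zeta> ^ n"
    proof (rule abs_sum_le)
      fix i assume i: "i \<in> {0..n} - {0}"
      have "a (fps_nth ell i) * a (fps_nth (inverse ell) (n - i)) \<le> a \<zeta> ^ i * a \<zeta> ^ (n - i)"
        using i abs_zeta by (intro mult_mono ell_bound less) auto
      then show "a (fps_nth ell i * fps_nth (inverse ell) (n - i)) \<le> a \<zeta> ^ n"
        using i by (simp add: abs_mult power_add[symmetric])
    qed simp
    then show ?thesis by (subst eq) simp
  qed
qed

lemma geometric_tate:
  assumes "\<And>n. a (fps_nth F n) \<le> a \<zeta> ^ n"
  shows "F \<in> tate_algebra a"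
  unfolding tate_algebra_def mem_Collect_eq
proof (rule tendsto_0_le)
  show "(\<lambda>n. a \<zeta> ^ n) \<longlonglongrightarrow> 0" using abs_zeta by (intro LIMSEQ_power_zero) auto
qed (auto simp: assms)

end

locale carlitz_period = infinite_place \<iota> a for \<iota> :: "'q::{finite,field} ratbar \<Rightarrow> 'c::field" and a :: "'c \<Rightarrow> real" +
  fixes \<beta> :: 'c and u :: "'c fps \<Rightarrow> 'q poly"
  assumes beta: "\<beta> ^ (CARD('q) - 1) = - inverse (theta \<iota>)"
    and u: "u \<in> H_1_Betti \<iota> a" "u (fps_const \<beta> * ell_minus \<iota> a) = 1"
begin

definition generator :: "'c fps" where
  "generator = fps_const \<beta> * ell"

lemma beta_nonzero: "\<beta> \<noteq> 0"
proof
  assume "\<beta> = 0"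
  then have "\<beta> ^ (CARD('q) - 1) = 0" using q_ge_2 by (simp add: zero_power)
  then show False unfolding beta using theta_nonzero by simp
qed

lemma beta_power: "\<beta> ^ CARD('q) = - \<zeta> * \<beta>"
proof -
  have "\<beta> ^ CARD('q) = \<beta> ^ (CARD('q) - 1) * \<beta>" using q_ge_2 by (metis Suc_pred' mult.commute power_Suc zero_less_card_finite)
  then show ?thesis using beta by simp
qed

lemma generator_tate: "generator \<in> tate_algebra a"
  unfolding generator_def tate_iff
  by (intro conv_at_mult conv_at_const geometric_tate[unfolded tate_iff] ell_bound)

lemma generator_sigma: "generator = (fps_X - fps_const \<theta>) * sigma CARD('q) generator"
proof -
  have "(fps_X - fps_const \<theta>) * sigma CARD('q) generator = (fps_X - fps_const \<theta>) * fps_const (- \<zeta>) * fps_const \<beta> * sigma CARD('q) ell"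
    by (simp only: generator_def sigma.map_mult sigma_const[OF frob1] beta_power mult.assoc fps_const_mult[symmetric])
  also have "(fps_X - fps_const \<theta>) * fps_const (- \<zeta>) = fps_const (\<theta> * \<zeta>) - fps_const \<zeta> * fps_X"
  proof -
    have "fps_const (- \<zeta>) = - fps_const \<zeta>" by simp
    then have "(fps_X - fps_const \<theta>) * fps_const (- \<zeta>) = fps_const \<theta> * fps_const \<zeta> - fps_const \<zeta> * fps_X"
      by (simp only: left_diff_distrib mult_minus_right mult.commute[of fps_X] minus_diff_minus)
         (simp only: minus_diff_eq diff_minus_eq_add uminus_add_conv_diff)
    then show ?thesis by (simp only: fps_const_mult)
  qed
  also have "\<dots> = 1 - fps_const \<zeta> * fps_X" using theta_nonzero by simp
  also have "(1 - fps_const \<zeta> * fps_X) * fps_const \<beta> * sigma CARD('q) ell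
      = fps_const \<beta> * ((1 - fps_const \<zeta> * fps_X) * sigma CARD('q) ell)" by (simp only: mult_ac)
  also have "(1 - fps_const \<zeta> * fps_X) * sigma CARD('q) ell = ell" by (rule ell_sigma[symmetric])
  finally show ?thesis by (simp add: generator_def)
qed

lemma generator_in_H1: "generator \<in> H1_Betti \<iota> a"
  using generator_tate generator_sigma by (simp add: H1_Betti_def)

definition cogenerator :: "'c fps" where
  "cogenerator = fps_const (inverse \<beta>) * inverse ell"

lemma generator_inverse: "generator * cogenerator = 1"
proof -
  have "inverse ell * ell = 1" using ell_0 by (intro inverse_mult_eq_1) simp
  moreover have "fps_const \<beta> * fps_const (inverse \<beta>) = 1" using beta_nonzero by simp
  moreover have "generator * cogenerator = (fps_const \<beta> * fps_const (inverse \<beta>)) * (inverse ell * ell)"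
    unfolding generator_def cogenerator_def by (simp only: mult_ac)
  ultimately show ?thesis by simp
qed

lemma generator_nonzero: "generator \<noteq> 0"
  using generator_inverse by auto

lemma cogenerator_tate: "cogenerator \<in> tate_algebra a"
  unfolding cogenerator_def tate_iff
  by (intro conv_at_mult conv_at_const geometric_tate[unfolded tate_iff] inverse_ell_bound)

text \<open>
  The quotient of two solutions of \<open>f = (t - \<theta>)\<sigma>(f)\<close> is fixed by \<open>\<sigma>\<close>, so its coefficients lie in the finite
  field.  Tending to 0, they vanish from some point on.
\<close>

lemma H1_generated:
  assumes "F \<in> H1_Betti \<iota> a"
  shows "\<exists>b. F = A_to_fps \<iota> b * generator"
proof -
  define G where "G = F * cogenerator"
  have F: "F = G * generator" using generator_inverse by (simp add: G_def mult_ac)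
  have "F = (fps_X - fps_const \<theta>) * sigma CARD('q) F" "F \<in> tate_algebra a"
    using assms by (auto simp: H1_Betti_def)
  have "G * generator = (fps_X - fps_const \<theta>) * sigma CARD('q) F" unfolding F[symmetric] by (rule \<open>F = (fps_X - _) * _\<close>)
  also have "\<dots> = sigma CARD('q) G * ((fps_X - fps_const \<theta>) * sigma CARD('q) generator)"
    by (subst F) (simp add: sigma.map_mult mult_ac)
  also have "\<dots> = sigma CARD('q) G * generator" by (subst (2) generator_sigma) (rule refl)
  finally have "G = sigma CARD('q) G" using generator_nonzero by simp
  then have "fps_nth G n ^ CARD('q) = fps_nth G n" for n by (metis sigma_nth)
  then have "\<exists>c. fps_nth G n = scal \<iota> c" for n using power_card_fixed[OF ring_map_scal] by blast
  then obtain c where c: "\<And>n. fps_nth G n = scal \<iota> (c n)" by metis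
  have "G \<in> tate_algebra a" unfolding G_def using \<open>F \<in> tate_algebra a\<close> cogenerator_tate by (rule tate_mult)
  then have "eventually (\<lambda>n. a (fps_nth G n) < 1) sequentially"
    unfolding tate_algebra_def by (auto dest: order_tendstoD[of _ _ _ 1])
  then obtain N where N: "\<And>n. N \<le> n \<Longrightarrow> a (fps_nth G n) < 1" by (auto simp: eventually_sequentially)
  have c0: "c n = 0" if "N \<le> n" for n using N[OF that] abs_scal[of "c n"] c by fastforce
  define b where "b = (\<Sum>n<N. monom (c n) n)"
  have "poly.coeff b n = c n" for n using c0[of n] by (auto simp: b_def coeff_sum)
  then have "A_to_fps \<iota> b = G" by (simp add: fps_eq_iff A_to_fps_nth c)
  then show ?thesis using F by blast
qed

lemma u_generator: "u (A_to_fps \<iota> b * generator) = b"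
  using u generator_in_H1 by (auto simp: H_1_Betti_def generator_def)

text \<open>
  The \<open>q\<close>-th power turns the decay \<open>|\<zeta>|^n\<close> of the coefficients into \<open>|\<zeta>|^(q n) \<le> |\<zeta>|^(2 n)\<close>, of which the
  factor \<open>|\<theta>|^n\<close> consumes only half.
\<close>

lemma sigma_generator_terms: "a (fps_nth (sigma CARD('q) generator) n * \<theta> ^ n) \<le> a \<beta> ^ CARD('q) * a \<zeta> ^ n"
proof -
  have "a (fps_nth (sigma CARD('q) generator) n * \<theta> ^ n) = a \<beta> ^ CARD('q) * (a (fps_nth ell n) ^ CARD('q) * a \<theta> ^ n)"
    by (simp add: generator_def abs_mult abs_power power_mult_distrib)
  also have "a (fps_nth ell n) ^ CARD('q) \<le> (a \<zeta> ^ n) ^ CARD('q)" by (intro power_mono ell_bound) simp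
  also have "(a \<zeta> ^ n) ^ CARD('q) \<le> (a \<zeta> ^ n) ^ 2"
    using q_ge_2 abs_zeta by (intro power_decreasing) (auto intro: power_le_one)
  also have "(a \<zeta> ^ n) ^ 2 * a \<theta> ^ n = a \<zeta> ^ n"
    using theta_nonzero by (simp add: abs_inverse power2_eq_square power_inverse)
  finally show ?thesis by (simp add: mult_left_mono mult_right_mono)
qed

lemma sigma_generator_conv: "conv_at (sigma CARD('q) generator) \<theta>"
  unfolding conv_at_def
proof (rule tendsto_0_le)
  show "(\<lambda>n. a \<beta> ^ CARD('q) * a \<zeta> ^ n) \<longlonglongrightarrow> 0"
    using abs_zeta by (intro tendsto_mult_right_zero LIMSEQ_power_zero) auto
qed (auto intro: sigma_generator_terms simp del: sigma_nth)

lemma h_infinity_value: "h_infinity \<iota> a F = fps_value (sigma CARD('q) F) \<theta>"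
  by (simp add: h_infinity_def fps_value_def)

lemma abs_h_generator: "a (h_infinity \<iota> a generator) = a \<beta> ^ CARD('q)"
proof -
  let ?f = "\<lambda>n. fps_nth (sigma CARD('q) generator) n * \<theta> ^ n"
  have f0: "a (?f 0) = a \<beta> ^ CARD('q)" by (simp add: generator_def ell_0 abs_power)
  have "a (fps_value (sigma CARD('q) generator) \<theta>) = a (?f 0)"
  proof (rule abs_sums_dominated[OF conv_at_sums[OF sigma_generator_conv]])
    have bpos: "a \<beta> ^ CARD('q) > 0" using abs_pos[OF beta_nonzero] by simp
    show "a (?f (Suc n)) \<le> a \<beta> ^ CARD('q) * a \<zeta>" for n
    proof (rule order_trans[OF sigma_generator_terms])
      have "a \<zeta> ^ Suc n \<le> a \<zeta>" using abs_zeta power_decreasing[of 1 "Suc n" "a \<zeta>"] by simp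
      then show "a \<beta> ^ CARD('q) * a \<zeta> ^ Suc n \<le> a \<beta> ^ CARD('q) * a \<zeta>" by (intro mult_left_mono) auto
    qed
    show "a \<beta> ^ CARD('q) * a \<zeta> < a (?f 0)" unfolding f0 using mult_strict_left_mono[OF abs_zeta(2) bpos] by simp
  qed
  then show ?thesis unfolding h_infinity_value f0 .
qed

lemma h_infinity_mult: "h_infinity \<iota> a (A_to_fps \<iota> b * generator) = gam \<iota> b * h_infinity \<iota> a generator"
proof -
  have "sigma CARD('q) (A_to_fps \<iota> b * generator) = A_to_fps \<iota> b * sigma CARD('q) generator"
    using sigma_A_to_fps[of 1 b] by (simp add: sigma.map_mult)
  moreover have "conv_at (A_to_fps \<iota> b) \<theta>" "fps_value (A_to_fps \<iota> b) \<theta> = gam \<iota> b"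
    unfolding A_to_fps_def by (auto simp: conv_at_poly fps_value_poly scal_poly_gam)
  ultimately show ?thesis unfolding h_infinity_value
    by (simp add: fps_value_mult sigma_generator_conv)
qed

lemma h_generator_nonzero: "h_infinity \<iota> a generator \<noteq> 0"
  using abs_h_generator abs_pos[OF beta_nonzero] by (metis abs_0 less_irrefl zero_less_power)

lemma pairing_infinity_eq: "pairing_infinity \<iota> a u = inverse (h_infinity \<iota> a generator)"
  unfolding pairing_infinity_def
proof (rule the_equality)
  show "\<forall>F\<in>H1_Betti \<iota> a. gam \<iota> (u F) = h_infinity \<iota> a F * inverse (h_infinity \<iota> a generator)"
  proof
    fix F assume "F \<in> H1_Betti \<iota> a"
    then obtain b where "F = A_to_fps \<iota> b * generator" using H1_generated by blast
    then show "gam \<iota> (u F) = h_infinity \<iota> a F * inverse (h_infinity \<iota> a generator)"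
      using h_generator_nonzero by (simp add: u_generator h_infinity_mult)
  qed
next
  fix c assume "\<forall>F\<in>H1_Betti \<iota> a. gam \<iota> (u F) = h_infinity \<iota> a F * c"
  then have "gam \<iota> (u generator) = h_infinity \<iota> a generator * c" using generator_in_H1 by blast
  moreover have "u generator = 1" using u by (simp add: generator_def)
  ultimately show "c = inverse (h_infinity \<iota> a generator)"
    using h_generator_nonzero by (simp add: gam.map_one field_simps)
qed

lemma abs_period_infinity_pos: "abs_period_infinity \<iota> a u > 0"
  unfolding abs_period_infinity_def pairing_infinity_eq using h_generator_nonzero by (intro abs_pos) simp

lemma ln_abs_period_infinity:
  "ln (abs_period_infinity \<iota> a u) = real CARD('q) / (real CARD('q) - 1) * ln (real CARD('q))"
proof -
  have b: "a \<beta> > 0" using abs_pos[OF beta_nonzero] .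
  have "a \<beta> ^ (CARD('q) - 1) = 1 / real CARD('q)"
    using beta abs_power[of \<beta> "CARD('q) - 1"] abs_zeta by simp
  then have "real (CARD('q) - 1) * ln (a \<beta>) = - ln (real CARD('q))"
    using b ln_realpow[of "a \<beta>" "CARD('q) - 1"] q_ge_2 by (simp add: ln_div)
  then have l: "ln (a \<beta>) = - ln (real CARD('q)) / (real CARD('q) - 1)"
    using q_ge_2 by (simp add: field_simps of_nat_diff)
  have "ln (abs_period_infinity \<iota> a u) = - ln (a \<beta> ^ CARD('q))"
    unfolding abs_period_infinity_def pairing_infinity_eq abs_inverse abs_h_generator
    by (rule ln_inverse)
  also have "\<dots> = - real CARD('q) * ln (a \<beta>)" using b by (simp add: ln_realpow)
  also have "\<dots> = real CARD('q) / (real CARD('q) - 1) * ln (real CARD('q))" unfolding l by simp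
  finally show ?thesis .
qed

end

section \<open>The expansion of the coordinate at a finite place\<close>

lemma diff_dvd_poly_diff: "(x - y) dvd poly p x - poly p (y :: 'a::comm_ring_1)"
proof (induction p)
  case (pCons c p)
  have "poly (pCons c p) x - poly (pCons c p) y = (x - y) * poly p x + y * (poly p x - poly p y)"
    by (simp add: algebra_simps)
  then show ?case using pCons by (metis dvd_add dvd_mult dvd_triv_left)
qed simp

lemma ring_map_fps_nth_0: "ring_map (\<lambda>F :: 'a::comm_ring_1 fps. fps_nth F 0)"
  by standard auto

locale finite_place = place \<iota> a
  for \<iota> :: "'q::{finite,field} ratbar \<Rightarrow> 'c::field" and a :: "'c \<Rightarrow> real" +
  fixes v :: "'q poly"
  assumes irreducible: "Factorial_Ring.irreducible v"
    and abs_gam_power: "\<not> v dvd b \<Longrightarrow> a (gam \<iota> (v ^ n * b)) = (1 / real (qv v)) ^ n"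
begin

abbreviation "w \<equiv> gam \<iota> v"

lemma v_prime: "prime_elem v"
  using irreducible by (rule field_poly_irreducible_imp_prime)

lemma v_nonzero: "v \<noteq> 0" using irreducible by auto

lemma v_not_unit: "\<not> v dvd 1" using v_prime by (simp add: prime_elem_def)

lemma degree_v_pos: "0 < degree v"
proof (rule ccontr)
  assume "\<not> 0 < degree v"
  then have "v dvd 1" using v_nonzero by (simp add: is_unit_iff_degree)
  then show False using v_not_unit by simp
qed

lemma qv_ge_2: "qv v \<ge> 2"
proof -
  have "2 \<le> CARD('q) ^ 1" using card_field_ge_2[where 'q = 'q] by simp
  also have "\<dots> \<le> qv v" unfolding qv_def using degree_v_pos
    by (intro power_increasing) auto
  finally show ?thesis .
qed

lemma abs_w: "a w = 1 / real (qv v)"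
  using abs_gam_power[of 1 1] v_not_unit by simp

lemma abs_w_bounds: "0 < a w" "a w < 1" "a w \<le> 1"
  unfolding abs_w using qv_ge_2 by auto

lemma w_nonzero: "w \<noteq> 0"
  using abs_w_bounds by auto

lemma abs_gam_unit: "\<not> v dvd b \<Longrightarrow> a (gam \<iota> b) = 1"
  using abs_gam_power[of b 0] by simp

lemma abs_gam_le_1: "a (gam \<iota> b) \<le> 1"
proof (induction "degree b" arbitrary: b rule: less_induct)
  case less
  show ?case
  proof (cases "v dvd b \<and> b \<noteq> 0")
    case True
    then obtain c where c: "b = v * c" by (auto elim: dvdE)
    have "degree c < degree b"
      using True degree_v_pos unfolding c by (subst degree_mult_eq) auto
    then have "a w * a (gam \<iota> c) \<le> 1"
      using less abs_w_bounds by (intro mult_le_one) auto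
    then show ?thesis by (simp add: c gam.map_mult abs_mult)
  next
    case False
    then show ?thesis using abs_gam_unit[of b] by (cases "b = 0") (auto simp: gam.map_zero)
  qed
qed

lemma abs_gam_dvd: "v dvd b \<Longrightarrow> a (gam \<iota> b) \<le> a w"
  using abs_gam_le_1 abs_w_bounds by (auto elim!: dvdE simp: gam.map_mult abs_mult intro: mult_right_le_one_le)

lemma frob_qv: "ring_map (\<lambda>x :: 'c. x ^ (qv v))"
  unfolding qv_def by (rule frob)

lemma frob_qv_power: "ring_map (\<lambda>x :: 'c. x ^ (qv v ^ n))"
  unfolding qv_def power_mult[symmetric] by (rule frob)

sublocale sigma_v: ring_map "sigma (qv v) :: 'c fps \<Rightarrow> 'c fps"
  by (rule ring_map_sigma[OF frob_qv])

text \<open>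
  The closure of \<open>A\<close>, that is, the ring of integers \<open>A\<^sub>v\<close> of \<open>K\<^sub>v\<close>.  The digits of \<open>\<theta>\<close> are constructed inside
  it, where Fermat's congruence modulo \<open>v\<close> is available by approximation.
\<close>

definition A_closure :: "'c set" where
  "A_closure = {x. \<forall>e>0. \<exists>b. a (x - gam \<iota> b) < e}"

lemma A_closureD: "x \<in> A_closure \<Longrightarrow> 0 < e \<Longrightarrow> \<exists>b. a (x - gam \<iota> b) < e"
  unfolding A_closure_def by blast

lemma gam_in_closure: "gam \<iota> b \<in> A_closure"
  by (auto simp: A_closure_def intro!: exI[of _ b])

lemma A_closure_le_1:
  assumes "x \<in> A_closure"
  shows "a x \<le> 1"
proof -
  obtain b where "a (x - gam \<iota> b) < 1" using assms by (auto simp: A_closure_def dest: spec[of _ 1])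
  then have "a ((x - gam \<iota> b) + gam \<iota> b) \<le> 1" by (intro abs_add_le' abs_gam_le_1) simp
  then show ?thesis by simp
qed

lemma A_closure_diff:
  assumes "x \<in> A_closure" "y \<in> A_closure"
  shows "x - y \<in> A_closure"
  unfolding A_closure_def
proof safe
  fix e :: real assume "e > 0"
  then obtain b c where "a (x - gam \<iota> b) < e" "a (y - gam \<iota> c) < e" using assms A_closureD by blast
  then have "a ((x - gam \<iota> b) - (y - gam \<iota> c)) < e"
    using abs_diff_le[of "x - gam \<iota> b" "y - gam \<iota> c"] by linarith
  then show "\<exists>b. a (x - y - gam \<iota> b) < e"
    by (intro exI[of _ "b - c"]) (simp add: gam.map_diff algebra_simps)
qed

lemma A_closure_mult:
  assumes "x \<in> A_closure" "y \<in> A_closure"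
  shows "x * y \<in> A_closure"
  unfolding A_closure_def
proof safe
  fix e :: real assume "e > 0"
  then obtain b c where bc: "a (x - gam \<iota> b) < e" "a (y - gam \<iota> c) < e" using assms A_closureD by blast
  have "a (x * (y - gam \<iota> c)) \<le> a (y - gam \<iota> c)"
    unfolding abs_mult using A_closure_le_1[OF assms(1)] by (intro mult_left_le_one_le) auto
  moreover have "a ((x - gam \<iota> b) * gam \<iota> c) \<le> a (x - gam \<iota> b)"
    unfolding abs_mult using abs_gam_le_1 by (intro mult_right_le_one_le) auto
  ultimately have "a (x * (y - gam \<iota> c) + (x - gam \<iota> b) * gam \<iota> c) < e"
    using abs_add_le[of "x * (y - gam \<iota> c)" "(x - gam \<iota> b) * gam \<iota> c"] bc by linarith
  then show "\<exists>b. a (x * y - gam \<iota> b) < e"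
    by (intro exI[of _ "b * c"]) (simp add: gam.map_mult algebra_simps)
qed

lemma A_closure_power: "x \<in> A_closure \<Longrightarrow> x ^ n \<in> A_closure"
proof (induction n)
  case 0
  show ?case using gam_in_closure[of 1] by (simp add: gam.map_one)
qed (simp add: A_closure_mult)

lemma A_closure_lim:
  assumes "converges f x" "\<And>n. f n \<in> A_closure"
  shows "x \<in> A_closure"
  unfolding A_closure_def
proof safe
  fix e :: real assume e: "e > 0"
  have "eventually (\<lambda>n. a (f n - x) < e) sequentially"
    using assms(1) e unfolding converges_def by (auto dest: order_tendstoD)
  then obtain n where n: "a (f n - x) < e" by (auto simp: eventually_sequentially)
  obtain b where "a (f n - gam \<iota> b) < e" using assms(2) e by (auto simp: A_closure_def)
  then have "a ((f n - gam \<iota> b) - (f n - x)) < e"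
    using n abs_diff_le[of "f n - gam \<iota> b" "f n - x"] by linarith
  then show "\<exists>b. a (x - gam \<iota> b) < e" by (intro exI[of _ b]) simp
qed

text \<open>
  An element of \<open>A\<close> close to \<open>x\<close> has absolute value less than 1 and is therefore divisible by \<open>v\<close>.
\<close>

lemma A_closure_divide:
  assumes "x \<in> A_closure" "a x \<le> a w"
  shows "x / w \<in> A_closure"
  unfolding A_closure_def
proof safe
  fix e :: real assume "e > 0"
  then have "min (e * a w) (a w) > 0" using abs_w_bounds by simp
  then obtain b where b: "a (x - gam \<iota> b) < min (e * a w) (a w)" using assms(1) A_closureD by blast
  then have "a (x - (x - gam \<iota> b)) \<le> a w" using assms abs_diff_le'[of x "a w" "x - gam \<iota> b"] by simp
  then have "a (gam \<iota> b) \<le> a w" by simp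
  then have "v dvd b" using abs_gam_unit[of b] abs_w_bounds by force
  then obtain c where c: "b = v * c" by (elim dvdE)
  have "x / w - gam \<iota> c = (x - gam \<iota> b) / w" using w_nonzero by (simp add: c gam.map_mult diff_divide_distrib)
  then have "a (x / w - gam \<iota> c) < e" using b abs_w_bounds by (simp add: abs_divide divide_less_eq)
  then show "\<exists>b. a (x / w - gam \<iota> b) < e" by blast
qed

lemma A_closure_fermat:
  assumes "x \<in> A_closure"
  shows "a (x ^ qv v - x) \<le> a w"
proof -
  interpret F: ring_map "\<lambda>x :: 'c. x ^ qv v" by (rule frob_qv)
  obtain b where b: "a (x - gam \<iota> b) < a w" using A_closureD[OF assms abs_w_bounds(1)] by blast
  define y where "y = x - gam \<iota> b"
  have y: "a y \<le> a w" using b by (simp add: y_def)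
  have "a (gam \<iota> (b ^ qv v - b)) \<le> a w"
    by (rule abs_gam_dvd) (simp add: qv_def fermat_poly[OF irreducible])
  then have 1: "a (gam \<iota> b ^ qv v - gam \<iota> b) \<le> a w" by (simp add: gam.map_diff gam.map_power)
  have "a (y ^ qv v) \<le> a y"
    unfolding abs_power using y abs_w_bounds qv_ge_2 power_decreasing[of 1 "qv v" "a y"] by simp
  then have 2: "a (y ^ qv v - y) \<le> a w" using y by (intro abs_diff_le') auto
  have "x ^ qv v - x = (gam \<iota> b ^ qv v - gam \<iota> b) + (y ^ qv v - y)"
    by (simp add: y_def F.map_diff)
  then show ?thesis using abs_add_le'[OF 1 2] by simp
qed

text \<open>
  The sequence \<open>x^(Q^n)\<close> converges, since its increments are the \<open>Q^n\<close>-th powers of \<open>x^Q - x\<close>, and its limit is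
  fixed by the continuous map \<open>x \<mapsto> x^Q\<close>.
\<close>

lemma teichmueller:
  assumes "x \<in> A_closure"
  shows "\<exists>e\<in>A_closure. e ^ qv v = e \<and> a (x - e) \<le> a w"
proof -
  define f where "f n = x ^ (qv v ^ n)" for n
  have step: "a (f (Suc n) - f n) \<le> a w ^ Suc n" for n
  proof -
    interpret F: ring_map "\<lambda>x :: 'c. x ^ (qv v ^ n)" by (rule frob_qv_power)
    have "f (Suc n) - f n = (x ^ qv v - x) ^ (qv v ^ n)"
      by (simp add: f_def F.map_diff power_mult[symmetric])
    then have "a (f (Suc n) - f n) \<le> a w ^ (qv v ^ n)"
      using A_closure_fermat[OF assms] by (simp add: abs_power power_mono)
    also have "n < qv v ^ n"
      using qv_ge_2 by (intro less_exp[THEN order.strict_trans2] power_mono) auto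
    then have "a w ^ (qv v ^ n) \<le> a w ^ Suc n" using abs_w_bounds by (intro power_decreasing) auto
    finally show ?thesis .
  qed
  have "(\<lambda>n. a (f (Suc n) - f n)) \<longlonglongrightarrow> 0"
  proof (rule tendsto_0_le)
    show "(\<lambda>n. a w ^ Suc n) \<longlonglongrightarrow> 0"
      using abs_w_bounds LIMSEQ_power_zero[of "a w"] LIMSEQ_Suc by fastforce
  qed (auto simp: step simp del: power_Suc)
  then obtain e where e: "converges f e" using converges_exists by blast
  have "e \<in> A_closure" by (rule A_closure_lim[OF e]) (simp add: f_def A_closure_power assms)
  moreover have "e ^ qv v = e"
  proof -
    have "converges (\<lambda>n. f n ^ qv v) (e ^ qv v)" by (rule converges_power[OF e frob_qv])
    moreover have "f n ^ qv v = f (Suc n)" for n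
      by (simp add: f_def power_mult[symmetric] mult.commute)
    ultimately have "converges f (e ^ qv v)" using converges_Suc[of f] by simp
    then show ?thesis using e converges_unique by blast
  qed
  moreover have "a (x - e) \<le> a w"
  proof -
    have "a (f n - x) \<le> a w" for n
    proof (induction n)
      case (Suc n)
      have "a w ^ Suc n \<le> a w" using abs_w_bounds power_decreasing[of 1 "Suc n" "a w"] by simp
      then have "a (f (Suc n) - f n) \<le> a w" using step[of n] by linarith
      then have "a ((f (Suc n) - f n) + (f n - x)) \<le> a w" using Suc by (rule abs_add_le')
      then show ?case by simp
    qed (use abs_w_bounds in \<open>simp add: f_def\<close>)
    with converges_diff[OF e converges_const[of x]] have "a (e - x) \<le> a w" by (rule converges_le)
    then show ?thesis by (simp add: abs_diff_commute)
  qed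
  ultimately show ?thesis by blast
qed

definition digit :: "'c \<Rightarrow> 'c" where
  "digit x = (SOME e. e \<in> A_closure \<and> e ^ qv v = e \<and> a (x - e) \<le> a w)"

lemma digit:
  assumes "x \<in> A_closure"
  shows "digit x \<in> A_closure" "digit x ^ qv v = digit x" "a (x - digit x) \<le> a w"
proof -
  have "\<exists>e. e \<in> A_closure \<and> e ^ qv v = e \<and> a (x - e) \<le> a w" using teichmueller[OF assms] by blast
  from someI_ex[OF this, folded digit_def]
  show "digit x \<in> A_closure" "digit x ^ qv v = digit x" "a (x - digit x) \<le> a w" by auto
qed

primrec remainder :: "nat \<Rightarrow> 'c" where
  "remainder 0 = theta \<iota>"
| "remainder (Suc n) = (remainder n - digit (remainder n)) / w"

lemma remainder_in_closure: "remainder n \<in> A_closure"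
proof (induction n)
  case 0
  show ?case by (simp add: theta_def gam_in_closure)
next
  case (Suc n)
  then show ?case by (simp add: A_closure_divide A_closure_diff digit)
qed

lemma digit_expansion: "abs_sums a (\<lambda>i. digit (remainder i) * w ^ i) (theta \<iota>)"
proof -
  \<comment> \<open>after \<open>n\<close> digits the error is the \<open>n\<close>-th remainder, scaled back by \<open>\<zeta>\<^sub>v^n\<close>\<close>
  have partial: "(\<Sum>i<n. digit (remainder i) * w ^ i) - theta \<iota> = - (w ^ n * remainder n)" for n
  proof (induction n)
    case (Suc n)
    have "(\<Sum>i<Suc n. digit (remainder i) * w ^ i) - theta \<iota> =
        digit (remainder n) * w ^ n - w ^ n * remainder n"
      using Suc by (simp add: algebra_simps)
    also have "\<dots> = - (w ^ n * (remainder n - digit (remainder n)))"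
      by (simp add: algebra_simps)
    also have "remainder n - digit (remainder n) = w * remainder (Suc n)" using w_nonzero by simp
    finally show ?case by (simp only: power_Suc2 mult.assoc)
  qed simp
  show ?thesis
    unfolding abs_sums_iff converges_def partial
  proof (rule tendsto_0_le)
    show "(\<lambda>n. a w ^ n) \<longlonglongrightarrow> 0" using abs_w_bounds by (intro LIMSEQ_power_zero) auto
    show "a (- (w ^ n * remainder n)) \<le> a w ^ n" for n
      using A_closure_le_1[OF remainder_in_closure[of n]]
      by (simp add: abs_mult abs_power mult_right_le_one_le)
  qed simp
qed

lemma abs_fixed: "x ^ qv v = x \<Longrightarrow> x \<noteq> 0 \<Longrightarrow> a x = 1"
  using abs_power_fixed[of x "qv v"] qv_ge_2 by simp

lemma abs_fixed_le: "x ^ qv v = x \<Longrightarrow> a x \<le> 1"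
  using abs_fixed[of x] by (cases "x = 0") auto

definition integral_coeffs :: "'c fps \<Rightarrow> bool" where
  "integral_coeffs F \<longleftrightarrow> (\<forall>n. a (fps_nth F n) \<le> 1)"

lemma integral_mult: "integral_coeffs F \<Longrightarrow> integral_coeffs G \<Longrightarrow> integral_coeffs (F * G)"
  unfolding integral_coeffs_def fps_mult_nth by (auto intro!: abs_sum_le simp: abs_mult mult_le_one)

lemma integral_prod: "(\<And>i. i \<in> I \<Longrightarrow> integral_coeffs (F i)) \<Longrightarrow> integral_coeffs (prod F I)"
  by (induction I rule: infinite_finite_induct) (auto simp: integral_mult, auto simp: integral_coeffs_def)

lemma integral_conv_at: "integral_coeffs F \<Longrightarrow> conv_at F w"
  using abs_w_bounds by (intro conv_at_bounded) (auto simp: integral_coeffs_def)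

lemma fixed_integral: "sigma (qv v) F = F \<Longrightarrow> integral_coeffs F"
  unfolding integral_coeffs_def by (metis abs_fixed_le sigma_nth)

text \<open>
  The coefficients of the difference are fixed by \<open>x \<mapsto> x^Q\<close>, hence have absolute value 0 or 1.  So the first
  nonzero one would dominate the value at \<open>\<zeta>\<^sub>v\<close>.
\<close>

lemma fixed_series_unique:
  assumes F: "sigma (qv v) F = F" and G: "sigma (qv v) G = G" and eq: "fps_value F w = fps_value G w"
  shows "F = G"
proof (rule ccontr)
  assume "F \<noteq> G"
  define H where "H = F - G"
  have HF: "sigma (qv v) H = H" unfolding H_def sigma_v.map_diff F G by (rule refl)
  have H: "fps_nth H i ^ qv v = fps_nth H i" for i using HF by (metis sigma_nth)
  have int: "a (fps_nth H i) \<le> 1" for i using abs_fixed_le[OF H] .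
  have "fps_value H w = fps_value F w - fps_value G w" unfolding H_def
    by (rule fps_value_diff) (rule integral_conv_at[OF fixed_integral[OF F]], rule integral_conv_at[OF fixed_integral[OF G]])
  then have "fps_value H w = 0" by (simp only: eq diff_self)
  then have sums: "abs_sums a (\<lambda>i. fps_nth H i * w ^ i) 0"
    using conv_at_sums[OF integral_conv_at[OF fixed_integral[OF HF]]] by (simp only:)
  have "H \<noteq> 0" using \<open>F \<noteq> G\<close> by (simp add: H_def)
  define n where "n = subdegree H"
  have n: "fps_nth H n \<noteq> 0" "\<And>i. i < n \<Longrightarrow> fps_nth H i = 0"
    unfolding n_def using \<open>H \<noteq> 0\<close> by (rule nth_subdegree_nonzero) (rule nth_less_subdegree_zero)
  have "k \<le> n \<Longrightarrow> abs_sums a (\<lambda>i. fps_nth H (i + k) * w ^ (i + k)) 0" for k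
  proof (induction k)
    case (Suc k)
    have "fps_nth H k = 0" using n(2)[of k] Suc.prems by simp
    then show ?case
      using abs_sums_Suc[of "\<lambda>i. fps_nth H (i + k) * w ^ (i + k)" 0] Suc by simp
  qed (use sums in simp)
  from this[of n] have s: "abs_sums a (\<lambda>i. fps_nth H (i + n) * w ^ (i + n)) 0" by simp
  have "a 0 = a (fps_nth H (0 + n) * w ^ (0 + n))"
  proof (rule abs_sums_dominated[OF s])
    show "a (fps_nth H (Suc i + n) * w ^ (Suc i + n)) \<le> a w ^ Suc n" for i
    proof -
      have "a (fps_nth H (Suc i + n)) * a w ^ (Suc i + n) \<le> 1 * a w ^ Suc n"
        using int[of "Suc i + n"] abs_w_bounds by (intro mult_mono power_decreasing) auto
      then show ?thesis by (simp only: abs_mult abs_power mult_1)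
    qed
    show "a w ^ Suc n < a (fps_nth H (0 + n) * w ^ (0 + n))"
      using abs_fixed[OF H n(1)] abs_w_bounds by (simp add: abs_mult abs_power)
  qed
  then show False using abs_fixed[OF H n(1)] w_nonzero by (simp add: abs_mult abs_power)
qed

abbreviation "T \<equiv> t_expansion v \<iota> a"

lemma t_expansion_exists:
  "(\<forall>i. fps_nth T i ^ qv v = fps_nth T i) \<and> abs_sums a (\<lambda>i. fps_nth T i * w ^ i) (theta \<iota>)"
  unfolding t_expansion_def
proof (rule theI')
  show "\<exists>!T. (\<forall>i. fps_nth T i ^ qv v = fps_nth T i) \<and> abs_sums a (\<lambda>i. fps_nth T i * w ^ i) (theta \<iota>)"
  proof (rule ex_ex1I)
    show "\<exists>T. (\<forall>i. fps_nth T i ^ qv v = fps_nth T i) \<and> abs_sums a (\<lambda>i. fps_nth T i * w ^ i) (theta \<iota>)"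
      using digit(2)[OF remainder_in_closure] digit_expansion
      by (intro exI[of _ "Abs_fps (\<lambda>i. digit (remainder i))"] conjI allI) (simp_all only: fps_nth_Abs_fps)
  next
    fix S S' assume S: "(\<forall>i. fps_nth S i ^ qv v = fps_nth S i) \<and> abs_sums a (\<lambda>i. fps_nth S i * w ^ i) (theta \<iota>)"
      and S': "(\<forall>i. fps_nth S' i ^ qv v = fps_nth S' i) \<and> abs_sums a (\<lambda>i. fps_nth S' i * w ^ i) (theta \<iota>)"
    show "S = S'"
    proof (rule fixed_series_unique)
      show "sigma (qv v) S = S" "sigma (qv v) S' = S'"
        using S S' by (intro fps_ext; simp only: sigma_nth)+
      show "fps_value S w = fps_value S' w"
        unfolding fps_value_def abs_suminf_eq[OF conjunct2[OF S]] abs_suminf_eq[OF conjunct2[OF S']] by (rule refl)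
    qed
  qed
qed

lemma T_fixed: "sigma (qv v) T = T"
  using t_expansion_exists by (intro fps_ext) (simp only: sigma_nth)

lemma T_value: "fps_value T w = theta \<iota>"
  unfolding fps_value_def by (rule abs_suminf_eq[OF conjunct2[OF t_expansion_exists]])

lemma T_integral: "integral_coeffs T" by (rule fixed_integral[OF T_fixed])

lemma integral_value_minus_nth_0:
  assumes "integral_coeffs F"
  shows "a (fps_value F w - fps_nth F 0) \<le> a w"
proof (rule abs_sums_le)
  have "abs_sums a (\<lambda>n. fps_nth F n * w ^ n) (fps_nth F 0 * w ^ 0 + (fps_value F w - fps_nth F 0))"
    using conv_at_sums[OF integral_conv_at[OF assms]] by simp
  then show "abs_sums a (\<lambda>n. fps_nth F (Suc n) * w ^ (Suc n)) (fps_value F w - fps_nth F 0)"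
    by (subst abs_sums_Suc) simp
  show "a (fps_nth F (Suc n) * w ^ Suc n) \<le> a w" for n
  proof -
    have "a (fps_nth F (Suc n)) * a w ^ Suc n \<le> 1 * a w ^ 1"
      using assms abs_w_bounds by (intro mult_mono power_decreasing) (auto simp: integral_coeffs_def)
    then show ?thesis by (simp add: abs_mult abs_power)
  qed
qed

definition A_to_T :: "'q poly \<Rightarrow> 'c fps" where
  "A_to_T b = poly (map_poly (\<lambda>c. fps_const (scal \<iota> c)) b) T"

lemma A_to_T_alt: "A_to_T b = poly (map_poly fps_const (map_poly (scal \<iota>) b)) T"
  unfolding A_to_T_def by (subst map_poly_map_poly) (auto simp: scal.map_zero o_def)

lemma ring_map_const_scal: "ring_map (\<lambda>c. fps_const (scal \<iota> c))"
  using ring_map_comp[OF ring_map_scal ring_map_fps_const] .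

sublocale A_to_T: ring_map A_to_T
  unfolding A_to_T_def
  using ring_map_comp[OF ring_map.ring_map_map_poly[OF ring_map_const_scal] ring_map_poly] .

lemma A_to_T_value: "fps_value (A_to_T b) w = gam \<iota> b"
  unfolding A_to_T_alt using integral_conv_at[OF T_integral] by (simp add: fps_value_poly_comp T_value scal_poly_gam)

lemma A_to_T_fixed: "sigma (qv v) (A_to_T b) = A_to_T b"
proof (induction b)
  case 0
  show ?case by (simp add: A_to_T.map_zero sigma_v.map_zero)
next
  case (pCons c b)
  have c: "scal \<iota> c ^ qv v = scal \<iota> c" unfolding qv_def by (rule scal_power)
  have "A_to_T (pCons c b) = fps_const (scal \<iota> c) + T * A_to_T b"
    by (simp add: A_to_T_def map_poly_pCons scal.map_zero)
  then show ?case
    by (simp only: sigma_v.map_add sigma_v.map_mult sigma_const[OF frob_qv] T_fixed pCons.IH c)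
qed

lemma A_to_T_integral: "integral_coeffs (A_to_T b)" by (rule fixed_integral[OF A_to_T_fixed])

text \<open>
  Both sides have digits as coefficients and the value \<open>\<zeta>\<^sub>v\<close> at \<open>\<zeta>\<^sub>v\<close>.
\<close>

lemma A_to_T_v: "A_to_T v = fps_X"
proof (rule fixed_series_unique[OF A_to_T_fixed])
  show "sigma (qv v) fps_X = (fps_X :: 'c fps)" by (rule sigma_X[OF frob_qv])
  show "fps_value (A_to_T v) w = fps_value fps_X w"
    using fps_value_poly[of "[:0, 1:]" w] by (simp add: A_to_T_value fps_of_poly_linear)
qed

abbreviation "\<alpha> \<equiv> fps_nth T 0"

lemma A_to_T_nth_0: "fps_nth (A_to_T b) 0 = poly (map_poly (scal \<iota>) b) \<alpha>"
proof (induction b)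
  case (pCons c b)
  then show ?case by (simp add: A_to_T_def map_poly_pCons scal.map_zero)
qed (simp add: A_to_T.map_zero)

lemma v_alpha: "poly (map_poly (scal \<iota>) v) \<alpha> = 0"
  using A_to_T_nth_0[of v] by (simp add: A_to_T_v)

lemma alpha_fixed: "\<alpha> ^ qv v = \<alpha>"
  using T_fixed by (metis sigma_nth)

text \<open>
  If the linear coefficient of \<open>T\<close> vanished, so would that of \<open>v(T) = X\<close>.
\<close>

lemma T_nth_1: "fps_nth T 1 \<noteq> 0"
proof
  assume T1: "fps_nth T 1 = 0"
  let ?p = "map_poly fps_const (map_poly (scal \<iota>) v)"
  have "(T - fps_const \<alpha>) dvd poly ?p T - poly ?p (fps_const \<alpha>)" by (rule diff_dvd_poly_diff)
  also have "poly ?p (fps_const \<alpha>) = 0"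
    by (simp only: poly_map_eval[OF ring_map_fps_const] v_alpha fps_const_0_eq_0)
  also have "poly ?p T - 0 = fps_X" using A_to_T_v by (simp add: A_to_T_alt)
  finally obtain h where h: "fps_X = (T - fps_const \<alpha>) * h" by (elim dvdE)
  have "fps_nth ((T - fps_const \<alpha>) * h) 1 = 0" using T1 by (simp add: fps_mult_nth)
  then show False using h by (metis fps_X_nth zero_neq_one)
qed

lemma abs_T_nth_1: "a (fps_nth T 1) = 1"
  using T_nth_1 t_expansion_exists by (intro abs_fixed) auto

lemma abs_alpha_minus_theta: "a (\<alpha> - theta \<iota>) = a w"
proof -
  let ?f = "\<lambda>n. fps_nth T (Suc n) * w ^ Suc n"
  have "abs_sums a (\<lambda>n. fps_nth T n * w ^ n) (fps_nth T 0 * w ^ 0 + (theta \<iota> - \<alpha>))"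
    using t_expansion_exists by simp
  then have s: "abs_sums a ?f (theta \<iota> - \<alpha>)" by (subst abs_sums_Suc) simp
  have T1: "a (?f 0) = a w" using abs_T_nth_1 by (simp add: abs_mult)
  have "a (theta \<iota> - \<alpha>) = a (?f 0)"
  proof (rule abs_sums_dominated[OF s])
    show "a (?f (Suc n)) \<le> a w ^ 2" for n
    proof -
      have "a (fps_nth T (Suc (Suc n))) * a w ^ Suc (Suc n) \<le> 1 * a w ^ 2"
        using T_integral abs_w_bounds by (intro mult_mono power_decreasing) (auto simp: integral_coeffs_def)
      then show ?thesis by (simp only: abs_mult abs_power mult_1)
    qed
    show "a w ^ 2 < a (?f 0)" unfolding T1 using abs_w_bounds power_strict_decreasing[of 1 2 "a w"] by simp
  qed
  then show ?thesis using T1 by (simp add: abs_diff_commute)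
qed

text \<open>
  Otherwise \<open>\<alpha>\<close> would be fixed by \<open>x \<mapsto> x^(q^i)\<close>, and with it all \<open>b(\<alpha>)\<close> for polynomials \<open>b\<close> of degree
  less than \<open>d\<close>.  These are \<open>q^d\<close> different elements, because \<open>b(\<alpha>)\<close> is congruent to \<open>\<gamma>(b)\<close>, but
  \<open>X^(q^i) - X\<close> has only \<open>q^i\<close> roots.
\<close>

lemma abs_alpha_minus_theta_power:
  assumes "0 < i" "i < degree v"
  shows "a (\<alpha> - theta \<iota> ^ (CARD('q) ^ i)) = 1"
proof (rule ccontr)
  assume ne: "a (\<alpha> - theta \<iota> ^ (CARD('q) ^ i)) \<noteq> 1"
  define N where "N = CARD('q) ^ i"
  interpret F: ring_map "\<lambda>x :: 'c. x ^ N" unfolding N_def by (rule frob)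
  interpret G: ring_map "\<lambda>x :: 'c. x ^ qv v" by (rule frob_qv)
  have N: "N > 0" by (simp add: N_def)
  have alpha: "a \<alpha> \<le> 1" using T_integral by (simp add: integral_coeffs_def)
  have theta: "a (theta \<iota>) \<le> 1" unfolding theta_def by (rule abs_gam_le_1)
  have "a (\<alpha> - theta \<iota> ^ N) \<le> 1"
    using alpha theta by (intro abs_diff_le') (auto simp: abs_power power_le_one)
  with ne have lt: "a (\<alpha> - theta \<iota> ^ N) < 1" by (simp add: N_def)
  have "a ((\<alpha> - theta \<iota>) ^ N) < 1"
    unfolding abs_power abs_alpha_minus_theta using N abs_w_bounds by (intro power_less_one_iff[THEN iffD2]) auto
  then have "a (\<alpha> ^ N - theta \<iota> ^ N) < 1" by (simp add: F.map_diff)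
  with lt have "a ((\<alpha> - theta \<iota> ^ N) - (\<alpha> ^ N - theta \<iota> ^ N)) < 1"
    using abs_diff_le[of "\<alpha> - theta \<iota> ^ N" "\<alpha> ^ N - theta \<iota> ^ N"] by linarith
  then have "a (\<alpha> - \<alpha> ^ N) < 1" by simp
  moreover have "(\<alpha> ^ N) ^ qv v = \<alpha> ^ N"
    by (metis alpha_fixed mult.commute power_mult)
  then have "(\<alpha> - \<alpha> ^ N) ^ qv v = \<alpha> - \<alpha> ^ N" by (simp add: G.map_diff alpha_fixed)
  ultimately have aN: "\<alpha> ^ N = \<alpha>" using abs_fixed[of "\<alpha> - \<alpha> ^ N"] by force
  define E where "E b = poly (map_poly (scal \<iota>) b) \<alpha>" for b
  interpret E: ring_map E unfolding E_def using ring_map_comp[OF scal.ring_map_map_poly ring_map_poly] .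
  have E: "E b ^ N = E b" for b
  proof (induction b)
    case 0
    show ?case using N by (simp add: E.map_zero)
  next
    case (pCons c b)
    have "E (pCons c b) = scal \<iota> c + \<alpha> * E b" by (simp add: E_def map_poly_pCons scal.map_zero)
    moreover have "scal \<iota> c ^ N = scal \<iota> c" unfolding N_def by (rule scal_power)
    ultimately show ?case using pCons.IH by (simp add: F.map_add power_mult_distrib aN)
  qed
  define B where "B = {b :: 'q poly. \<forall>i\<ge>degree v. poly.coeff b i = 0}"
  have "inj_on E B"
  proof (rule inj_onI, rule ccontr)
    fix b c assume bc: "b \<in> B" "c \<in> B" "E b = E c" "b \<noteq> c"
    have "b - c \<in> B" using bc by (simp add: B_def)
    then have "degree (b - c) < degree v"
      using bc(4) unfolding B_def polys_below_eq by auto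
    then have "\<not> v dvd b - c" using bc(4) dvd_imp_degree_le[of v "b - c"] by auto
    then have "a (gam \<iota> (b - c)) = 1" by (rule abs_gam_unit)
    moreover have "fps_nth (A_to_T (b - c)) 0 = 0"
      using bc(3) E.map_diff[of b c] by (simp add: A_to_T_nth_0 E_def)
    then have "a (gam \<iota> (b - c)) \<le> a w"
      using integral_value_minus_nth_0[OF A_to_T_integral[of "b - c"]] by (simp add: A_to_T_value)
    ultimately show False using abs_w_bounds by simp
  qed
  then have "card (E ` B) = CARD('q) ^ degree v"
    by (simp add: card_image B_def card_polys_below)
  define P where "P = (monom 1 N - monom 1 1 :: 'c poly)"
  have N2: "N \<ge> 2"
  proof -
    have "2 \<le> CARD('q) ^ 1" using card_field_ge_2[where 'q = 'q] by simp
    also have "\<dots> \<le> N" unfolding N_def using assms by (intro power_increasing) auto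
    finally show ?thesis .
  qed
  then have "poly.coeff P N = 1" by (simp add: P_def)
  then have P0: "P \<noteq> 0" by auto
  have "degree P \<le> N" using N2 by (intro degree_le) (auto simp: P_def)
  have "E ` B \<subseteq> {x. poly P x = 0}" using E by (auto simp: P_def poly_monom)
  then have "card (E ` B) \<le> card {x. poly P x = 0}" using poly_roots_finite[OF P0] by (intro card_mono) auto
  also have "\<dots> \<le> N" using card_poly_roots_bound[OF P0] \<open>degree P \<le> N\<close> by linarith
  also have "N < CARD('q) ^ degree v"
    unfolding N_def using assms card_field_ge_2[where 'q = 'q] by (intro power_strict_increasing) auto
  finally show False using \<open>card (E ` B) = _\<close> by simp
qed

section \<open>The Frobenius equation at a finite place\<close>

text \<open>
  The factor that arises from \<open>d\<close> iterations of \<open>f = (t - \<theta>)\<sigma>(f)\<close>.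
\<close>

definition frobenius_factor :: "'c fps" where
  "frobenius_factor = (\<Prod>i<degree v. T - fps_const (theta \<iota> ^ (CARD('q) ^ i)))"

lemma frobenius_factor_integral: "integral_coeffs frobenius_factor"
  unfolding frobenius_factor_def
proof (rule integral_prod)
  fix i
  have "a (theta \<iota>) \<le> 1" unfolding theta_def by (rule abs_gam_le_1)
  then have "a (theta \<iota> ^ (CARD('q) ^ i)) \<le> 1" by (simp add: abs_power power_le_one)
  then show "integral_coeffs (T - fps_const (theta \<iota> ^ (CARD('q) ^ i)))"
    using T_integral unfolding integral_coeffs_def by (auto intro!: abs_diff_le')
qed

lemma abs_frobenius_factor_0: "a (fps_nth frobenius_factor 0) = a w"
proof -
  have "fps_nth frobenius_factor 0 = (\<Prod>i<degree v. \<alpha> - theta \<iota> ^ (CARD('q) ^ i))"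
    unfolding frobenius_factor_def ring_map.map_prod[OF ring_map_fps_nth_0] by simp
  then have "a (fps_nth frobenius_factor 0) = (\<Prod>i<degree v. a (\<alpha> - theta \<iota> ^ (CARD('q) ^ i)))"
    by (simp add: abs_prod)
  also have "\<dots> = a (\<alpha> - theta \<iota> ^ (CARD('q) ^ 0)) *
     (\<Prod>i\<in>{..<degree v} - {0}. a (\<alpha> - theta \<iota> ^ (CARD('q) ^ i)))"
    using degree_v_pos by (subst prod.remove[of _ 0]) auto
  also have "(\<Prod>i\<in>{..<degree v} - {0}. a (\<alpha> - theta \<iota> ^ (CARD('q) ^ i))) = 1"
    by (intro prod.neutral) (auto simp: abs_alpha_minus_theta_power)
  finally show ?thesis by (simp add: abs_alpha_minus_theta)
qed

context
  fixes F :: "'c fps"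
  assumes F: "F = frobenius_factor * sigma (qv v) F" and F0: "fps_nth F 0 \<noteq> 0"
begin

lemma solution_nth_0: "a (fps_nth F 0) ^ (qv v - 1) = real (qv v)"
proof -
  define M where "M = a (fps_nth F 0)"
  have M: "M > 0" unfolding M_def using F0 by (rule abs_pos)
  have "fps_nth F 0 = fps_nth frobenius_factor 0 * fps_nth F 0 ^ qv v"
    by (subst F) simp
  then have "M = a w * M ^ qv v" unfolding M_def by (metis abs_mult abs_power abs_frobenius_factor_0)
  also have "M ^ qv v = M * M ^ (qv v - 1)" using qv_ge_2 by (cases "qv v") auto
  finally have "a w * M ^ (qv v - 1) = 1" using M by simp
  then show ?thesis unfolding abs_w M_def[symmetric] using qv_ge_2 by (simp add: field_simps)
qed

text \<open>
  Compare coefficients of \<open>X^n\<close>: \<open>F\<^sub>n = P\<^sub>0 F\<^sub>n^Q + R\<close>, where \<open>|P\<^sub>0| = 1/Q\<close> and \<open>R\<close> involves only earlier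
  coefficients.  If \<open>F\<^sub>n\<close> violated the bound, \<open>P\<^sub>0 F\<^sub>n^Q\<close> would dominate \<open>R\<close>, so \<open>F\<^sub>n\<close> and \<open>P\<^sub>0 F\<^sub>n^Q\<close> would have the
  same absolute value.  That forces \<open>|F\<^sub>n| = |F\<^sub>0|\<close>, which satisfies the bound.
\<close>

lemma solution_nth_bound: "a (fps_nth F n) ^ qv v \<le> a (fps_nth F 0) ^ qv v * real (qv v) ^ n"
proof (induction n rule: less_induct)
  case (less n)
  define Q where "Q = real (qv v)"
  define M where "M = a (fps_nth F 0)"
  have M: "M > 0" unfolding M_def using F0 by (rule abs_pos)
  have Q: "Q \<ge> 2" unfolding Q_def using qv_ge_2 by simp
  show ?case
  proof (cases n)
    case (Suc m)
    show ?thesis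
    proof (rule ccontr)
      assume "\<not> ?thesis"
      then have big: "a (fps_nth F n) ^ qv v > M ^ qv v * Q ^ n" by (simp add: M_def Q_def)
      define top_term where "top_term = fps_nth frobenius_factor 0 * fps_nth F n ^ qv v"
      define lower_terms where "lower_terms = (\<Sum>k\<in>{0..n} - {0}. fps_nth frobenius_factor k * fps_nth F (n - k) ^ qv v)"
      have "fps_nth F n = (\<Sum>k=0..n. fps_nth frobenius_factor k * fps_nth F (n - k) ^ qv v)"
        by (subst F) (simp add: fps_mult_nth)
      also have "\<dots> = top_term + lower_terms" unfolding top_term_def lower_terms_def by (subst sum.remove[of _ 0]) auto
      finally have split: "fps_nth F n = top_term + lower_terms" .
      have "a lower_terms \<le> M ^ qv v * Q ^ m"
        unfolding lower_terms_def
      proof (rule abs_sum_le)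
        fix k assume k: "k \<in> {0..n} - {0}"
        have "a (fps_nth frobenius_factor k) * a (fps_nth F (n - k)) ^ qv v \<le> 1 * (M ^ qv v * Q ^ (n - k))"
          using less[of "n - k"] k frobenius_factor_integral
          by (intro mult_mono) (auto simp: integral_coeffs_def M_def Q_def)
        also have "\<dots> \<le> M ^ qv v * Q ^ m"
        proof -
          have "Q ^ (n - k) \<le> Q ^ m" using k Suc Q by (intro power_increasing) auto
          then show ?thesis using M by (simp add: mult_left_mono)
        qed
        finally show "a (fps_nth frobenius_factor k * fps_nth F (n - k) ^ qv v) \<le> M ^ qv v * Q ^ m"
          by (simp add: abs_mult abs_power)
      qed (use M Q in simp)
      moreover have abs_top: "a top_term = a (fps_nth F n) ^ qv v / Q"
        by (simp add: top_term_def abs_mult abs_power abs_frobenius_factor_0 abs_w Q_def)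
      have "M ^ qv v * Q ^ m < a top_term"
        using big Q unfolding abs_top Suc by (simp add: field_simps)
      ultimately have "a lower_terms < a top_term" by linarith
      then have "a (fps_nth F n) = a top_term" unfolding split by (rule abs_add_eq)
      define x where "x = a (fps_nth F n)"
      have "x ^ qv v > 0" using big M Q unfolding x_def by (smt (verit) mult_pos_pos zero_less_power)
      then have x: "x > 0" using qv_ge_2 abs_nonneg[of "fps_nth F n"]
        unfolding x_def by (metis abs_pos abs_0 less_irrefl not_gr_zero zero_power order.strict_trans2 zero_less_numeral)
      have "x ^ qv v = x * x ^ (qv v - 1)" using qv_ge_2 by (cases "qv v") auto
      moreover have "x * Q = x ^ qv v" using \<open>a (fps_nth F n) = a top_term\<close> Q nonzero_eq_divide_eq[of Q x "x ^ qv v"]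
        unfolding abs_top x_def by fastforce
      ultimately have "x ^ (qv v - 1) = Q" using x by simp
      then have "x ^ (qv v - 1) = M ^ (qv v - 1)" using solution_nth_0 by (simp add: Q_def M_def)
      then have "x = M" using x M qv_ge_2 power_eq_iff_eq_base[of "qv v - 1" x M] by simp
      then have "M ^ qv v * Q ^ n < M ^ qv v * 1" using big by (simp add: x_def)
      moreover have "1 \<le> Q ^ n" using Q by (intro one_le_power) simp
      ultimately show False using M by (simp add: mult_less_cancel_left)
    qed
  qed simp
qed

text \<open>
  By the preceding bound \<open>|F\<^sub>n \<zeta>\<^sub>v^n|^Q \<le> |F\<^sub>0|^Q Q^(n - n Q) \<le> |F\<^sub>0|^Q Q^(-n)\<close>.
\<close>

lemma
  shows solution_conv_at: "conv_at F w"
    and solution_value: "a (fps_value F w) = a (fps_nth F 0)"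
proof -
  define Q where "Q = real (qv v)"
  define M where "M = a (fps_nth F 0)"
  have M: "M > 0" unfolding M_def using F0 by (rule abs_pos)
  have Q: "Q \<ge> 2" unfolding Q_def using qv_ge_2 by simp
  \<comment> \<open>\<open>r\<close> is chosen such that the bound on \<open>|F\<^sub>n \<zeta>\<^sub>v^n|^Q\<close> is the \<open>Q\<close>-th power of \<open>|F\<^sub>0| r^n\<close>\<close>
  define r where "r = root (qv v) (1 / Q)"
  have r: "0 < r" "r < 1" using Q qv_ge_2 by (auto simp: r_def real_root_lt_1_iff)
  have rQ: "r ^ qv v = 1 / Q" unfolding r_def using Q qv_ge_2 by (intro real_root_pow_pos2) auto
  have bound: "a (fps_nth F n * w ^ n) \<le> M * r ^ n" for n
  proof (rule power_le_imp_le_base)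
    have "a (fps_nth F n * w ^ n) ^ Suc (qv v - 1) = a (fps_nth F n) ^ qv v * (a w ^ n) ^ qv v"
      using qv_ge_2 by (simp add: abs_mult abs_power power_mult_distrib)
    also have "\<dots> \<le> (M ^ qv v * Q ^ n) * (a w ^ n) ^ qv v"
      unfolding M_def Q_def by (intro mult_right_mono solution_nth_bound) simp
    also have "(a w ^ n) ^ qv v \<le> (a w ^ n) ^ 2"
      using qv_ge_2 abs_w_bounds by (intro power_decreasing) (auto intro: power_le_one)
    also have "(M ^ qv v * Q ^ n) * (a w ^ n) ^ 2 = M ^ qv v * (1 / Q) ^ n"
      using Q unfolding abs_w Q_def by (simp add: power2_eq_square power_divide)
    also have "(1 / Q) ^ n = (r ^ n) ^ qv v"
      unfolding rQ[symmetric] power_mult[symmetric] by (simp add: mult.commute)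
    also have "M ^ qv v * (r ^ n) ^ qv v = (M * r ^ n) ^ Suc (qv v - 1)"
      using qv_ge_2 by (simp add: power_mult_distrib)
    finally show "a (fps_nth F n * w ^ n) ^ Suc (qv v - 1) \<le> (M * r ^ n) ^ Suc (qv v - 1)"
      using M Q by (simp add: mult_left_mono)
    show "0 \<le> M * r ^ n" using M r by simp
  qed
  show conv: "conv_at F w"
    unfolding conv_at_def
  proof (rule tendsto_0_le)
    show "(\<lambda>n. M * r ^ n) \<longlonglongrightarrow> 0"
      using r by (intro tendsto_mult_right_zero LIMSEQ_power_zero) auto
  qed (auto simp: bound)
  have "a (fps_value F w) = a (fps_nth F 0 * w ^ 0)"
  proof (rule abs_sums_dominated[OF conv_at_sums[OF conv]])
    show "a (fps_nth F (Suc n) * w ^ Suc n) \<le> M * r" for n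
    proof (rule order_trans[OF bound])
      have "r ^ Suc n \<le> r" using r power_decreasing[of 1 "Suc n" r] by simp
      then show "M * r ^ Suc n \<le> M * r" using M by (intro mult_left_mono) auto
    qed
    show "M * r < a (fps_nth F 0 * w ^ 0)"
      using mult_strict_left_mono[OF r(2) M] by (simp add: M_def)
  qed
  then show "a (fps_value F w) = a (fps_nth F 0)" by simp
qed

end

end

section \<open>Reductions modulo powers of a finite place\<close>

lemma fps_X_power_dvd_iff: "fps_X ^ n dvd (F :: 'a::comm_ring_1 fps) \<longleftrightarrow> (\<forall>i<n. fps_nth F i = 0)"
proof
  assume "\<forall>i<n. fps_nth F i = 0"
  then have "F = fps_X ^ n * fps_shift n F"
    by (intro fps_ext) (auto simp: fps_X_power_mult_nth)
  then show "fps_X ^ n dvd F" by (rule dvdI)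
qed (auto elim!: dvdE simp: fps_X_power_mult_nth)

lemma map_poly_ring_map_nonzero:
  fixes f :: "'a::field \<Rightarrow> 'b::comm_ring_1"
  assumes "ring_map f" "p \<noteq> 0"
  shows "map_poly f p \<noteq> 0"
proof
  assume "map_poly f p = 0"
  then have "f (poly.coeff p i) = 0" for i using ring_map.coeff_map[OF assms(1), of p i] by simp
  then show False using assms by (auto simp: ring_map_inj[OF assms(1)] poly_eq_iff)
qed

context place
begin

definition lift :: "'q ratbar poly \<Rightarrow> 'c fps" where
  "lift g = fps_of_poly (map_poly \<iota> g)"

sublocale lift: ring_map lift
  unfolding lift_def using ring_map_comp[OF \<iota>.ring_map_map_poly ring_map_fps_of_poly] .

lemma lift_nth: "fps_nth (lift g) n = \<iota> (poly.coeff g n)"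
  by (simp add: lift_def \<iota>.coeff_map)

lemma lift_eq_0: "lift g = 0 \<Longrightarrow> g = 0"
proof (rule poly_eqI)
  fix n assume "lift g = 0"
  then have "\<iota> (poly.coeff g n) = 0" by (metis lift_nth fps_zero_nth)
  then show "poly.coeff g n = poly.coeff 0 n" by (simp add: ring_map_inj[OF ring_map_\<iota>])
qed

lemma lift_tate: "lift g \<in> tate_algebra a"
  unfolding lift_def by (rule tate_poly)

lemma A_to_fps_eq_lift: "A_to_fps \<iota> b = lift (map_poly ac_scal b)"
  by (simp add: lift_def A_to_fps_eq_map)

lemma reduction_alt:
  "reduction \<iota> a v n F g \<longleftrightarrow> (\<exists>h\<in>tate_algebra a. F - lift g = A_to_fps \<iota> (v ^ n) * h)"
  by (simp add: reduction_def lift_def)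

text \<open>
  The difference of the two polynomials is divisible by \<open>v^n\<close> in the Tate algebra.  Uniqueness of Weierstrass
  division transfers the divisibility to polynomials over the algebraic closure.
\<close>

lemma reduction_unique:
  assumes "v \<noteq> 0" "reduction \<iota> a v n F g" "reduction \<iota> a v n F g'"
  shows "map_poly ac_scal (v ^ n) dvd g - g'"
proof -
  define m where "m = v ^ n"
  have m: "m \<noteq> 0" using assms(1) by (simp add: m_def)
  define N where "N = map_poly ac_scal m"
  have deg: "degree N = degree m"
    unfolding N_def by (rule degree_ring_map[OF ring_map_ac_scal])
  have N0: "N \<noteq> 0" unfolding N_def by (rule map_poly_ring_map_nonzero[OF ring_map_ac_scal m])
  obtain h h' where h: "h \<in> tate_algebra a" "F - lift g = A_to_fps \<iota> m * h"
    and h': "h' \<in> tate_algebra a" "F - lift g' = A_to_fps \<iota> m * h'"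
    using assms(2,3) unfolding reduction_alt m_def by blast
  define r where "r = (g - g') mod N"
  define k where "k = (g - g') div N"
  define H where "H = h' - h - lift k"
  have H: "H \<in> tate_algebra a" unfolding H_def by (intro tate_diff h h' lift_tate)
  have "A_to_fps \<iota> m * (h' - h) = lift (g - g')"
    unfolding right_diff_distrib h(2)[symmetric] h'(2)[symmetric] lift.map_diff by simp
  also have "g - g' = N * k + r" unfolding r_def k_def by simp
  also have "lift \<dots> = A_to_fps \<iota> m * lift k + lift r"
    unfolding lift.map_add lift.map_mult N_def A_to_fps_eq_lift by (rule refl)
  finally have eq: "A_to_fps \<iota> m * H = lift r"
    unfolding H_def by (simp add: right_diff_distrib)
  have "H = 0"
  proof (rule weierstrass_unique[OF m H])
    fix i assume i: "degree m \<le> i"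
    have "r = 0 \<or> degree r < degree m"
      using degree_mod_less[OF N0, of "g - g'"] unfolding r_def deg .
    then have "poly.coeff r i = 0" using i by (auto intro: coeff_eq_0)
    then show "fps_nth (A_to_fps \<iota> m * H) i = 0"
      unfolding eq lift_nth by (simp add: \<iota>.map_zero)
  qed
  then have "lift r = 0" using eq by simp
  then have "r = 0" by (rule lift_eq_0)
  then show ?thesis unfolding r_def N_def m_def by (simp add: mod_eq_0_iff_dvd)
qed

lemma reduction_mono:
  assumes "reduction \<iota> a v n F g" "k \<le> n"
  shows "reduction \<iota> a v k F g"
proof -
  obtain h where h: "h \<in> tate_algebra a" "F - lift g = A_to_fps \<iota> (v ^ n) * h"
    using assms(1) unfolding reduction_alt by blast
  have "v ^ n = v ^ k * v ^ (n - k)" using assms(2) by (simp add: power_add[symmetric])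
  then have "F - lift g = A_to_fps \<iota> (v ^ k) * (A_to_fps \<iota> (v ^ (n - k)) * h)"
    by (simp only: h(2) A.map_mult mult.assoc)
  then show ?thesis unfolding reduction_alt using tate_mult[OF tate_A h(1)] by blast
qed

lemma reduction_lift_mult:
  assumes "reduction \<iota> a v n F g"
  shows "reduction \<iota> a v n (lift c * F) (c * g)"
proof -
  obtain h where h: "h \<in> tate_algebra a" "F - lift g = A_to_fps \<iota> (v ^ n) * h"
    using assms(1) unfolding reduction_alt by blast
  have "lift c * F - lift (c * g) = lift c * (F - lift g)"
    by (simp only: lift.map_mult right_diff_distrib)
  also have "\<dots> = A_to_fps \<iota> (v ^ n) * (lift c * h)" by (simp only: h(2) mult_ac)
  finally show ?thesis unfolding reduction_alt using tate_mult[OF lift_tate h(1)] by blast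
qed

lemma reduction_sigma:
  assumes "reduction \<iota> a v n F g"
  shows "reduction \<iota> a v n (sigma (CARD('q) ^ k) F) (map_poly (\<lambda>x. x ^ (CARD('q) ^ k)) g)"
proof -
  interpret S: ring_map "sigma (CARD('q) ^ k) :: 'c fps \<Rightarrow> 'c fps" by (rule ring_map_sigma[OF frob])
  obtain h where h: "h \<in> tate_algebra a" "F - lift g = A_to_fps \<iota> (v ^ n) * h"
    using assms(1) unfolding reduction_alt by blast
  have "lift (map_poly (\<lambda>x. x ^ (CARD('q) ^ k)) g) = sigma (CARD('q) ^ k) (lift g)"
    by (rule fps_ext) (simp add: lift_nth coeff_map_poly \<iota>.map_power zero_power)
  then have "sigma (CARD('q) ^ k) F - lift (map_poly (\<lambda>x. x ^ (CARD('q) ^ k)) g) = sigma (CARD('q) ^ k) (F - lift g)"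
    by (simp only: S.map_diff)
  also have "\<dots> = A_to_fps \<iota> (v ^ n) * sigma (CARD('q) ^ k) h"
    by (simp only: h(2) S.map_mult sigma_A_to_fps)
  finally show ?thesis unfolding reduction_alt using tate_sigma[OF h(1)] by blast
qed

end

definition ac_theta :: "'q::{finite,field} ratbar" where
  "ac_theta = to_ac (to_fract [:0, 1:])"

text \<open>
  The polynomial \<open>(t - \<theta>^(q^j)) \<cdots> (t - \<theta>^(q^(k-1)))\<close> by which \<open>\<sigma>^j(f)\<close> and \<open>\<sigma>^k(f)\<close> differ.
\<close>

definition twist_product :: "nat \<Rightarrow> nat \<Rightarrow> 'q::{finite,field} ratbar poly" where
  "twist_product j k = (\<Prod>i\<in>{j..<k}. [:- (ac_theta ^ (CARD('q) ^ i)), 1:])"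

context carlitz_period
begin

lemma generator_twist:
  assumes "j \<le> k"
  shows "sigma (CARD('q) ^ j) generator = lift (twist_product j k) * sigma (CARD('q) ^ k) generator"
  using assms
proof (induction k rule: dec_induct)
  case base
  show ?case by (simp add: twist_product_def lift.map_one del: sigma_nth)
next
  case (step k)
  interpret S: ring_map "sigma (CARD('q) ^ k) :: 'c fps \<Rightarrow> 'c fps" by (rule ring_map_sigma[OF frob])
  have l: "lift [:- (ac_theta ^ (CARD('q) ^ k)), 1:] = fps_X - fps_const (\<theta> ^ (CARD('q) ^ k))"
    by (auto simp: fps_eq_iff lift_nth coeff_pCons \<iota>.map_uminus \<iota>.map_power \<iota>.map_one \<iota>.map_zero
        theta_eq ac_theta_def split: nat.splits)
  have "sigma (CARD('q) ^ k) generator =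
      (fps_X - fps_const (\<theta> ^ (CARD('q) ^ k))) * sigma (CARD('q) ^ k) (sigma CARD('q) generator)"
    by (subst generator_sigma) (simp only: S.map_mult S.map_diff sigma_X[OF frob] sigma_const[OF frob])
  also have "sigma (CARD('q) ^ k) (sigma CARD('q) generator) = sigma (CARD('q) ^ Suc k) generator"
    by (simp only: sigma_sigma power_Suc)
  finally have eq: "sigma (CARD('q) ^ k) generator =
      lift [:- (ac_theta ^ (CARD('q) ^ k)), 1:] * sigma (CARD('q) ^ Suc k) generator" unfolding l .
  have t: "twist_product j (Suc k) = twist_product j k * [:- (ac_theta ^ (CARD('q) ^ k)), 1 :: 'q ratbar:]"
    unfolding twist_product_def using step(1) by (simp add: prod.atLeastLessThan_Suc mult.commute)
  show ?case unfolding t lift.map_mult step.IH mult.assoc eq[symmetric] by (rule refl)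
qed

text \<open>
  Let \<open>r\<close> be the remainder of \<open>f = \<beta>\<ell>\<close> modulo \<open>v^n\<close> and \<open>D\<close> the degree of \<open>v^n\<close>.  The \<open>D + 1\<close> twist products
  relating \<open>\<sigma>^k(f)\<close>, \<open>k \<le> D\<close>, to \<open>\<sigma>^D(f)\<close> are linearly dependent modulo \<open>v^n\<close>, say with coefficients \<open>e\<^sub>k\<close>.
  Hence \<open>\<Sum> e\<^sub>k \<sigma>^k(r)\<close> is divisible by \<open>v^n\<close> and so vanishes, its degree being less than \<open>D\<close>.  Thus each
  coefficient of \<open>r\<close> is a root of \<open>\<Sum> e\<^sub>k X^(q^k)\<close> and is algebraic over \<open>K\<close>.
\<close>

lemma generator_reduction:
  assumes "v \<noteq> 0"
  shows "\<exists>g. reduction \<iota> a v n generator g"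
proof -
  define m where "m = v ^ n"
  have m: "m \<noteq> 0" using assms by (simp add: m_def)
  define D where "D = degree m"
  define N :: "'q ratbar poly" where "N = map_poly ac_scal m"
  have deg: "degree N = D"
    unfolding N_def D_def by (rule degree_ring_map[OF ring_map_ac_scal])
  have N0: "N \<noteq> 0" unfolding N_def by (rule map_poly_ring_map_nonzero[OF ring_map_ac_scal m])
  obtain h r where h: "h \<in> tate_algebra a" and r: "\<And>i. D \<le> i \<Longrightarrow> poly.coeff r i = 0"
    and gen: "generator = A_to_fps \<iota> m * h + fps_of_poly r"
    using weierstrass_division[OF m generator_tate] unfolding D_def by blast
  define p where "p k = twist_product k D mod N" for k
  have "\<exists>e. (\<exists>k\<in>{..D}. e k \<noteq> 0) \<and> (\<Sum>k\<in>{..D}. smult (e k) (p k)) = 0"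
  proof (rule linear_dependence_degree_less[where D = D])
    fix k i assume "D \<le> i"
    then show "poly.coeff (p k) i = 0"
      using degree_mod_less[OF N0, of "twist_product k D"] unfolding p_def deg by (auto intro: coeff_eq_0)
  qed auto
  then obtain e where e: "\<exists>k\<le>D. e k \<noteq> 0" "(\<Sum>k\<le>D. smult (e k) (p k)) = 0" by auto
  have "N dvd (\<Sum>k\<le>D. smult (e k) (twist_product k D)) - (\<Sum>k\<le>D. smult (e k) (p k))"
    unfolding sum_subtractf[symmetric] smult_diff_right[symmetric] p_def
    by (intro dvd_sum dvd_smult) (simp add: minus_mod_eq_mult_div)
  then obtain E where E: "(\<Sum>k\<le>D. smult (e k) (twist_product k D)) = N * E"
    unfolding e(2) by (auto elim: dvdE)
  have relation: "(\<Sum>k\<le>D. lift [:e k:] * sigma (CARD('q) ^ k) generator) =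
      A_to_fps \<iota> m * (lift E * sigma (CARD('q) ^ D) generator)"
  proof -
    have "(\<Sum>k\<le>D. lift [:e k:] * sigma (CARD('q) ^ k) generator) =
        (\<Sum>k\<le>D. lift (smult (e k) (twist_product k D)) * sigma (CARD('q) ^ D) generator)"
    proof (intro sum.cong refl)
      fix k assume "k \<in> {..D}"
      then have k: "k \<le> D" by simp
      have "smult (e k) (twist_product k D) = [:e k:] * twist_product k D" by simp
      then show "lift [:e k:] * sigma (CARD('q) ^ k) generator =
          lift (smult (e k) (twist_product k D)) * sigma (CARD('q) ^ D) generator"
        by (simp only: lift.map_mult mult.assoc generator_twist[OF k, symmetric])
    qed
    also have "\<dots> = lift (N * E) * sigma (CARD('q) ^ D) generator"
      by (simp only: sum_distrib_right[symmetric] lift.map_sum[symmetric] E)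
    finally show ?thesis by (simp only: lift.map_mult mult.assoc A_to_fps_eq_lift N_def)
  qed
  define H where "H = lift E * sigma (CARD('q) ^ D) generator - (\<Sum>k\<le>D. lift [:e k:] * sigma (CARD('q) ^ k) h)"
  have sum_tate: "(\<Sum>k\<in>I. G k) \<in> tate_algebra a" if "\<And>k. k \<in> I \<Longrightarrow> G k \<in> tate_algebra a" for I and G :: "nat \<Rightarrow> 'c fps"
    using that by (induction I rule: infinite_finite_induct) (use lift_tate[of 0] in \<open>auto simp: tate_add lift.map_zero\<close>)
  have H: "H \<in> tate_algebra a"
    unfolding H_def by (intro tate_diff tate_mult lift_tate tate_sigma generator_tate sum_tate h)
  have "(\<Sum>k\<le>D. lift [:e k:] * sigma (CARD('q) ^ k) generator) =
     (\<Sum>k\<le>D. A_to_fps \<iota> m * (lift [:e k:] * sigma (CARD('q) ^ k) h) + lift [:e k:] * sigma (CARD('q) ^ k) (fps_of_poly r))"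
  proof (intro sum.cong refl)
    fix k
    interpret S: ring_map "sigma (CARD('q) ^ k) :: 'c fps \<Rightarrow> 'c fps" by (rule ring_map_sigma[OF frob])
    show "lift [:e k:] * sigma (CARD('q) ^ k) generator =
      A_to_fps \<iota> m * (lift [:e k:] * sigma (CARD('q) ^ k) h) + lift [:e k:] * sigma (CARD('q) ^ k) (fps_of_poly r)"
      unfolding gen by (simp only: S.map_add S.map_mult sigma_A_to_fps distrib_left mult_ac)
  qed
  also have "\<dots> = A_to_fps \<iota> m * (\<Sum>k\<le>D. lift [:e k:] * sigma (CARD('q) ^ k) h) +
      (\<Sum>k\<le>D. lift [:e k:] * sigma (CARD('q) ^ k) (fps_of_poly r))"
    by (simp only: sum.distrib sum_distrib_left)
  finally have eq: "A_to_fps \<iota> m * H = (\<Sum>k\<le>D. lift [:e k:] * sigma (CARD('q) ^ k) (fps_of_poly r))"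
    unfolding relation H_def right_diff_distrib by (simp only: add_diff_cancel_left')
  have lift_const: "lift [:c:] = fps_const (\<iota> c)" for c
    by (auto simp: fps_eq_iff lift_nth coeff_pCons \<iota>.map_zero split: nat.splits)
  have nth: "fps_nth (A_to_fps \<iota> m * H) i = (\<Sum>k\<le>D. \<iota> (e k) * poly.coeff r i ^ (CARD('q) ^ k))" for i
    unfolding eq by (simp add: fps_sum_nth lift_const)
  have "H = 0"
  proof (rule weierstrass_unique[OF m H])
    fix i assume "degree m \<le> i"
    then show "fps_nth (A_to_fps \<iota> m * H) i = 0"
      unfolding nth using r[of i] by (simp add: D_def zero_power)
  qed
  then have root: "(\<Sum>k\<le>D. \<iota> (e k) * poly.coeff r i ^ (CARD('q) ^ k)) = 0" for i
    using nth[of i] by simp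
  define P where "P = (\<Sum>k\<le>D. monom (e k) (CARD('q) ^ k))"
  have "P \<noteq> 0"
  proof -
    obtain k where k: "k \<le> D" "e k \<noteq> 0" using e by blast
    have "poly.coeff P (CARD('q) ^ k) = (\<Sum>j\<le>D. if j = k then e j else 0)"
      unfolding P_def coeff_sum coeff_monom using q_ge_2 by (intro sum.cong refl) (auto simp: power_inject_exp)
    also have "\<dots> = e k" using k by simp
    finally show ?thesis using k by auto
  qed
  interpret mp: ring_map "map_poly \<iota>" by (rule \<iota>.ring_map_map_poly)
  have "\<exists>y. poly.coeff r i = \<iota> y" for i
  proof -
    have "map_poly \<iota> (monom c k) = monom (\<iota> c) k" for c k
      by (rule poly_eqI) (simp add: \<iota>.coeff_map \<iota>.map_zero)
    then have "poly (map_poly \<iota> P) (poly.coeff r i) = 0"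
      using root[of i] by (simp add: P_def mp.map_sum poly_sum poly_monom)
    then show ?thesis using roots_in_alg_closed_field[OF ring_map_\<iota> \<open>P \<noteq> 0\<close>] by blast
  qed
  then obtain y where y: "\<And>i. poly.coeff r i = \<iota> (y i)" by metis
  define g where "g = (\<Sum>i<D. monom (y i) i)"
  have "y i = 0" if "D \<le> i" for i using r[OF that] y[of i] by (simp add: ring_map_inj[OF ring_map_\<iota>])
  then have "poly.coeff g i = y i" for i by (auto simp: g_def coeff_sum)
  then have "lift g = fps_of_poly r" by (simp add: fps_eq_iff lift_nth y)
  then have "generator - lift g = A_to_fps \<iota> m * h" using gen by simp
  then show ?thesis unfolding reduction_alt m_def using h by blast
qed

lemma generator_value_nonzero:
  assumes "a x \<le> 1"
  shows "conv_at generator x" "fps_value generator x \<noteq> 0"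
proof -
  have c: "conv_at generator x" "conv_at cogenerator x"
    using generator_tate cogenerator_tate assms unfolding tate_iff by (auto intro: conv_at_mono[of _ 1])
  then show "conv_at generator x" by simp
  have "fps_value generator x * fps_value cogenerator x = 1"
    using fps_value_mult[OF c] fps_value_const[of 1 x] by (simp add: generator_inverse)
  then show "fps_value generator x \<noteq> 0" by auto
qed

end

section \<open>The period at a finite place\<close>

locale two_places = infty: carlitz_period \<iota>i ai \<beta> u + finite_place \<iota> a v
  for \<iota>i :: "'q::{finite,field} ratbar \<Rightarrow> 'c::field" and ai :: "'c \<Rightarrow> real" and \<beta> :: 'c
    and u :: "'c fps \<Rightarrow> 'q poly"
    and \<iota> :: "'q ratbar \<Rightarrow> 'd::field" and a :: "'d \<Rightarrow> real" and v :: "'q poly"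
begin

abbreviation "subst \<equiv> subst_t v \<iota> a"

sublocale subst: ring_map subst
proof -
  have "ring_map (\<lambda>x. fps_const (\<iota> x))" using ring_map_comp[OF ring_map_\<iota> ring_map_fps_const] .
  from ring_map_comp[OF ring_map.ring_map_map_poly[OF this] ring_map_poly]
  show "ring_map subst" unfolding subst_t_def .
qed

lemma subst_pCons: "subst (pCons c g) = fps_const (\<iota> c) + T * subst g"
  by (simp add: subst_t_def map_poly_pCons \<iota>.map_zero)

lemma subst_A: "subst (map_poly ac_scal b) = A_to_T b"
proof (induction b)
  case 0
  show ?case by (simp add: subst.map_zero A_to_T.map_zero)
next
  case (pCons c b)
  have "map_poly ac_scal (pCons c b) = pCons (ac_scal c) (map_poly ac_scal b)"
    by (simp add: map_poly_pCons ring_map.map_zero[OF ring_map_ac_scal])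
  moreover have "A_to_T (pCons c b) = fps_const (scal \<iota> c) + T * A_to_T b"
    by (simp add: A_to_T_def map_poly_pCons scal.map_zero)
  ultimately show ?case by (simp only: subst_pCons pCons.IH scal_eq)
qed

lemma subst_power_v: "subst (map_poly ac_scal (v ^ n)) = fps_X ^ n"
  by (simp only: subst_A A_to_T.map_power A_to_T_v)

lemma subst_sigma: "subst (map_poly (\<lambda>x. x ^ qv v) g) = sigma (qv v) (subst g)"
proof (induction g)
  case 0
  show ?case by (simp add: subst.map_zero sigma_v.map_zero)
next
  case (pCons c g)
  have "qv v > 0" using qv_ge_2 by linarith
  then have "map_poly (\<lambda>x. x ^ qv v) (pCons c g) = pCons (c ^ qv v) (map_poly (\<lambda>x. x ^ qv v) g)"
    by (simp add: map_poly_pCons zero_power)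
  then show ?case
    by (simp only: subst_pCons pCons.IH sigma_v.map_add sigma_v.map_mult sigma_const[OF frob_qv] T_fixed \<iota>.map_power)
qed

lemma subst_twist: "subst (twist_product 0 (degree v)) = frobenius_factor"
  unfolding twist_product_def frobenius_factor_def subst.map_prod
proof (intro prod.cong)
  fix i
  have "subst [:- (ac_theta ^ (CARD('q) ^ i)), 1:] = T - fps_const (theta \<iota> ^ (CARD('q) ^ i))"
    by (simp add: subst_pCons \<iota>.map_uminus \<iota>.map_one \<iota>.map_power subst.map_zero theta_eq ac_theta_def
        fps_const_neg[symmetric] del: fps_const_neg)
  then show "subst [:- (ac_theta ^ (CARD('q) ^ i)), 1:] = T - fps_const (theta \<iota> ^ (CARD('q) ^ i))" .
qed auto

lemma reductions_subst:
  assumes "reduction \<iota>i ai v n f g" "reduction \<iota>i ai v n f g'"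
  shows "fps_X ^ n dvd subst g - subst g'"
  using subst.map_dvd[OF infty.reduction_unique[OF v_nonzero assms]]
  unfolding subst_power_v subst.map_diff .

definition completion :: "'c fps \<Rightarrow> 'd fps \<Rightarrow> bool" where
  "completion f F \<longleftrightarrow> (\<forall>n. \<exists>g. reduction \<iota>i ai v n f g \<and> fps_X ^ n dvd (F - subst g))"

lemma completion_dvd:
  assumes "completion f F" "reduction \<iota>i ai v n f g"
  shows "fps_X ^ n dvd (F - subst g)"
proof -
  obtain g' where g': "reduction \<iota>i ai v n f g'" "fps_X ^ n dvd (F - subst g')"
    using assms(1) unfolding completion_def by blast
  have "F - subst g = (F - subst g') + (subst g' - subst g)" by simp
  then show ?thesis using dvd_add[OF g'(2) reductions_subst[OF g'(1) assms(2)]] by simp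
qed

lemma completion_unique:
  assumes "completion f F" "completion f F'"
  shows "F = F'"
proof (rule fps_ext)
  fix n
  obtain g where g: "reduction \<iota>i ai v (Suc n) f g" "fps_X ^ (Suc n) dvd (F - subst g)"
    using assms(1) unfolding completion_def by blast
  have "fps_X ^ (Suc n) dvd (F - subst g) - (F' - subst g)"
    by (rule dvd_diff[OF g(2) completion_dvd[OF assms(2) g(1)]])
  then have "fps_nth ((F - subst g) - (F' - subst g)) n = 0"
    unfolding fps_X_power_dvd_iff by blast
  then show "fps_nth F n = fps_nth F' n" by simp
qed

lemma f_v0_eq: "completion f F \<Longrightarrow> f_v0 \<iota>i ai v \<iota> a f = F"
  unfolding f_v0_def completion_def[symmetric] by (rule the_equality) (auto intro: completion_unique)

lemma completion_exists: "\<exists>F. completion infty.generator F"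
proof -
  obtain g where g: "\<And>n. reduction \<iota>i ai v n infty.generator (g n)"
    using infty.generator_reduction[OF v_nonzero] by metis
  define F where "F = Abs_fps (\<lambda>k. fps_nth (subst (g (Suc k))) k)"
  have "fps_X ^ n dvd (F - subst (g n))" for n
    unfolding fps_X_power_dvd_iff
  proof (intro allI impI)
    fix i assume "i < n"
    then have "reduction \<iota>i ai v (Suc i) infty.generator (g n)"
      using infty.reduction_mono[OF g[of n], of "Suc i"] by simp
    then have "fps_X ^ Suc i dvd subst (g (Suc i)) - subst (g n)" by (rule reductions_subst[OF g])
    then have "fps_nth (subst (g (Suc i)) - subst (g n)) i = 0" unfolding fps_X_power_dvd_iff by blast
    then show "fps_nth (F - subst (g n)) i = 0" by (simp add: F_def)
  qed
  then show ?thesis unfolding completion_def using g by blast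
qed

definition solution :: "'d fps" where
  "solution = f_v0 \<iota>i ai v \<iota> a infty.generator"

lemma completion_solution: "completion infty.generator solution"
  using completion_exists f_v0_eq unfolding solution_def by metis

lemma completion_A_mult:
  assumes "completion f F"
  shows "completion (A_to_fps \<iota>i b * f) (A_to_T b * F)"
  unfolding completion_def
proof
  fix n
  obtain g where g: "reduction \<iota>i ai v n f g" "fps_X ^ n dvd (F - subst g)"
    using assms(1) unfolding completion_def by blast
  have "A_to_T b * F - subst (map_poly ac_scal b * g) = A_to_T b * (F - subst g)"
    by (simp only: subst.map_mult subst_A right_diff_distrib)
  then have "fps_X ^ n dvd A_to_T b * F - subst (map_poly ac_scal b * g)"
    using dvd_mult[OF g(2)] by simp
  moreover have "reduction \<iota>i ai v n (A_to_fps \<iota>i b * f) (map_poly ac_scal b * g)"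
    unfolding infty.A_to_fps_eq_lift by (rule infty.reduction_lift_mult[OF g(1)])
  ultimately show "\<exists>g. reduction \<iota>i ai v n (A_to_fps \<iota>i b * f) g \<and> fps_X ^ n dvd (A_to_T b * F - subst g)"
    by blast
qed

lemma f_v0_A_mult: "f_v0 \<iota>i ai v \<iota> a (A_to_fps \<iota>i b * infty.generator) = A_to_T b * solution"
  by (rule f_v0_eq[OF completion_A_mult[OF completion_solution]])

text \<open>
  The right-hand side has the defining property of the completion as well: modulo \<open>v^n\<close>, applying \<open>\<sigma>^d\<close> to a
  reduction and multiplying by the twist product gives a reduction again.
\<close>

lemma solution_equation: "solution = frobenius_factor * sigma (qv v) solution"
proof (rule completion_unique[OF completion_solution])
  show "completion infty.generator (frobenius_factor * sigma (qv v) solution)"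
    unfolding completion_def
  proof
    fix n
    obtain g where g: "reduction \<iota>i ai v n infty.generator g" "fps_X ^ n dvd (solution - subst g)"
      using completion_solution unfolding completion_def by blast
    define g' where "g' = twist_product 0 (degree v) * map_poly (\<lambda>x. x ^ qv v) g"
    have "infty.lift (twist_product 0 (degree v)) * sigma (qv v) infty.generator =
        sigma (CARD('q) ^ 0) infty.generator"
      unfolding qv_def by (rule infty.generator_twist[symmetric]) simp
    also have "\<dots> = infty.generator" by (simp add: fps_eq_iff)
    finally have "reduction \<iota>i ai v n infty.generator g'"
      using infty.reduction_lift_mult[OF infty.reduction_sigma[OF g(1), of "degree v"],
          of "twist_product 0 (degree v)"]
      unfolding g'_def qv_def by simp
    moreover have "fps_X ^ n dvd frobenius_factor * sigma (qv v) solution - subst g'"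
    proof -
      have "sigma (qv v) (fps_X ^ n) dvd sigma (qv v) (solution - subst g)"
        by (rule sigma_v.map_dvd[OF g(2)])
      then have "fps_X ^ n dvd frobenius_factor * sigma (qv v) (solution - subst g)"
        unfolding sigma_v.map_power sigma_X[OF frob_qv] by (rule dvd_mult)
      then show ?thesis
        unfolding g'_def by (simp only: subst.map_mult subst_twist subst_sigma sigma_v.map_diff right_diff_distrib)
    qed
    ultimately show "\<exists>g. reduction \<iota>i ai v n infty.generator g \<and>
       fps_X ^ n dvd (frobenius_factor * sigma (qv v) solution - subst g)" by blast
  qed
qed

text \<open>
  The constant coefficient is \<open>g(\<alpha>)\<close> for a reduction \<open>g\<close> of \<open>\<beta>\<ell>\<close> modulo \<open>v\<close>, and \<open>\<alpha>\<close> is the image of a root \<open>y\<close>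
  of \<open>v\<close> in the algebraic closure of \<open>K\<close>.  Embedded at the infinite place, \<open>y\<close> lies in the closed unit disc,
  and \<open>g(y) = 0\<close> would make \<open>\<beta>\<ell>\<close> vanish there.
\<close>

lemma solution_nth_0_nonzero: "fps_nth solution 0 \<noteq> 0"
proof
  assume zero: "fps_nth solution 0 = 0"
  obtain g where g: "reduction \<iota>i ai v 1 infty.generator g" "fps_X ^ 1 dvd (solution - subst g)"
    using completion_solution unfolding completion_def by blast
  have "fps_nth (solution - subst g) 0 = 0" using g(2) unfolding fps_X_power_dvd_iff by simp
  then have "fps_nth (subst g) 0 = 0" using zero by simp
  moreover have "fps_nth (subst g) 0 = poly (map_poly \<iota> g) \<alpha>" for g
  proof (induction g)
    case (pCons c g)
    then show ?case by (simp add: subst_pCons map_poly_pCons \<iota>.map_zero)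
  qed (simp add: subst.map_zero)
  ultimately have root: "poly (map_poly \<iota> g) \<alpha> = 0" by simp
  define V where "V = map_poly ac_scal v"
  have V0: "V \<noteq> 0" unfolding V_def by (rule map_poly_ring_map_nonzero[OF ring_map_ac_scal v_nonzero])
  have "map_poly \<iota> V = map_poly (scal \<iota>) v"
    by (rule poly_eqI) (simp add: V_def \<iota>.coeff_map ring_map.coeff_map[OF ring_map_ac_scal] scal.coeff_map scal_eq)
  then have "poly (map_poly \<iota> V) \<alpha> = 0" using v_alpha by simp
  then obtain y where y: "\<alpha> = \<iota> y" "poly V y = 0"
    using roots_in_alg_closed_field[OF ring_map_\<iota> V0] by blast
  have "\<iota> (poly g y) = 0" using root unfolding y(1) by (simp add: poly_map_eval[OF ring_map_\<iota>])
  then have gy: "poly g y = 0" by (simp add: ring_map_inj[OF ring_map_\<iota>])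
  have "\<iota> (y ^ qv v) = \<iota> y" using alpha_fixed y(1) by (simp add: \<iota>.map_power)
  then have "y ^ qv v = y" by (simp add: ring_map_eq_iff[OF ring_map_\<iota>])
  then have "\<iota>i y ^ qv v = \<iota>i y" by (simp add: infty.\<iota>.map_power[symmetric])
  then have "ai (\<iota>i y) \<le> 1"
    using infty.abs_power_fixed[OF _ qv_ge_2, of "\<iota>i y"] by (cases "\<iota>i y = 0") auto
  note gen = infty.generator_value_nonzero[OF this]
  obtain h where h: "h \<in> tate_algebra ai" "infty.generator - infty.lift g = A_to_fps \<iota>i (v ^ 1) * h"
    using g(1) unfolding infty.reduction_alt by blast
  have conv: "infty.conv_at h (\<iota>i y)"
    using h(1) \<open>ai (\<iota>i y) \<le> 1\<close> unfolding infty.tate_iff by (auto intro: infty.conv_at_mono[of _ 1])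
  have val: "infty.conv_at (infty.lift p) (\<iota>i y)" "infty.fps_value (infty.lift p) (\<iota>i y) = \<iota>i (poly p y)" for p
    unfolding infty.lift_def by (auto simp: infty.conv_at_poly infty.fps_value_poly poly_map_eval[OF infty.ring_map_\<iota>])
  have "infty.generator = infty.lift g + infty.lift V * h"
    using h(2) by (simp add: infty.A_to_fps_eq_lift V_def algebra_simps)
  then have "infty.fps_value infty.generator (\<iota>i y) = \<iota>i (poly g y) + \<iota>i (poly V y) * infty.fps_value h (\<iota>i y)"
    using conv val by (simp add: infty.fps_value_add infty.fps_value_mult infty.conv_at_mult)
  then show False using gen(2) gy y(2) by (simp add: infty.\<iota>.map_zero)
qed

lemma solution_conv: "conv_at solution w"
  and abs_solution_value: "a (fps_value solution w) ^ (qv v - 1) = real (qv v)"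
  using solution_conv_at[OF solution_equation solution_nth_0_nonzero]
    solution_value[OF solution_equation solution_nth_0_nonzero]
    solution_nth_0[OF solution_equation solution_nth_0_nonzero] by auto

lemma A_to_fls_eq: "A_to_fls v \<iota> a b = fps_to_fls (recenter a w (A_to_T b))"
  by (simp add: A_to_fls_def A_to_T_def)

definition t_minus_theta :: "'d fps" where
  "t_minus_theta = recenter a w T - fps_const (theta \<iota>)"

lemma A_to_T_t: "A_to_T [:0, 1:] = T"
  by (simp add: A_to_T_def map_poly_pCons scal.map_zero scal.map_one)

lemma h_v_eq: "h_v \<iota>i ai v \<iota> a f =
    inverse (fps_to_fls t_minus_theta) * fps_to_fls (recenter a w (f_v0 \<iota>i ai v \<iota> a f))"
  unfolding h_v_def A_to_fls_eq A_to_T_t t_minus_theta_def by (simp only: fps_to_fls_minus fps_const_to_fls)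

lemma hasse_0: "hasse 0 F = F"
  by (simp add: fps_eq_iff hasse_def)

lemma recenter_nth_0: "conv_at F w \<Longrightarrow> fps_nth (recenter a w F) 0 = fps_value F w"
  using recenter_nth[of F w 0] w_nonzero by (simp add: hasse_0)

lemma t_minus_theta_nth_0: "fps_nth t_minus_theta 0 = 0"
  using recenter_nth_0[OF integral_conv_at[OF T_integral]] by (simp add: t_minus_theta_def T_value)

text \<open>
  The coefficient is the value of the derivative of \<open>T\<close> at \<open>\<zeta>\<^sub>v\<close>, which is congruent to the unit \<open>T\<^sub>1\<close>.
\<close>

lemma abs_t_minus_theta_nth_1: "a (fps_nth t_minus_theta 1) = 1"
proof -
  have int: "integral_coeffs (hasse 1 T)"
    unfolding integral_coeffs_def
  proof
    fix n
    have "a (of_nat (n + 1 choose 1)) * a (fps_nth T (n + 1)) \<le> 1"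
      using T_integral by (intro mult_le_one abs_of_nat_le_1) (auto simp: integral_coeffs_def)
    then show "a (fps_nth (hasse 1 T) n) \<le> 1" by (simp only: hasse_def fps_nth_Abs_fps abs_mult)
  qed
  have 0: "fps_nth (hasse 1 T) 0 = fps_nth T 1" by (simp add: hasse_def)
  have "a (fps_value (hasse 1 T) w - fps_nth T 1) \<le> a w"
    using integral_value_minus_nth_0[OF int] unfolding 0 .
  then have "a (fps_nth T 1 + (fps_value (hasse 1 T) w - fps_nth T 1)) = a (fps_nth T 1)"
    using abs_T_nth_1 abs_w_bounds by (intro abs_add_eq) simp
  then have "a (fps_value (hasse 1 T) w) = 1" using abs_T_nth_1 by simp
  then show ?thesis
    using recenter_nth[OF integral_conv_at[OF T_integral] w_nonzero, of 1] by (simp add: t_minus_theta_def)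
qed

definition recentered :: "'d fps" where
  "recentered = recenter a w solution"

lemma recentered_nth_0: "fps_nth recentered 0 = fps_value solution w"
  unfolding recentered_def by (rule recenter_nth_0[OF solution_conv])

lemma recentered_nth_0_nonzero: "fps_nth recentered 0 \<noteq> 0"
proof
  assume "fps_nth recentered 0 = 0"
  then have "a (fps_value solution w) = 0" unfolding recentered_nth_0 by simp
  then have "real (qv v) = 0" using abs_solution_value qv_ge_2 by (simp add: zero_power)
  then show False using qv_ge_2 by simp
qed

lemma h_v_A_mult:
  "h_v \<iota>i ai v \<iota> a (A_to_fps \<iota>i b * infty.generator) =
    A_to_fls v \<iota> a b * (inverse (fps_to_fls t_minus_theta) * fps_to_fls recentered)"
proof -
  have "recenter a w (A_to_T b * solution) = recenter a w (A_to_T b) * recentered"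
    unfolding recentered_def
    by (rule recenter_mult[OF integral_conv_at[OF A_to_T_integral] solution_conv w_nonzero])
  then show ?thesis unfolding h_v_eq f_v0_A_mult A_to_fls_eq by (simp only: fls_times_fps_to_fls mult_ac)
qed

lemma t_minus_theta_nonzero: "t_minus_theta \<noteq> 0"
  using abs_t_minus_theta_nth_1 by auto

lemma pairing_v_eq: "pairing_v \<iota>i ai v \<iota> a u = fps_to_fls (t_minus_theta * inverse recentered)"
proof -
  have inv: "fps_to_fls recentered * fps_to_fls (inverse recentered) = 1"
    using inverse_mult_eq_1[OF recentered_nth_0_nonzero]
    by (simp only: fls_times_fps_to_fls[symmetric] mult.commute fps_one_to_fls)
  have tinv: "inverse (fps_to_fls t_minus_theta) * fps_to_fls t_minus_theta = 1"
    using t_minus_theta_nonzero by simp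
  define H where "H = inverse (fps_to_fls t_minus_theta) * fps_to_fls recentered"
  define c where "c = fps_to_fls (t_minus_theta * inverse recentered)"
  have "H * c = (inverse (fps_to_fls t_minus_theta) * fps_to_fls t_minus_theta) *
      (fps_to_fls recentered * fps_to_fls (inverse recentered))"
    unfolding H_def c_def fls_times_fps_to_fls by (simp only: mult_ac)
  then have Hc: "H * c = 1" unfolding inv tinv by simp
  show ?thesis
    unfolding pairing_v_def c_def[symmetric]
  proof (rule the_equality)
    show "\<forall>f\<in>H1_Betti \<iota>i ai. A_to_fls v \<iota> a (u f) = h_v \<iota>i ai v \<iota> a f * c"
    proof
      fix f assume "f \<in> H1_Betti \<iota>i ai"
      then obtain b where b: "f = A_to_fps \<iota>i b * infty.generator" using infty.H1_generated by blast
      show "A_to_fls v \<iota> a (u f) = h_v \<iota>i ai v \<iota> a f * c"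
        unfolding b h_v_A_mult infty.u_generator H_def[symmetric] mult.assoc Hc by simp
    qed
  next
    fix c' assume c': "\<forall>f\<in>H1_Betti \<iota>i ai. A_to_fls v \<iota> a (u f) = h_v \<iota>i ai v \<iota> a f * c'"
    have gen: "infty.generator = A_to_fps \<iota>i 1 * infty.generator" by (simp add: infty.A.map_one)
    have "A_to_fls v \<iota> a (u infty.generator) = h_v \<iota>i ai v \<iota> a infty.generator * c'"
      using c' infty.generator_in_H1 by blast
    then have "A_to_fls v \<iota> a 1 = A_to_fls v \<iota> a 1 * H * c'"
      using h_v_A_mult[of 1] infty.u_generator[of 1] unfolding gen[symmetric] H_def by simp
    moreover have "A_to_fls v \<iota> a 1 \<noteq> 0"
    proof -
      have "fps_nth (recenter a w (A_to_T 1)) 0 = 1"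
        using recenter_nth_0[OF integral_conv_at[OF A_to_T_integral[of 1]]] by (simp add: A_to_T_value gam.map_one)
      then show ?thesis unfolding A_to_fls_eq by auto
    qed
    ultimately have "H * c' = 1" by (simp add: mult.assoc)
    then have "H * c' = H * c" using Hc by simp
    moreover have "H \<noteq> 0" using Hc by auto
    ultimately show "c' = c" by simp
  qed
qed

lemma abs_period_v_eq: "abs_period_v \<iota>i ai v \<iota> a u = inverse (a (fps_value solution w))"
proof -
  define c where "c = t_minus_theta * inverse recentered"
  have c0: "fps_nth c 0 = 0" by (simp add: c_def t_minus_theta_nth_0)
  have c1: "fps_nth c 1 = fps_nth t_minus_theta 1 * inverse (fps_value solution w)"
    by (simp add: c_def fps_mult_nth t_minus_theta_nth_0 recentered_nth_0)
  then have a1: "a (fps_nth c 1) = inverse (a (fps_value solution w))"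
    by (simp only: abs_mult abs_inverse abs_t_minus_theta_nth_1 mult_1)
  have "fps_nth c 1 \<noteq> 0"
    unfolding c1 using abs_t_minus_theta_nth_1 recentered_nth_0_nonzero recentered_nth_0 by auto
  then have "subdegree c = 1" using c0 by (intro subdegreeI) auto
  then show ?thesis
    unfolding abs_period_v_def pairing_v_eq Let_def c_def[symmetric] fls_subdegree_fls_to_fps
    using a1 by simp
qed

lemma abs_solution_value_pos: "0 < a (fps_value solution w)"
  using recentered_nth_0_nonzero recentered_nth_0 by (simp add: abs_pos)

lemma abs_period_v_pos: "0 < abs_period_v \<iota>i ai v \<iota> a u"
  unfolding abs_period_v_eq using abs_solution_value_pos by simp

lemma ln_abs_period_v: "ln (abs_period_v \<iota>i ai v \<iota> a u) = - ln (real (qv v)) / (real (qv v) - 1)"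
proof -
  have "real (qv v - 1) * ln (a (fps_value solution w)) = ln (real (qv v))"
    using ln_realpow[of "a (fps_value solution w)" "qv v - 1"] abs_solution_value by simp
  moreover have "ln (abs_period_v \<iota>i ai v \<iota> a u) = - ln (a (fps_value solution w))"
    unfolding abs_period_v_eq by (rule ln_inverse)
  ultimately show ?thesis using qv_ge_2 by (simp add: field_simps of_nat_diff)
qed

end

section \<open>The Euler product\<close>

lemma irreducible_divisor_exists:
  fixes f :: "'a::field poly"
  assumes "0 < degree f"
  shows "\<exists>p. Factorial_Ring.irreducible p \<and> p dvd f"
  using assms
proof (induction "degree f" arbitrary: f rule: less_induct)
  case less
  have f0: "f \<noteq> 0" using less.prems by auto
  have unit: "\<not> f dvd 1" using less.prems f0 by (simp add: is_unit_iff_degree)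
  show ?case
  proof (cases "Factorial_Ring.irreducible f")
    case False
    then obtain b c where bc: "f = b * c" "\<not> b dvd 1" "\<not> c dvd 1"
      using f0 unit unfolding Factorial_Ring.irreducible_def by blast
    then have nz: "b \<noteq> 0" "c \<noteq> 0" using f0 by auto
    then have "0 < degree b" "0 < degree c" using bc by (simp_all add: is_unit_iff_degree)
    moreover have "degree f = degree b + degree c"
      unfolding bc(1) using nz by (rule degree_mult_eq)
    ultimately obtain p where "Factorial_Ring.irreducible p" "p dvd b" using less.hyps[of b] by auto
    then show ?thesis unfolding bc(1) by (auto intro: dvd_mult2)
  qed auto
qed

lemma extract_power:
  fixes h v :: "'a::field poly"
  assumes "h \<noteq> 0" "0 < degree v"
  shows "\<exists>k f. h = v ^ k * f \<and> \<not> v dvd f"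
  using assms(1)
proof (induction "degree h" arbitrary: h rule: less_induct)
  case less
  show ?case
  proof (cases "v dvd h")
    case True
    then obtain c where c: "h = v * c" by (elim dvdE)
    then have "degree h = degree v + degree c"
      using less.prems by (simp add: degree_mult_eq)
    then obtain k f where "c = v ^ k * f" "\<not> v dvd f" using less.hyps[of c] less.prems assms(2) c by auto
    then show ?thesis unfolding c by (intro exI[of _ "Suc k"] exI[of _ f]) (simp add: mult.assoc)
  qed (auto intro: exI[of _ 0])
qed

lemma card_polys_of_degree:
  "finite {f :: 'q::{finite,field} poly. f \<noteq> 0 \<and> degree f = k}"
  "card {f :: 'q::{finite,field} poly. f \<noteq> 0 \<and> degree f = k} = (CARD('q) - 1) * CARD('q) ^ k"
proof -
  let ?B = "{f :: 'q poly. f \<noteq> 0 \<and> degree f = k}"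
  let ?R = "\<lambda>n. {f :: 'q poly. f \<noteq> 0 \<and> degree f < n}"
  have eq: "?B = ?R (Suc k) - ?R k" by auto
  show "finite ?B" unfolding eq using card_nonzero_polys_below(1) by blast
  have "card ?B = card (?R (Suc k)) - card (?R k)"
    unfolding eq using card_nonzero_polys_below(1)[of k, where 'q = 'q] by (intro card_Diff_subset) auto
  then show "card ?B = (CARD('q) - 1) * CARD('q) ^ k"
    by (simp add: card_nonzero_polys_below(2) algebra_simps)
qed

lemma has_sum_geometric_powers:
  fixes c :: complex
  assumes "norm c < 1"
  shows "((\<lambda>k. c ^ k) has_sum (1 / (1 - c))) UNIV"
  using assms by (intro norm_summable_imp_has_sum geometric_sums) (auto simp: norm_power summable_geometric)

lemma
  fixes z :: complex
  assumes "real CARD('q::{finite,field}) * norm z < 1"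
  shows summable_polys: "(\<lambda>f :: 'q poly. z ^ degree f) summable_on {f. f \<noteq> 0}"
    and infsum_polys: "(\<Sum>\<^sub>\<infinity>f | (f :: 'q poly) \<noteq> 0. z ^ degree f) =
      of_nat (CARD('q) - 1) * (1 / (1 - of_nat CARD('q) * z))"
proof -
  define B where "B k = {f :: 'q poly. f \<noteq> 0 \<and> degree f = k}" for k
  have B: "finite (B k)" "card (B k) = (CARD('q) - 1) * CARD('q) ^ k" for k
    unfolding B_def by (rule card_polys_of_degree)+
  define r where "r = real CARD('q) * norm z"
  have r: "0 \<le> r" "r < 1" using assms by (auto simp: r_def)
  have "bdd_above (sum (\<lambda>f :: 'q poly. norm (z ^ degree f)) ` {F. F \<subseteq> {f. f \<noteq> 0} \<and> finite F})"
  proof (rule bdd_aboveI2)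
    fix F assume "F \<in> {F. F \<subseteq> {f :: 'q poly. f \<noteq> 0} \<and> finite F}"
    then have F: "finite F" "F \<subseteq> {f. f \<noteq> 0}" by auto
    define n where "n = Suc (Max (insert 0 (degree ` F)))"
    have "degree f < n" if "f \<in> F" for f
      using F that by (auto simp: n_def less_Suc_eq_le intro!: Max_ge)
    then have sub: "F \<subseteq> (\<Union>k\<in>{..<n}. B k)" using F by (auto simp: B_def)
    have "(\<Sum>f\<in>F. norm (z ^ degree f)) \<le> (\<Sum>f\<in>(\<Union>k\<in>{..<n}. B k). norm (z ^ degree f))"
      using sub B by (intro sum_mono2) auto
    also have "\<dots> = (\<Sum>k<n. \<Sum>f\<in>B k. norm (z ^ degree f))"
      using B by (intro sum.UNION_disjoint) (auto simp: B_def)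
    also have "\<dots> = (\<Sum>k<n. real (CARD('q) - 1) * r ^ k)"
    proof (intro sum.cong refl)
      fix k
      have "(\<Sum>f\<in>B k. norm (z ^ degree f)) = (\<Sum>f\<in>B k. norm z ^ k)"
        by (intro sum.cong) (auto simp: B_def norm_power)
      then show "(\<Sum>f\<in>B k. norm (z ^ degree f)) = real (CARD('q) - 1) * r ^ k"
        by (simp add: B r_def power_mult_distrib)
    qed
    also have "\<dots> = real (CARD('q) - 1) * (\<Sum>k<n. r ^ k)" by (simp add: sum_distrib_left)
    also have "(\<Sum>k<n. r ^ k) \<le> (\<Sum>k. r ^ k)" using r by (intro sum_le_suminf summable_geometric) auto
    finally show "(\<Sum>f\<in>F. norm (z ^ degree f)) \<le> real (CARD('q) - 1) * (\<Sum>k. r ^ k)"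
      by (simp add: mult_left_mono)
  qed
  then have "(\<lambda>f :: 'q poly. norm (z ^ degree f)) summable_on {f. f \<noteq> 0}"
    by (rule nonneg_bdd_above_summable_on[OF norm_ge_zero])
  then show summable: "(\<lambda>f :: 'q poly. z ^ degree f) summable_on {f. f \<noteq> 0}"
    by (rule abs_summable_summable)
  have bij: "bij_betw snd (Sigma UNIV B) {f :: 'q poly. f \<noteq> 0}"
    by (rule bij_betw_byWitness[where f' = "\<lambda>f. (degree f, f)"]) (auto simp: B_def)
  have "(\<Sum>\<^sub>\<infinity>f | (f :: 'q poly) \<noteq> 0. z ^ degree f) = (\<Sum>\<^sub>\<infinity>x\<in>Sigma UNIV B. z ^ degree (snd x))"
    using infsum_reindex_bij_betw[OF bij, of "\<lambda>f. z ^ degree f"] by simp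
  also have "\<dots> = (\<Sum>\<^sub>\<infinity>k. \<Sum>\<^sub>\<infinity>f\<in>B k. z ^ degree (snd (k, f)))"
    using summable summable_on_reindex_bij_betw[OF bij, of "\<lambda>f. z ^ degree f"]
    by (intro infsum_Sigma_banach[symmetric]) simp
  also have "\<dots> = (\<Sum>\<^sub>\<infinity>k. of_nat (CARD('q) - 1) * (of_nat CARD('q) * z) ^ k)"
  proof (rule infsum_cong)
    fix k
    have "(\<Sum>\<^sub>\<infinity>f\<in>B k. z ^ degree (snd (k, f))) = (\<Sum>f\<in>B k. z ^ k)"
      using B by (simp add: B_def)
    then show "(\<Sum>\<^sub>\<infinity>f\<in>B k. z ^ degree (snd (k, f))) = of_nat (CARD('q) - 1) * (of_nat CARD('q) * z) ^ k"
      by (simp add: B power_mult_distrib)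
  qed
  also have "\<dots> = of_nat (CARD('q) - 1) * (1 / (1 - of_nat CARD('q) * z))"
    using r by (intro infsumI has_sum_cmult_right has_sum_geometric_powers) (simp add: norm_mult r_def)
  finally show "(\<Sum>\<^sub>\<infinity>f | (f :: 'q poly) \<noteq> 0. z ^ degree f) =
      of_nat (CARD('q) - 1) * (1 / (1 - of_nat CARD('q) * z))" .
qed

text \<open>
  The sum over these polynomials is \<open>q - 1\<close> times the partial Euler product over \<open>S\<close>.
\<close>

definition smooth_polys :: "'a::field poly set \<Rightarrow> 'a poly set \<Rightarrow> 'a poly set" where
  "smooth_polys V S = {f. f \<noteq> 0 \<and> (\<forall>v\<in>V. v dvd f \<longrightarrow> v \<in> S)}"

lemma finite_places_facts:
  assumes "finite_places V" "v \<in> V"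
  shows "prime_elem v" "0 < degree v" "\<And>u. u \<in> V \<Longrightarrow> u dvd v \<Longrightarrow> u = v"
proof -
  have irr: "Factorial_Ring.irreducible v" using assms unfolding finite_places_def by blast
  then show pr: "prime_elem v" by (rule field_poly_irreducible_imp_prime)
  show "0 < degree v"
  proof (rule ccontr)
    assume "\<not> 0 < degree v"
    then have "degree v = 0" by simp
    moreover have "v \<noteq> 0" using pr by (simp add: prime_elem_def)
    ultimately have "v dvd 1" using is_unit_iff_degree by blast
    then show False using pr by (simp add: prime_elem_def)
  qed
  show "u = v" if "u \<in> V" "u dvd v" for u
  proof -
    have "\<exists>!u. u \<in> V \<and> u dvd v" using assms(1) irr unfolding finite_places_def by simp
    then obtain x where x: "\<And>y. y \<in> V \<Longrightarrow> y dvd v \<Longrightarrow> y = x" by (auto elim!: ex1E)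
    show ?thesis using x[OF that] x[OF assms(2) dvd_refl] by simp
  qed
qed

lemma smooth_polys_empty:
  fixes V :: "'q::{finite,field} poly set"
  assumes "finite_places V"
  shows "smooth_polys V {} = {f. f \<noteq> 0 \<and> degree f = 0}"
proof (intro equalityI subsetI CollectI conjI)
  fix f assume f: "f \<in> smooth_polys V {}"
  then show "f \<noteq> 0" by (simp add: smooth_polys_def)
  show "degree f = 0"
  proof (rule ccontr)
    assume "degree f \<noteq> 0"
    then have "0 < degree f" by simp
    then obtain p where p: "Factorial_Ring.irreducible p" "p dvd f" using irreducible_divisor_exists by blast
    have "\<exists>!v. v \<in> V \<and> v dvd p" using assms p(1) unfolding finite_places_def by simp
    then obtain v where v: "v \<in> V" "v dvd p" by (elim ex1E conjE)
    have "v dvd f" by (rule dvd_trans[OF v(2) p(2)])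
    then show False using f v(1) by (simp add: smooth_polys_def)
  qed
next
  fix f assume "f \<in> {f :: 'q poly. f \<noteq> 0 \<and> degree f = 0}"
  then have f: "f \<noteq> 0" "degree f = 0" by auto
  have "\<not> v dvd f" if "v \<in> V" for v
  proof
    assume "v dvd f"
    then have "degree v \<le> 0" using dvd_imp_degree_le[of v f] f by simp
    then show False using finite_places_facts(2)[OF assms that] by simp
  qed
  then show "f \<in> smooth_polys V {}" using f by (simp add: smooth_polys_def)
qed

text \<open>
  Every polynomial is uniquely a power of \<open>v\<close> times a polynomial prime to \<open>v\<close>; the geometric series over the
  exponents is the Euler factor.
\<close>

lemma smooth_polys_insert:
  assumes V: "finite_places V" and v: "v \<in> V" "v \<notin> S"
  shows "bij_betw (\<lambda>(k, f). v ^ k * f) (UNIV \<times> smooth_polys V S) (smooth_polys V (insert v S))"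
  unfolding bij_betw_def
proof
  note pv = finite_places_facts[OF V v(1)]
  have v0: "v \<noteq> 0" using pv(1) by (simp add: prime_elem_def)
  have nd: "\<not> v dvd f" if "f \<in> smooth_polys V S" for f using that v by (auto simp: smooth_polys_def)
  show "inj_on (\<lambda>(k, f). v ^ k * f) (UNIV \<times> smooth_polys V S)"
  proof -
    have *: "k = l \<and> f = g" if "f \<in> smooth_polys V S" "v ^ k * f = v ^ l * g" "k \<le> l" for k l f g
    proof -
      have "v ^ l = v ^ k * v ^ (l - k)" using that(3) by (simp add: power_add[symmetric])
      then have "v ^ k * f = v ^ k * (v ^ (l - k) * g)" using that(2) by (simp add: mult.assoc)
      then have f: "f = v ^ (l - k) * g" using v0 by simp
      have "l - k = 0"
      proof (rule ccontr)
        assume "l - k \<noteq> 0"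
        then have "v dvd f" unfolding f by (intro dvd_mult2 dvd_power) auto
        then show False using nd[OF that(1)] by simp
      qed
      then show ?thesis using f that(3) by simp
    qed
    show ?thesis
    proof (rule inj_onI, clarify)
      fix k l f g assume fg: "f \<in> smooth_polys V S" "g \<in> smooth_polys V S" "v ^ k * f = v ^ l * g"
      show "k = l \<and> f = g"
        using *[OF fg(1) fg(3)] *[OF fg(2) fg(3)[symmetric]] by (cases "k \<le> l") auto
    qed
  qed
  show "(\<lambda>(k, f). v ^ k * f) ` (UNIV \<times> smooth_polys V S) = smooth_polys V (insert v S)"
  proof safe
    fix k :: nat and f assume f: "f \<in> smooth_polys V S"
    have "u = v" if "u \<in> V" "u dvd v ^ k * f" "u \<notin> S" for u
    proof -
      have "\<not> u dvd f" using that f by (auto simp: smooth_polys_def)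
      moreover have pu: "prime_elem u" by (rule finite_places_facts(1)[OF V that(1)])
      ultimately have "u dvd v ^ k" using that(2) by (simp add: prime_elem_dvd_mult_iff)
      then have "u dvd v" using pu prime_elem_dvd_power by blast
      then show ?thesis using pv(3) that(1) by blast
    qed
    then show "v ^ k * f \<in> smooth_polys V (insert v S)"
      using f v0 by (auto simp: smooth_polys_def)
  next
    fix h assume h: "h \<in> smooth_polys V (insert v S)"
    then obtain k f where kf: "h = v ^ k * f" "\<not> v dvd f"
      using extract_power[of h v] pv(2) by (auto simp: smooth_polys_def)
    have "f \<in> smooth_polys V S"
      using h kf unfolding smooth_polys_def by auto
    then show "h \<in> (\<lambda>(k, f). v ^ k * f) ` (UNIV \<times> smooth_polys V S)" using kf by force
  qed
qed

lemma infsum_smooth_polys: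
  fixes z :: complex and V :: "'q::{finite,field} poly set"
  assumes V: "finite_places V" and z: "real CARD('q) * norm z < 1"
    and S: "finite S" "S \<subseteq> V"
  shows "(\<Sum>\<^sub>\<infinity>f\<in>smooth_polys V S. z ^ degree f) =
    of_nat (CARD('q) - 1) * (\<Prod>v\<in>S. inverse (1 - z ^ degree v))"
  using S
proof (induction S rule: finite_induct)
  case empty
  have "(\<Sum>\<^sub>\<infinity>f\<in>smooth_polys V {}. z ^ degree f) =
      (\<Sum>f | (f :: 'q poly) \<noteq> 0 \<and> degree f = 0. z ^ degree f)"
    unfolding smooth_polys_empty[OF V] using card_polys_of_degree(1)[of 0] by (rule infsum_finite)
  also have "\<dots> = (\<Sum>f | (f :: 'q poly) \<noteq> 0 \<and> degree f = 0. 1)" by (intro sum.cong) auto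
  also have "\<dots> = of_nat (card {f :: 'q poly. f \<noteq> 0 \<and> degree f = 0})" by simp
  finally show ?case by (simp only: card_polys_of_degree(2)) simp
next
  case (insert v S)
  have v: "v \<in> V" "v \<notin> S" using insert by auto
  note pv = finite_places_facts[OF V v(1)]
  have v0: "v \<noteq> 0" using pv(1) by (simp add: prime_elem_def)
  have "1 * norm z \<le> real CARD('q) * norm z"
    using card_field_ge_2[where 'q = 'q] by (intro mult_right_mono) auto
  then have "norm z < 1" using z by linarith
  then have zd: "norm (z ^ degree v) < 1"
    unfolding norm_power using pv(2) by (intro power_less_one_iff[THEN iffD2]) auto
  note bij = smooth_polys_insert[OF V v]
  let ?g = "\<lambda>f :: 'q poly. z ^ degree f"
  have "?g summable_on smooth_polys V (insert v S)"
    by (rule summable_on_subset_banach[OF summable_polys[OF z]]) (auto simp: smooth_polys_def)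
  then have summable: "(\<lambda>x. ?g (case x of (k, f) \<Rightarrow> v ^ k * f)) summable_on (UNIV \<times> smooth_polys V S)"
    using summable_on_reindex_bij_betw[OF bij, of ?g] by simp
  have "infsum ?g (smooth_polys V (insert v S)) =
      (\<Sum>\<^sub>\<infinity>x\<in>UNIV \<times> smooth_polys V S. ?g (case x of (k, f) \<Rightarrow> v ^ k * f))"
    using infsum_reindex_bij_betw[OF bij, of ?g] by simp
  also have "\<dots> = (\<Sum>\<^sub>\<infinity>k. \<Sum>\<^sub>\<infinity>f\<in>smooth_polys V S. ?g (case (k, f) of (k, f) \<Rightarrow> v ^ k * f))"
    using summable by (rule infsum_Sigma_banach[symmetric])
  also have "\<dots> = (\<Sum>\<^sub>\<infinity>k. (z ^ degree v) ^ k * infsum ?g (smooth_polys V S))"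
  proof (rule infsum_cong)
    fix k :: nat
    have "(\<Sum>\<^sub>\<infinity>f\<in>smooth_polys V S. ?g (case (k, f) of (k, f) \<Rightarrow> v ^ k * f)) =
        (\<Sum>\<^sub>\<infinity>f\<in>smooth_polys V S. (z ^ degree v) ^ k * ?g f)"
    proof (rule infsum_cong)
      fix f assume "f \<in> smooth_polys V S"
      then have "degree (v ^ k * f) = degree v * k + degree f"
        using v0 by (simp add: smooth_polys_def degree_mult_eq degree_power_eq)
      then show "?g (case (k, f) of (k, f) \<Rightarrow> v ^ k * f) = (z ^ degree v) ^ k * ?g f"
        by (simp only: prod.case power_add power_mult)
    qed
    then show "(\<Sum>\<^sub>\<infinity>f\<in>smooth_polys V S. ?g (case (k, f) of (k, f) \<Rightarrow> v ^ k * f)) =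
        (z ^ degree v) ^ k * infsum ?g (smooth_polys V S)"
      by (simp only: infsum_cmult_right')
  qed
  also have "\<dots> = (\<Sum>\<^sub>\<infinity>k. (z ^ degree v) ^ k) * infsum ?g (smooth_polys V S)"
    by (rule infsum_cmult_left')
  also have "(\<Sum>\<^sub>\<infinity>k. (z ^ degree v) ^ k) = inverse (1 - z ^ degree v)"
    using infsumI[OF has_sum_geometric_powers[OF zd]] by (simp add: inverse_eq_divide)
  finally show ?case using insert by (simp add: mult_ac)
qed

text \<open>
  For every finite set of nonzero polynomials, the smooth polynomials contain it as soon as \<open>S\<close> contains its finitely
  many prime divisors.  So the sums over smooth polynomials tend to the sum over all nonzero polynomials.
\<close>

lemma euler_product:
  fixes z :: complex and V :: "'q::{finite,field} poly set"
  assumes V: "finite_places V" and z: "real CARD('q) * norm z < 1"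
  shows "((\<lambda>S. \<Prod>v\<in>S. inverse (1 - z ^ degree v)) \<longlongrightarrow> inverse (1 - of_nat CARD('q) * z))
    (finite_subsets_at_top V)"
proof -
  let ?g = "\<lambda>f :: 'q poly. z ^ degree f"
  let ?N = "{f :: 'q poly. f \<noteq> 0}"
  define total where "total = infsum ?g ?N"
  have sum: "(?g has_sum total) ?N" unfolding total_def using summable_polys[OF z] by (rule has_sum_infsum)
  have lim: "((\<lambda>S. infsum ?g (smooth_polys V S)) \<longlongrightarrow> total) (finite_subsets_at_top V)"
    unfolding tendsto_iff
  proof (intro allI impI)
    fix e :: real assume e: "e > 0"
    have "eventually (\<lambda>F. dist (sum ?g F) total < e / 2) (finite_subsets_at_top ?N)"
      using sum[unfolded has_sum_def] half_gt_zero[OF e] by (rule tendstoD)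
    then obtain F0 where "finite F0 \<and> F0 \<subseteq> ?N \<and>
        (\<forall>F. finite F \<and> F0 \<subseteq> F \<and> F \<subseteq> ?N \<longrightarrow> dist (sum ?g F) total < e / 2)"
      unfolding eventually_finite_subsets_at_top by (rule exE)
    then have F0: "finite F0" "F0 \<subseteq> ?N"
      and close: "\<And>F. finite F \<Longrightarrow> F0 \<subseteq> F \<Longrightarrow> F \<subseteq> ?N \<Longrightarrow> dist (sum ?g F) total < e / 2"
      by simp_all
    define S0 where "S0 = (\<Union>f\<in>F0. {v \<in> V. v dvd f})"
    have "finite {v \<in> V. v dvd f}" if "f \<in> F0" for f
    proof (rule finite_subset)
      have "f \<noteq> 0" using F0 that by auto
      then show "{v \<in> V. v dvd f} \<subseteq> {v. \<forall>i\<ge>Suc (degree f). poly.coeff v i = 0}"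
        using dvd_imp_degree_le[of _ f] by (auto intro!: coeff_eq_0 intro: le_less_trans simp: Suc_le_eq)
    qed (rule finite_polys_below)
    then have "finite S0" unfolding S0_def using F0 by auto
    moreover have "dist (infsum ?g (smooth_polys V S)) total < e"
      if S: "finite S" "S0 \<subseteq> S" "S \<subseteq> V" for S
    proof -
      have F0S: "F0 \<subseteq> smooth_polys V S" using F0 S by (auto simp: smooth_polys_def S0_def)
      have sub: "smooth_polys V S \<subseteq> ?N" by (auto simp: smooth_polys_def)
      have "?g summable_on smooth_polys V S" by (rule summable_on_subset_banach[OF summable_polys[OF z] sub])
      then have "(?g has_sum infsum ?g (smooth_polys V S)) (smooth_polys V S)" by (rule has_sum_infsum)
      then have "(sum ?g \<longlongrightarrow> infsum ?g (smooth_polys V S)) (finite_subsets_at_top (smooth_polys V S))"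
        unfolding has_sum_def .
      then have "((\<lambda>F. dist (sum ?g F) total) \<longlongrightarrow> dist (infsum ?g (smooth_polys V S)) total)
          (finite_subsets_at_top (smooth_polys V S))"
        by (intro tendsto_dist tendsto_const)
      moreover have "eventually (\<lambda>F. dist (sum ?g F) total \<le> e / 2) (finite_subsets_at_top (smooth_polys V S))"
        unfolding eventually_finite_subsets_at_top
      proof (intro exI[of _ F0] conjI allI impI)
        fix F assume F: "finite F \<and> F0 \<subseteq> F \<and> F \<subseteq> smooth_polys V S"
        then have "dist (sum ?g F) total < e / 2" using sub by (intro close) auto
        then show "dist (sum ?g F) total \<le> e / 2" by simp
      qed (use F0(1) F0S in auto)
      ultimately have "dist (infsum ?g (smooth_polys V S)) total \<le> e / 2"
        by (rule tendsto_upperbound) simp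
      then show ?thesis using e by simp
    qed
    moreover have "S0 \<subseteq> V" by (auto simp: S0_def)
    ultimately show "eventually (\<lambda>S. dist (infsum ?g (smooth_polys V S)) total < e) (finite_subsets_at_top V)"
      unfolding eventually_finite_subsets_at_top by (intro exI[of _ S0]) simp
  qed
  define c :: complex where "c = of_nat (CARD('q) - 1)"
  have "CARD('q) - 1 \<noteq> 0" using card_field_ge_2[where 'q = 'q] by linarith
  then have c: "c \<noteq> 0" unfolding c_def of_nat_eq_0_iff .
  have "((\<lambda>S. inverse c * infsum ?g (smooth_polys V S)) \<longlongrightarrow> inverse c * total) (finite_subsets_at_top V)"
    by (intro tendsto_mult tendsto_const lim)
  also have "inverse c * total = inverse (1 - of_nat CARD('q) * z)"
    unfolding total_def infsum_polys[OF z] c_def[symmetric] using c by (simp add: inverse_eq_divide)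
  finally show ?thesis
  proof (rule Lim_transform_eventually)
    show "eventually (\<lambda>S. inverse c * infsum ?g (smooth_polys V S) =
        (\<Prod>v\<in>S. inverse (1 - z ^ degree v))) (finite_subsets_at_top V)"
    proof (rule eventually_finite_subsets_at_top_weakI)
      fix S assume "finite S" "S \<subseteq> V"
      note infsum_smooth_polys[OF V z this, folded c_def]
      then show "inverse c * infsum ?g (smooth_polys V S) = (\<Prod>v\<in>S. inverse (1 - z ^ degree v))"
        using c by simp
    qed
  qed
qed

section \<open>The trivial character\<close>

lemma invariants_projection_trivial: "invariants_projection {mat 1} = (mat 1 :: complex ^ 1 ^ 1)"
  by (simp add: invariants_projection_def vec_eq_iff)

lemma contragredient_trivial: "contragredient trivial_rep = trivial_rep"
  by (auto simp: contragredient_def trivial_rep_def transpose_mat)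

lemma euler_factor_trivial:
  fixes w :: "'q::{finite,field} ratbar \<Rightarrow> real"
  assumes "w 0 = 0"
  shows "euler_factor v w trivial_rep s = inverse (1 - of_nat (qv v) powr (- s))"
proof -
  have "id \<in> inertia_group w"
    using assms by (simp add: inertia_group_def decomposition_group_def galois_group_def ring_embedding_def)
  then have "trivial_rep ` inertia_group w = {mat 1}" by (auto simp: trivial_rep_def)
  then show ?thesis
    unfolding euler_factor_def
    by (simp only: invariants_projection_trivial trivial_rep_def matrix_mul_lid) (simp add: det_1 mat_def)
qed

text \<open>
  The image of each ramification group is the trivial group or empty.  In the second case its cardinality
  0 makes the term vanish.
\<close>

lemma conductor_exponent_trivial: "conductor_exponent w trivial_rep = 0"
proof -
  have "of_nat (card (trivial_rep ` ramification_group w trivial_rep i)) /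
      of_nat (card (trivial_rep ` ramification_group w trivial_rep 0)) *
      (of_nat CARD(1) - trace (invariants_projection (trivial_rep ` ramification_group w trivial_rep i))) = (0 :: complex)"
    for i
  proof (cases "ramification_group w trivial_rep i = {}")
    case False
    then have "trivial_rep ` ramification_group w trivial_rep i = {mat 1}" by (auto simp: trivial_rep_def)
    moreover have "trace (mat 1 :: complex ^ 1 ^ 1) = 1" by (simp add: trace_def mat_def)
    ultimately show ?thesis by (simp only: invariants_projection_trivial) simp
  qed simp
  then show ?thesis unfolding conductor_exponent_def by (simp only: suminf_zero)
qed

lemma of_nat_powr: "n \<noteq> 0 \<Longrightarrow> of_nat n powr s = exp (s * of_real (ln (real n)))"
  for s :: complex
  unfolding powr_def using Ln_of_real[of "real n"] by simp

text \<open>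
  The difference vanishes near every point after removal of its singularities.  Both functions therefore
  have the same poles and limits, and those determine the values of a nicely meromorphic function.
\<close>

lemma nicely_meromorphic_eqI:
  assumes F: "F nicely_meromorphic_on UNIV" and G: "G nicely_meromorphic_on UNIV"
    and "open U" "U \<noteq> {}" and eq: "\<And>s. s \<in> U \<Longrightarrow> F s = G s"
  shows "F = G"
proof
  fix z
  have mero: "F meromorphic_on UNIV" "G meromorphic_on UNIV"
    using F G by (auto simp: nicely_meromorphic_on_def)
  define H where "H s = F s - G s" for s
  have H: "H meromorphic_on UNIV" unfolding H_def by (intro meromorphic_intros mero)
  obtain p where p: "p \<in> U" using \<open>U \<noteq> {}\<close> by auto
  have iso: "isolated_singularity_at H s" for s
    using H meromorphic_on_isolated_singularity by (meson UNIV_I meromorphic_on_subset subset_UNIV)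
  have rem: "eventually (\<lambda>x. remove_sings H x = H x) (at s)" for s
    using eventually_remove_sings_eq_at[OF iso] .
  have "eventually (\<lambda>x. x \<in> U) (at p)" using \<open>open U\<close> p by (rule eventually_at_in_open')
  then have "eventually (\<lambda>x. remove_sings H x = 0) (at p)"
    using rem by eventually_elim (simp add: H_def eq)
  then have "frequently (\<lambda>x. remove_sings H x = 0) (at p)"
    by (rule eventually_frequently[rotated]) simp
  then have zero: "remove_sings H x = 0" for x
    using frequently_eq_meromorphic_imp_constant[of "remove_sings H" 0 p UNIV x]
      remove_sings_nicely_meromorphic[OF H] by auto
  have ev: "eventually (\<lambda>x. F x = G x) (at z)"
    using rem[of z] by eventually_elim (simp add: zero H_def)
  have poles: "is_pole F z \<longleftrightarrow> is_pole G z"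
    unfolding is_pole_def using ev by (intro filterlim_cong) auto
  consider "is_pole F z \<and> F z = 0" "is_pole G z \<and> G z = 0" | "\<not> is_pole F z" "\<not> is_pole G z"
    using F G poles unfolding nicely_meromorphic_on_def
    by (meson UNIV_I is_pole_def not_tendsto_and_filterlim_at_infinity trivial_limit_at)
  then show "F z = G z"
  proof cases
    case 2
    then have "(F \<longlongrightarrow> F z) (at z)" "(G \<longlongrightarrow> G z) (at z)"
      using F G unfolding nicely_meromorphic_on_def by auto
    moreover from this(1) have "(G \<longlongrightarrow> F z) (at z)" using ev by (rule Lim_transform_eventually)
    ultimately show ?thesis using LIM_unique by blast
  qed simp
qed

context
  fixes V :: "'q::{finite,field} poly set" and w :: "'q poly \<Rightarrow> 'q ratbar \<Rightarrow> real"
  assumes V: "finite_places V" and w: "\<And>v. v \<in> V \<Longrightarrow> w v 0 = 0"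
begin

lemma L_infinity_trivial:
  "L_infinity V w trivial_rep = (\<lambda>s. inverse (1 - exp ((1 - s) * of_real (ln (real CARD('q))))))"
    (is "_ = ?L")
  unfolding L_infinity_def
proof (rule the_equality)
  have q: "CARD('q) \<ge> 2" by (rule card_field_ge_2)
  have "(\<lambda>s. 1 - exp ((1 - s) * of_real (ln (real CARD('q))))) nicely_meromorphic_on UNIV"
    by (intro analytic_on_imp_nicely_meromorphic_on analytic_intros)
  then have mero: "?L nicely_meromorphic_on UNIV" by (rule nicely_meromorphic_on_inverse)
  have lim: "((\<lambda>S. \<Prod>v\<in>S. euler_factor v (w v) trivial_rep s) \<longlongrightarrow> ?L s) (finite_subsets_at_top V)"
    if "Re s > 1" for s
  proof -
    define z where "z = exp (- s * of_real (ln (real CARD('q))))"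
    have qz: "of_nat CARD('q) * z = exp ((1 - s) * of_real (ln (real CARD('q))))"
    proof -
      have "of_nat CARD('q) = exp (complex_of_real (ln (real CARD('q))))"
        using q by (simp add: exp_of_real)
      then show ?thesis unfolding z_def by (simp add: exp_add[symmetric] algebra_simps)
    qed
    have "norm (of_nat CARD('q) * z) < 1"
    proof -
      have "ln (real CARD('q)) > 0" using q by simp
      then have "(1 - Re s) * ln (real CARD('q)) < 0" using that by (simp add: mult_neg_pos)
      then show ?thesis unfolding qz norm_exp_eq_Re by simp
    qed
    then have "real CARD('q) * norm z < 1" by (simp add: norm_mult)
    from euler_product[OF V this]
    have "((\<lambda>S. \<Prod>v\<in>S. inverse (1 - z ^ degree v)) \<longlongrightarrow> ?L s) (finite_subsets_at_top V)"
      unfolding qz .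
    then show ?thesis
    proof (rule Lim_transform_eventually)
      show "eventually (\<lambda>S. (\<Prod>v\<in>S. inverse (1 - z ^ degree v)) =
          (\<Prod>v\<in>S. euler_factor v (w v) trivial_rep s)) (finite_subsets_at_top V)"
      proof (rule eventually_finite_subsets_at_top_weakI, rule prod.cong)
        fix S v assume "S \<subseteq> V" "v \<in> S"
        then have "euler_factor v (w v) trivial_rep s = inverse (1 - of_nat (qv v) powr (- s))"
          using w by (intro euler_factor_trivial) auto
        moreover have "of_nat (qv v) powr (- s) = z ^ degree v"
        proof -
          have "qv v \<noteq> 0" using q by (simp add: qv_def)
          then have "of_nat (qv v) powr (- s) = exp (- s * of_real (ln (real (qv v))))" by (rule of_nat_powr)
          also have "ln (real (qv v)) = real (degree v) * ln (real CARD('q))"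
            by (simp add: qv_def ln_realpow)
          finally show ?thesis unfolding z_def exp_of_nat_mult[symmetric] by (simp add: mult_ac)
        qed
        ultimately show "inverse (1 - z ^ degree v) = euler_factor v (w v) trivial_rep s" by simp
      qed simp
    qed
  qed
  show "?L nicely_meromorphic_on UNIV \<and>
      (\<forall>s. Re s > 1 \<longrightarrow> ((\<lambda>S. \<Prod>v\<in>S. euler_factor v (w v) trivial_rep s) \<longlongrightarrow> ?L s) (finite_subsets_at_top V))"
    using mero lim by blast
  fix L assume L: "L nicely_meromorphic_on UNIV \<and>
      (\<forall>s. Re s > 1 \<longrightarrow> ((\<lambda>S. \<Prod>v\<in>S. euler_factor v (w v) trivial_rep s) \<longlongrightarrow> L s) (finite_subsets_at_top V))"
  show "L = ?L"
  proof (rule nicely_meromorphic_eqI)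
    show "open {s. Re s > 1}" by (rule open_halfspace_Re_gt)
    have "(2 :: complex) \<in> {s. Re s > 1}" by simp
    then show "{s. Re s > 1} \<noteq> {}" by blast
    show "L s = ?L s" if "s \<in> {s. Re s > 1}" for s
      using L lim that tendsto_unique[OF finite_subsets_at_top_neq_bot] by blast
  qed (use L mero in auto)
qed

lemma Z_infinity_trivial:
  shows "\<not> is_pole (Z_infinity V w trivial_rep) 0"
    and "Z_infinity V w trivial_rep 0 = of_real (real CARD('q) / (real CARD('q) - 1) * ln (real CARD('q)))"
proof -
  define c :: complex where "c = of_real (ln (real CARD('q)))"
  define E where "E s = exp ((1 - s) * c)" for s
  have q: "CARD('q) \<ge> 2" by (rule card_field_ge_2)
  have E0: "E 0 = of_nat CARD('q)" unfolding E_def c_def using q by (simp add: exp_of_real)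
  have L: "L_infinity V w trivial_rep = (\<lambda>s. inverse (1 - E s))"
    unfolding L_infinity_trivial E_def c_def by (rule refl)
  have Z: "Z_infinity V w trivial_rep s = - (c * E s) / (1 - E s)" if "E s \<noteq> 1" for s
  proof -
    have "((\<lambda>s. inverse (1 - E s)) has_field_derivative (- (c * E s) / (1 - E s) ^ 2)) (at s)"
      unfolding E_def using that[unfolded E_def]
      by (auto intro!: derivative_eq_intros simp: power2_eq_square field_simps)
    then have "deriv (\<lambda>s. inverse (1 - E s)) s = - (c * E s) / (1 - E s) ^ 2" by (rule DERIV_imp_deriv)
    moreover have "x / d ^ 2 / inverse d = x / d" if "d \<noteq> 0" for x d :: complex
      using that by (simp add: power2_eq_square)
    ultimately show ?thesis unfolding Z_infinity_def L using that by simp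
  qed
  have "of_nat CARD('q) \<noteq> (1 :: complex)" using q by (metis of_nat_eq_1_iff numeral_le_one_iff semiring_norm(69))
  then have E1: "E 0 \<noteq> 1" unfolding E0 .
  have contE: "isCont E s" for s unfolding E_def by (intro continuous_intros)
  have "eventually (\<lambda>s. E s \<noteq> 1) (at 0)"
    using contE[of 0] E1 unfolding isCont_def by (rule tendsto_imp_eventually_ne)
  then have ev: "eventually (\<lambda>s. - (c * E s) / (1 - E s) = Z_infinity V w trivial_rep s) (at 0)"
    by eventually_elim (simp add: Z)
  have "((\<lambda>s. - (c * E s) / (1 - E s)) \<longlongrightarrow> - (c * E 0) / (1 - E 0)) (at 0)"
    using contE[of 0] E1 unfolding isCont_def by (intro tendsto_intros) auto
  then have "(Z_infinity V w trivial_rep \<longlongrightarrow> - (c * E 0) / (1 - E 0)) (at 0)"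
    using ev by (rule Lim_transform_eventually)
  then show "\<not> is_pole (Z_infinity V w trivial_rep) 0"
    unfolding is_pole_def using not_tendsto_and_filterlim_at_infinity[OF trivial_limit_at] by blast
  have "Z_infinity V w trivial_rep 0 = - (c * of_nat CARD('q)) / (1 - of_nat CARD('q))"
    using Z[OF E1] unfolding E0 .
  also have "\<dots> = of_real (- (ln (real CARD('q)) * real CARD('q)) / (1 - real CARD('q)))"
    unfolding c_def by simp
  also have "- (ln (real CARD('q)) * real CARD('q)) / (1 - real CARD('q)) =
      real CARD('q) / (real CARD('q) - 1) * ln (real CARD('q))"
    using q by (simp add: field_simps)
  finally show "Z_infinity V w trivial_rep 0 = of_real (real CARD('q) / (real CARD('q) - 1) * ln (real CARD('q)))" .
qed

lemma mu_Art_trivial: "mu_Art V w trivial_rep = 0"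
  by (simp add: mu_Art_def conductor_exponent_trivial)

lemma Z_v_trivial:
  assumes "v \<in> V"
  shows "Z_v v (w v) trivial_rep 1 * of_real (ln (real (qv v))) = of_real (ln (real (qv v)) / (real (qv v) - 1))"
proof -
  have "2 \<le> CARD('q) ^ 1" using card_field_ge_2[where 'q = 'q] by simp
  also have "\<dots> \<le> qv v" unfolding qv_def using finite_places_facts(2)[OF V assms]
    by (intro power_increasing) auto
  finally have Q: "qv v \<ge> 2" .
  define c :: complex where "c = of_real (ln (real (qv v)))"
  have c0: "c \<noteq> 0" unfolding c_def using Q by simp
  define E where "E s = exp (- s * c)" for s
  have e: "euler_factor v (w v) trivial_rep = (\<lambda>s. inverse (1 - E s))"
    using Q by (intro ext) (simp add: euler_factor_trivial w assms of_nat_powr E_def c_def)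
  have E1: "E 1 = of_real (1 / real (qv v))"
  proof -
    have "E 1 = of_real (exp (- ln (real (qv v))))" unfolding E_def c_def by (simp add: exp_of_real[symmetric] del: exp_ln)
    also have "exp (- ln (real (qv v))) = 1 / real (qv v)" using Q by (simp add: exp_minus inverse_eq_divide)
    finally show ?thesis .
  qed
  have ne: "E 1 \<noteq> 1" unfolding E1 using Q by simp
  have "((\<lambda>s. inverse (1 - E s)) has_field_derivative (- (c * E 1) / (1 - E 1) ^ 2)) (at 1)"
    unfolding E_def using ne[unfolded E_def]
    by (auto intro!: derivative_eq_intros simp: power2_eq_square field_simps)
  then have "deriv (\<lambda>s. inverse (1 - E s)) 1 = - (c * E 1) / (1 - E 1) ^ 2" by (rule DERIV_imp_deriv)
  moreover have "- x / d ^ 2 / (- inverse d * c) * c = x / d" if "d \<noteq> 0" for x d :: complex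
    using that c0 by (simp add: power2_eq_square)
  ultimately have "Z_v v (w v) trivial_rep 1 * c = c * E 1 / (1 - E 1)"
    unfolding Z_v_def e c_def[symmetric] using ne by simp
  also have "\<dots> = of_real (ln (real (qv v)) * (1 / real (qv v)) / (1 - 1 / real (qv v)))"
    unfolding E1 c_def by simp
  also have "ln (real (qv v)) * (1 / real (qv v)) / (1 - 1 / real (qv v)) = ln (real (qv v)) / (real (qv v) - 1)"
    using Q by (simp add: field_simps)
  finally show ?thesis unfolding c_def .
qed

end

section \<open>The product of all absolute values\<close>

theorem mainTheorem2:
  fixes V :: "'q::{finite,field} poly set"
    and \<iota>\<^sub>i :: "'q ratbar \<Rightarrow> 'c::field" and abs\<^sub>i :: "'c \<Rightarrow> real"
    and \<iota> :: "'q poly \<Rightarrow> 'q ratbar \<Rightarrow> 'd::field" and abs\<^sub>v :: "'q poly \<Rightarrow> 'd \<Rightarrow> real"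
    and \<beta> :: 'c and u :: "'c fps \<Rightarrow> 'q poly"
  assumes "finite_places V"
    and "is_C_infinity \<iota>\<^sub>i abs\<^sub>i"
    and "\<And>v. v \<in> V \<Longrightarrow> is_C_v v (\<iota> v) (abs\<^sub>v v)"
    and "\<beta> ^ (CARD('q) - 1) = - inverse (theta \<iota>\<^sub>i)"
    and "u \<in> H_1_Betti \<iota>\<^sub>i abs\<^sub>i"
    and "u (fps_const \<beta> * ell_minus \<iota>\<^sub>i abs\<^sub>i) = 1"
  shows "abs_period_infinity \<iota>\<^sub>i abs\<^sub>i u > 0 \<and>
    (\<forall>v\<in>V. abs_period_v \<iota>\<^sub>i abs\<^sub>i v (\<iota> v) (abs\<^sub>v v) u > 0) \<and>
    (\<exists>S. has_regularized_sum V (\<lambda>v x. abs\<^sub>v v (\<iota> v x)) trivial_rep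
           (\<lambda>v. of_real (ln (abs_period_v \<iota>\<^sub>i abs\<^sub>i v (\<iota> v) (abs\<^sub>v v) u))) S \<and>
         of_real (ln (abs_period_infinity \<iota>\<^sub>i abs\<^sub>i u)) + S = 0)"
proof -
  interpret infty: carlitz_period \<iota>\<^sub>i abs\<^sub>i \<beta> u
    using assms(2,4,5,6) by unfold_locales (auto simp: is_C_infinity_def)
  have two: "two_places \<iota>\<^sub>i abs\<^sub>i \<beta> u (\<iota> v) (abs\<^sub>v v) v" if "v \<in> V" for v
    using assms(1) assms(3)[OF that] that
    by unfold_locales (auto simp: is_C_v_def finite_places_def)
  define w where "w = (\<lambda>v x. abs\<^sub>v v (\<iota> v x))"
  have w: "w v 0 = 0" if "v \<in> V" for v
  proof -
    interpret two_places \<iota>\<^sub>i abs\<^sub>i \<beta> u "\<iota> v" "abs\<^sub>v v" v by (rule two[OF that])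
    show ?thesis by (simp add: w_def \<iota>.map_zero)
  qed
  define x :: "'q poly \<Rightarrow> complex" where "x = (\<lambda>v. of_real (ln (abs_period_v \<iota>\<^sub>i abs\<^sub>i v (\<iota> v) (abs\<^sub>v v) u)))"
  have "x v + Z_v v (w v) trivial_rep 1 * of_real (ln (real (qv v))) = 0" if "v \<in> V" for v
  proof -
    have "x v = - of_real (ln (real (qv v)) / (real (qv v) - 1))"
      unfolding x_def two_places.ln_abs_period_v[OF two[OF that]] by simp
    moreover have "Z_v v (w v) trivial_rep 1 * of_real (ln (real (qv v))) = of_real (ln (real (qv v)) / (real (qv v) - 1))"
      by (rule Z_v_trivial[where w = w, OF assms(1) w that])
    ultimately show ?thesis by simp
  qed
  then have none: "{v \<in> V. x v + Z_v v (w v) trivial_rep 1 * of_real (ln (real (qv v))) \<noteq> 0} = {}" by auto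
  define S :: complex where "S = - of_real (real CARD('q) / (real CARD('q) - 1) * ln (real CARD('q)))"
  have "has_regularized_sum V w trivial_rep x S"
    unfolding has_regularized_sum_def Let_def none contragredient_trivial S_def
    using Z_infinity_trivial[where w = w, OF assms(1) w] mu_Art_trivial[of V w, OF assms(1) w] by simp
  moreover have "of_real (ln (abs_period_infinity \<iota>\<^sub>i abs\<^sub>i u)) + S = 0"
    unfolding infty.ln_abs_period_infinity S_def by simp
  ultimately show ?thesis
    using infty.abs_period_infinity_pos two_places.abs_period_v_pos[OF two] unfolding w_def x_def by blast
qed

end
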